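(* Let $N\ge 2$, $s\in(0,1)$, and let $\mathcal K_s$, $P_s$, $C_{N,s}$, $\tau_E$, $\sigma_s$ and $E_t$ be as described in the context. Let $E\subset\mathbb{R}^N$ be an open set such that $\partial E$ is of class $C^{1,\beta}$ for some $\beta>2s$ if $s\in(0,\tfrac12)$, and $\partial E$ is of class $C^3$ if $s\in[\tfrac12,1)$. For $y\in\partial E$ let $\nu(y)$ be the unit exterior normal of $E$ at $y$, and for $t>0$ small let $v(t,y)\in\mathbb{R}$ be any number such that $$y+v(t,y)\,t\,\nu(y)\in \partial E_t\cap B\big(y,\sigma_s(t)^{\frac1{2s}}\big).$$ Then, as $t\to0$, locally uniformly in $y\in\partial E$, $$ v(t,y)=\begin{cases} a_{N,s}\,H_s(y)+o_t(1) & \text{if } s\in(0,\tfrac12),\\[4pt] b_N(t)\,H(y)+O\!\left(\dfrac{1}{\log(\sigma_{1/2}(t))}\right) & \text{if } s=\tfrac12,\\[8pt] c_{N,s}\,H(y)+O\!\left(t^{\frac{2s-1}{2}}\right) & \text{if } s\in(\tfrac12,1), \end{cases} $$ where $o_t(1)\to0$ as $t\to0$, $H_s$ and $H$ are the fractional and normalized classical mean curvatures of $\partial E$ (defined in the context), and $$ a_{N,s}=\frac{C_{N,s}}{2\int_{\mathbb{R}^{N-1}}P_s(y',0)\,dy'},\qquad b_N(t)=\frac{\int_{B^{N-1}_{\sigma_{1/2}(t)^{-1}}}|y'|^2P_{1/2}(y',0)\,dy'}{2\,|\log(\sigma_{1/2}(t))|\int_{\mathbb{R}^{N-1}}P_{1/2}(y',0)\,dy'},\qquad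 c_{N,s}=\frac{\int_{\mathbb{R}^{N-1}}|y'|^2P_s(y',0)\,dy'}{2\int_{\mathbb{R}^{N-1}}P_s(y',0)\,dy'}, $$ with $B^{N-1}_\rho$ the ball of radius $\rho$ centred at $0$ in $\mathbb{R}^{N-1}$.
   Context: Kernel: $\mathcal K_s(x,t)=t^{-\frac{N}{2s}}P_s(t^{-\frac1{2s}}x)$ for $x\in\mathbb{R}^N$, $t>0$, where $P_s\in C^1(\mathbb{R}^N)$ is radially symmetric (so $P_s=\mathcal K_s(\cdot,1)$), and there are constants $\mathcal C_{N,s}>0$, $C_{N,s}>0$ with $$\frac{\mathcal C_{N,s}^{-1}}{1+|y|^{N+2s}}\le P_s(y)\le\frac{\mathcal C_{N,s}}{1+|y|^{N+2s}},\qquad |\nabla P_s(y)|\le\frac{\mathcal C_{N,s}}{1+|y|^{N+2s+1}}\quad(y\in\mathbb{R}^N),$$ and $\lim_{t\to0}t^{-1}\mathcal K_s(y,t)=\frac{C_{N,s}}{|y|^{N+2s}}$ locally uniformly in $\mathbb{R}^N\setminus\{0\}$. (Examples: the fractional heat kernel, i.e. the kernel with Fourier transform $e^{-t|\xi|^{2s}}$; or $\overline K_s(x,t^{1/2s})$ with $\overline K_s(x,t)=t^{-N}p_{N,s}(1+|x/t|^2)^{-\frac{N+2s}{2}}$.) For an open set $E$, $\tau_E=\mathbb 1_E-\mathbb 1_{\mathbb{R}^N\setminus\overline E}$, $u(x,t)=\int_{\mathbb{R}^N}\mathcal K_s(x-y,t)\tau_E(y)\,dy$, and $E_t=\{x\in\mathbb{R}^N: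 u(x,\sigma_s(t))>0\}$, where $\sigma_s(t)=t^{\frac{2s}{1+2s}}$ for $s\in(0,\frac12)$, $\sigma_s(t)=t^s$ for $s\in(\frac12,1)$, and $\sigma_{1/2}(t)$ is the unique positive solution of $t=\sigma_{1/2}(t)^2|\log(\sigma_{1/2}(t))|$. Fractional mean curvature ($s\in(0,\frac12)$): $H_s(x)=\lim_{\varepsilon\to0}\int_{\mathbb{R}^N\setminus B_\varepsilon(x)}\frac{\tau_E(y)}{|x-y|^{N+2s}}\,dy$ for $x\in\partial E$. Normalized mean curvature: for $x\in\partial E$, after a rigid motion taking $x$ to $0$ and the exterior normal $\nu(x)$ to $e_N$, near $0$ the set $E$ is $\{y_N<\gamma(y')\}$ with $\gamma(0)=0$, $\nabla\gamma(0)=0$, and $H(x)=\frac{\Delta\gamma(0)}{N-1}$ (the average of the principal curvatures, with the convention that $H=-1/R$ on the boundary of a ball of radius $R$). $O(f(t))$ denotes a quantity bounded by $C|f(t)|$ for a constant $C$.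
   Formalization: For s=1/2 the equation t=σ²|log σ| has three positive solutions when t>0 is small, so "the unique positive solution" is not defined; σ_{1/2}(t) is taken to be the unique solution in (0, e^{-1/2}), the one that tends to 0 as t→0. *)

theory Defs
  imports "HOL-Analysis.Analysis"
begin

text \<open>Ambient space: R^N is modelled as the product type 'm \<times> real, where 'm is a
  Euclidean space of dimension N-1. A point is (y', y_N); N = DIM('m) + 1 \<ge> 2.\<close>

definition kernel :: "('a::euclidean_space \<Rightarrow> real) \<Rightarrow> real \<Rightarrow> 'a \<Rightarrow> real \<Rightarrow> real" where
  "kernel P s x t = t powr (- real DIM('a) / (2 * s)) * P (t powr (- 1 / (2 * s)) *\<^sub>R x)"

definition tau :: "'a::euclidean_space set \<Rightarrow> 'a \<Rightarrow> real" where
  "tau E y = indicator E y - indicator (- closure E) y"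

definition uu :: "('a::euclidean_space \<Rightarrow> real) \<Rightarrow> real \<Rightarrow> 'a set \<Rightarrow> 'a \<Rightarrow> real \<Rightarrow> real" where
  "uu P s E x t = (\<integral> y. kernel P s (x - y) t * tau E y \<partial>lborel)"

text \<open>sigma_{1/2}(t): the solution of t = sigma^2 |log sigma| on the branch sigma \<in> (0, e^{-1/2})
  (the one tending to 0 as t \<rightarrow> 0; it is unique there for 0 < t < 1/(2e)).\<close>
definition sigma :: "real \<Rightarrow> real \<Rightarrow> real" where
  "sigma s t = (if s < 1/2 then t powr (2 * s / (1 + 2 * s))
     else if s = 1/2 then (THE \<sigma>. 0 < \<sigma> \<and> \<sigma> < exp (- 1/2) \<and> t = \<sigma>\<^sup>2 * \<bar>ln \<sigma>\<bar>)
     else t powr s)"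

definition Et :: "('a::euclidean_space \<Rightarrow> real) \<Rightarrow> real \<Rightarrow> 'a set \<Rightarrow> real \<Rightarrow> 'a set" where
  "Et P s E t = {x. uu P s E x (sigma s t) > 0}"

definition frac_curv :: "real \<Rightarrow> 'a::euclidean_space set \<Rightarrow> 'a \<Rightarrow> real" where
  "frac_curv s E x = Lim (at_right 0)
     (\<lambda>\<epsilon>. \<integral> y. indicator (- ball x \<epsilon>) y * tau E y / norm (x - y) powr (real DIM('a) + 2 * s) \<partial>lborel)"

definition chart :: "('m::euclidean_space \<times> real) set \<Rightarrow> 'm \<times> real
     \<Rightarrow> ('m \<times> real \<Rightarrow> 'm \<times> real) \<Rightarrow> ('m \<Rightarrow> real) \<Rightarrow> real \<Rightarrow> bool" where
  "chart E y R \<gamma> r \<longleftrightarrow> orthogonal_transformation R \<and> r > 0 \<and> \<gamma> 0 = 0 \<and>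
     (\<gamma> has_derivative (\<lambda>h. 0)) (at 0) \<and>
     (\<forall>w \<in> ball 0 r. y + R w \<in> E \<longleftrightarrow> snd w < \<gamma> (fst w))"

definition C1_holder_on :: "real \<Rightarrow> ('m::euclidean_space \<Rightarrow> real) \<Rightarrow> 'm set \<Rightarrow> bool" where
  "C1_holder_on \<beta> \<gamma> U \<longleftrightarrow> (\<exists>D1 :: 'm \<Rightarrow> ('m \<Rightarrow>\<^sub>L real). \<exists>L.
     (\<forall>a \<in> U. (\<gamma> has_derivative blinfun_apply (D1 a)) (at a)) \<and>
     (\<forall>a \<in> U. \<forall>b \<in> U. norm (D1 a - D1 b) \<le> L * norm (a - b) powr \<beta>))"

definition C2_on :: "('m::euclidean_space \<Rightarrow> real) \<Rightarrow> 'm set \<Rightarrow> bool" where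
  "C2_on \<gamma> U \<longleftrightarrow> (\<exists>(D1 :: 'm \<Rightarrow> ('m \<Rightarrow>\<^sub>L real)) (D2 :: 'm \<Rightarrow> ('m \<Rightarrow>\<^sub>L ('m \<Rightarrow>\<^sub>L real))).
     (\<forall>a \<in> U. (\<gamma> has_derivative blinfun_apply (D1 a)) (at a)) \<and>
     (\<forall>a \<in> U. (D1 has_derivative blinfun_apply (D2 a)) (at a)) \<and>
     continuous_on U D2)"

definition C3_on :: "('m::euclidean_space \<Rightarrow> real) \<Rightarrow> 'm set \<Rightarrow> bool" where
  "C3_on \<gamma> U \<longleftrightarrow> (\<exists>(D1 :: 'm \<Rightarrow> ('m \<Rightarrow>\<^sub>L real)) (D2 :: 'm \<Rightarrow> ('m \<Rightarrow>\<^sub>L ('m \<Rightarrow>\<^sub>L real)))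
       (D3 :: 'm \<Rightarrow> ('m \<Rightarrow>\<^sub>L ('m \<Rightarrow>\<^sub>L ('m \<Rightarrow>\<^sub>L real)))).
     (\<forall>a \<in> U. (\<gamma> has_derivative blinfun_apply (D1 a)) (at a)) \<and>
     (\<forall>a \<in> U. (D1 has_derivative blinfun_apply (D2 a)) (at a)) \<and>
     (\<forall>a \<in> U. (D2 has_derivative blinfun_apply (D3 a)) (at a)) \<and>
     continuous_on U D3)"

definition boundary_C1beta :: "real \<Rightarrow> ('m::euclidean_space \<times> real) set \<Rightarrow> bool" where
  "boundary_C1beta \<beta> E \<longleftrightarrow> (\<forall>y \<in> frontier E. \<exists>R \<gamma> r. chart E y R \<gamma> r \<and> C1_holder_on \<beta> \<gamma> (ball 0 r))"

definition boundary_C3 :: "('m::euclidean_space \<times> real) set \<Rightarrow> bool" where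
  "boundary_C3 E \<longleftrightarrow> (\<forall>y \<in> frontier E. \<exists>R \<gamma> r. chart E y R \<gamma> r \<and> C3_on \<gamma> (ball 0 r))"

definition ext_normal :: "('m::euclidean_space \<times> real) set \<Rightarrow> 'm \<times> real \<Rightarrow> 'm \<times> real" where
  "ext_normal E y = (THE n. \<exists>R \<gamma> r. chart E y R \<gamma> r \<and> n = R (0, 1))"

definition laplacian0 :: "('m::euclidean_space \<Rightarrow> real) \<Rightarrow> real" where
  "laplacian0 \<gamma> = (\<Sum>b \<in> Basis. deriv (deriv (\<lambda>\<tau>. \<gamma> (\<tau> *\<^sub>R b))) 0)"

definition mean_curv :: "('m::euclidean_space \<times> real) set \<Rightarrow> 'm \<times> real \<Rightarrow> real" where
  "mean_curv E y = (THE h. \<exists>R \<gamma> r. chart E y R \<gamma> r \<and> C2_on \<gamma> (ball 0 r) \<and>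
       h = laplacian0 \<gamma> / real DIM('m))"

end

theory Submission
  imports Defs
begin

text \<open>With \<open>\<rho> = \<sigma>\<^sub>s(t)\<^bsup>1/(2s)\<^esup>\<close> and \<open>v t = a \<rho>\<close>, a boundary point of \<open>E\<^sub>t\<close> is a zero of \<open>u\<close>. In coordinates whose last axis is the
  normal at \<open>y\<close>, compare \<open>E\<close> with its tangent half space: the half space contributes \<open>- 2 a g0 + O(a\<^sup>2)\<close>, where
  \<open>g0 = \<integral> P\<^sub>s(y',0) dy'\<close>, and the deviation contributes the integral of the rescaled kernel against \<open>\<tau>\<^sub>E + sgn x\<^sub>N\<close>, which is
  supported in a thin region around the tangent plane.
  For \<open>s < 1/2\<close> this region is thin enough for \<open>\<bar>z\<bar>\<^bsup>-N-2s\<^esup>\<close> to be integrable over it, and dividing by \<open>\<rho>\<^bsup>2s\<^esup>\<close> gives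
  \<open>C\<^sub>N\<^sub>,\<^sub>s H\<^sub>s(y)\<close> in the limit. For \<open>s \<ge> 1/2\<close> the boundary is replaced by its osculating paraboloid at the cost \<open>O(\<rho>\<^bsup>2s\<^esup>)\<close>; the kernel is then frozen at
  \<open>x\<^sub>N = 0\<close>, and isotropy of \<open>P\<^sub>s(\<cdot>,0)\<close> turns the quadratic form into its trace, that is, into \<open>H(y)\<close>.
  Uniformity in \<open>y\<close> follows from Taylor expansions in finitely many fixed charts.\<close>

text \<open>Membership in the ball gives only \<open>\<bar>a\<bar> \<le> 1\<close>, so the expansion
  with error O(a^2) cannot be used at once. The half space term is therefore also bounded below by a
  multiple of |a| on that whole range. Comparison with the size of the deviation gives a =
  O(rho^(2s)) for s < 1/2 and a = O(rho^s) for s \<ge> 1/2; only then is a^2 harmless. The time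
  scale is dictated by v = a rho / t. Here t is rho^(1+2s) for s < 1/2, rho^2 |log rho| for s = 1/2
  and rho^2 for s > 1/2. Hence an error O(rho^(2s)) in a turns into O(1/|log sigma|) or
  O(t^((2s-1)/2)), while for s < 1/2 it has to be o(rho^(2s)). The value 1/2 is where the integral
  of |x'|^(2-N-2s) over R^(N-1), the weight of a paraboloid against the kernel tail, changes from
  converging at the origin to converging at infinity; at 1/2 it diverges logarithmically at both
  ends, hence the truncated moment in b_N. Normal and mean curvature are descriptions over all
  charts at y, each with its own rotation, so agreement between charts has to be proved before any
  of them can be used.\<close>

subsection \<open>Measure theory\<close>

text \<open>Uniqueness of Haar measure: evaluating the double integral of \<open>1\<^sub>A(x) 1\<^sub>B(x + y)\<close> in both orders gives
  \<open>M(A) \<lambda>(B) = \<lambda>(A) M(B)\<close>, here with the unit ball as \<open>B\<close>.\<close>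

lemma translation_invariant_eq_lborel:
  fixes M :: "'a::euclidean_space measure"
  assumes sets: "sets M = sets borel"
    and sf: "sigma_finite_measure M"
    and inv: "\<And>a. distr M borel (\<lambda>x. x + a) = M"
    and ball: "emeasure M (ball 0 1) = emeasure lborel (ball (0::'a) 1)"
  shows "M = lborel"
proof (rule measure_eqI)
  interpret M: sigma_finite_measure M by fact
  interpret L: sigma_finite_measure "lborel :: 'a measure" by (rule lborel.sigma_finite_measure_axioms)
  interpret pair_sigma_finite M "lborel :: 'a measure" ..
  show "sets M = sets lborel" using sets by simp
  fix A assume "A \<in> sets M"
  then have A[measurable]: "A \<in> sets borel" using sets by simp
  note [measurable_cong] = sets
  let ?B = "ball (0::'a) 1"
  have [measurable]: "?B \<in> sets borel" by simp
  have M_shift: "(\<integral>\<^sup>+x. f (x + a) \<partial>M) = (\<integral>\<^sup>+x. f x \<partial>M)" if [measurable]: "f \<in> borel_measurable borel" for f a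
    by (subst (2) inv[of a, symmetric]) (simp add: nn_integral_distr)
  have L_shift: "(\<integral>\<^sup>+y. indicator A (x - y) \<partial>lborel) = emeasure lborel A" for x :: 'a
  proof -
    have "(\<integral>\<^sup>+y. indicator A (x - y) \<partial>lborel) = (\<integral>\<^sup>+y. indicator A y \<partial>distr lborel borel (\<lambda>y. x + (-1) *\<^sub>R y))"
      by (simp add: nn_integral_distr del: nn_integral_indicator)
    also have "distr lborel borel (\<lambda>y. x + (-1) *\<^sub>R y) = lborel"
      using lborel_affine[of "-1" x] by (simp add: density_1)
    finally show ?thesis by simp
  qed
  have "emeasure M A * emeasure lborel ?B = (\<integral>\<^sup>+x. \<integral>\<^sup>+y. indicator A x * indicator ?B (x + y) \<partial>lborel \<partial>M)"
  proof -
    have "(\<integral>\<^sup>+y. indicator ?B (x + y) \<partial>lborel) = emeasure lborel ?B" for x :: 'a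
    proof -
      have "(\<integral>\<^sup>+y. indicator ?B (x + y) \<partial>lborel) = (\<integral>\<^sup>+y. indicator ?B y \<partial>distr lborel borel (\<lambda>y. x + y))"
        by (subst nn_integral_distr) auto
      then show ?thesis by (simp add: lborel_distr_plus)
    qed
    then show ?thesis by (simp add: nn_integral_cmult nn_integral_multc)
  qed
  also have "\<dots> = (\<integral>\<^sup>+y. \<integral>\<^sup>+x. indicator A x * indicator ?B (x + y) \<partial>M \<partial>lborel)"
    by (rule Fubini'[symmetric]) measurable
  also have "\<dots> = (\<integral>\<^sup>+y. \<integral>\<^sup>+x. indicator A (x - y) * indicator ?B x \<partial>M \<partial>lborel)"
  proof (rule nn_integral_cong)
    fix y :: 'a
    show "(\<integral>\<^sup>+x. indicator A x * indicator ?B (x + y) \<partial>M) = (\<integral>\<^sup>+x. indicator A (x - y) * indicator ?B x \<partial>M)"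
      using M_shift[of "\<lambda>x. indicator A (x - y) * indicator ?B x" y] by simp
  qed
  also have "\<dots> = (\<integral>\<^sup>+x. \<integral>\<^sup>+y. indicator A (x - y) * indicator ?B x \<partial>lborel \<partial>M)"
    by (rule Fubini') measurable
  also have "\<dots> = emeasure lborel A * emeasure M ?B"
    using sets by (simp add: nn_integral_multc L_shift nn_integral_cmult)
  finally have "emeasure M A * emeasure lborel ?B = emeasure lborel A * emeasure lborel ?B"
    using ball by simp
  moreover have "emeasure lborel ?B \<noteq> \<infinity>" "emeasure lborel ?B \<noteq> 0"
    using emeasure_lborel_ball_finite[of "0::'a" 1] by (auto simp: emeasure_ball unit_ball_vol_pos less_imp_neq ennreal_eq_0_iff not_le)
  ultimately show "emeasure M A = emeasure lborel A"
    by (auto simp: ennreal_mult_cancel_left mult.commute[of _ "emeasure lborel ?B"])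
qed

section \<open>Invariance of Lebesgue measure under orthogonal maps\<close>

lemma orthogonal_transformation_measurable:
  fixes T :: "'a::euclidean_space \<Rightarrow> 'a"
  assumes "orthogonal_transformation T"
  shows "T \<in> borel_measurable borel"
  using assms by (intro borel_measurable_continuous_onI linear_continuous_on)
    (simp add: orthogonal_transformation_linear flip: linear_conv_bounded_linear)

text \<open>The image measure is again translation invariant because
  \<open>T x + a = T (x + inv T a)\<close>, and an isometry maps the unit ball onto itself, which
  fixes the normalisation in the uniqueness of Haar measure.\<close>

lemma lborel_distr_orthogonal:
  fixes T :: "'a::euclidean_space \<Rightarrow> 'a"
  assumes T: "orthogonal_transformation T"
  shows "distr lborel borel T = lborel"
proof (rule translation_invariant_eq_lborel)
  have lin: "linear T" using T by (simp add: orthogonal_transformation_linear)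
  note [measurable] = orthogonal_transformation_measurable[OF T]
  have bij: "bij T" using T by (rule orthogonal_transformation_bij)
  have inv: "orthogonal_transformation (inv T)" using T by (rule orthogonal_transformation_inv)
  have vim: "emeasure (distr lborel borel T) (ball 0 r) = emeasure lborel (ball (0::'a) r)" for r
  proof -
    have "T -` ball 0 r = ball 0 r"
      using T by (auto simp: orthogonal_transformation_norm)
    then show ?thesis by (simp add: emeasure_distr)
  qed
  show "emeasure (distr lborel borel T) (ball 0 1) = emeasure lborel (ball (0::'a) 1)" by (rule vim)
  show "sets (distr lborel borel T) = sets borel" by simp
  show "sigma_finite_measure (distr lborel borel T)"
  proof
    show "\<exists>A. countable A \<and> A \<subseteq> sets (distr lborel borel T) \<and> \<Union> A = space (distr lborel borel T)
      \<and> (\<forall>a\<in>A. emeasure (distr lborel borel T) a \<noteq> \<infinity>)"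
    proof (intro exI conjI)
      show "countable (range (\<lambda>n::nat. ball (0::'a) (real n)))" by simp
      show "\<Union> (range (\<lambda>n::nat. ball (0::'a) (real n))) = space (distr lborel borel T)"
        by (auto intro: reals_Archimedean2)
      show "\<forall>a\<in>range (\<lambda>n::nat. ball (0::'a) (real n)). emeasure (distr lborel borel T) a \<noteq> \<infinity>"
        using emeasure_lborel_ball_finite[of "0::'a"] by (auto simp: vim less_top)
    qed auto
  qed
  fix a
  have "T x + a = T (x + inv T a)" for x
    using lin bij by (simp add: linear_add surj_f_inv_f bij_is_surj)
  then have "distr (distr lborel borel T) borel (\<lambda>x. x + a) = distr (distr lborel borel (\<lambda>x. x + inv T a)) borel T"
    by (simp add: distr_distr comp_def)
  also have "distr lborel borel (\<lambda>x. x + inv T a) = lborel"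
    using lborel_distr_plus[of "inv T a"] by (simp add: add.commute[of _ "inv T a"])
  finally show "distr (distr lborel borel T) borel (\<lambda>x. x + a) = distr lborel borel T" .
qed

section \<open>Integrals of powers of the norm\<close>

text \<open>A shell of radius about \<open>r * l ^ n\<close> contributes a constant times
  \<open>(l powr (e + DIM('a))) ^ n\<close>, a geometric series. The ratio \<open>l = 1/2\<close>
  serves punctured balls and \<open>l = 2\<close> serves exteriors of balls; the slack of a factor 2
  in both directions makes the shells cover in either case.\<close>

lemma nn_integral_norm_powr_shells:
  fixes X :: "'a::euclidean_space set"
  assumes l: "0 < l" "l powr (e + real DIM('a)) < 1" and r: "0 < r"
    and X: "X \<subseteq> (\<Union>n. {z. r * l ^ n / 2 \<le> norm z \<and> norm z \<le> 2 * (r * l ^ n)})"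
    and X_sets[measurable]: "X \<in> sets borel"
  shows "(\<integral>\<^sup>+z. ennreal (norm z powr e) * indicator X z \<partial>lborel) < \<infinity>"
proof -
  let ?d = "DIM('a)" and ?V = "unit_ball_vol (real DIM('a))"
  define A where "A n = {z::'a. r * l ^ n / 2 \<le> norm z \<and> norm z \<le> 2 * (r * l ^ n)}" for n
  have [measurable]: "A n \<in> sets borel" for n unfolding A_def by measurable
  \<comment> \<open>The factor \<open>2 powr \<bar>e\<bar>\<close> pays for replacing
    \<open>norm z\<close> by the shell radius for either sign of \<open>e\<close>; the last two
    factors are the volume of a ball of radius \<open>2 * r\<close>.\<close>
  define c where "c = 2 powr \<bar>e\<bar> * r powr e * ?V * (2 * r) ^ ?d"
  have c: "0 \<le> c" using r by (simp add: c_def)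
  have shell: "norm z powr e \<le> 2 powr \<bar>e\<bar> * (r * l ^ n) powr e" if "z \<in> A n" for z n
  proof -
    let ?x = "r * l ^ n"
    have x: "0 < ?x" using r l by simp
    have z: "?x / 2 \<le> norm z" "norm z \<le> 2 * ?x" using that by (auto simp: A_def)
    show ?thesis
    proof (cases "0 \<le> e")
      case True
      then have "norm z powr e \<le> (2 * ?x) powr e" using z by (intro powr_mono2) auto
      then show ?thesis using True x by (simp add: powr_mult)
    next
      case False
      then have "norm z powr e \<le> (?x / 2) powr e" using z x by (intro powr_mono2') auto
      also have "\<dots> = 2 powr (- e) * ?x powr e"
        using x by (simp add: powr_divide powr_minus field_simps)
      finally show ?thesis using False by simp
    qed
  qed
  have "(\<integral>\<^sup>+z. ennreal (norm z powr e) * indicator X z \<partial>lborel)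
      \<le> (\<integral>\<^sup>+z. (\<Sum>n. ennreal (norm z powr e) * indicator (A n) z) \<partial>lborel)"
  proof (rule nn_integral_mono)
    fix z
    show "ennreal (norm z powr e) * indicator X z \<le> (\<Sum>n. ennreal (norm z powr e) * indicator (A n) z)"
    proof (cases "z \<in> X")
      case True
      then obtain n where "z \<in> A n" using X by (auto simp: A_def)
      then have "ennreal (norm z powr e) * indicator X z = (\<Sum>k\<in>{n}. ennreal (norm z powr e) * indicator (A k) z)"
        using True by simp
      also have "\<dots> \<le> (\<Sum>n. ennreal (norm z powr e) * indicator (A n) z)"
        by (rule sum_le_suminf) auto
      finally show ?thesis .
    qed simp
  qed
  also have "\<dots> = (\<Sum>n. \<integral>\<^sup>+z. ennreal (norm z powr e) * indicator (A n) z \<partial>lborel)"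
    by (rule nn_integral_suminf) simp
  also have "\<dots> \<le> (\<Sum>n. ennreal (c * (l powr (e + ?d)) ^ n))"
  proof (intro suminf_le allI)
    fix n
    let ?x = "r * l ^ n"
    have x: "0 < ?x" using r l by simp
    have "(\<integral>\<^sup>+z. ennreal (norm z powr e) * indicator (A n) z \<partial>lborel)
        \<le> (\<integral>\<^sup>+z. ennreal (2 powr \<bar>e\<bar> * ?x powr e) * indicator (cball (0::'a) (2 * ?x)) z \<partial>lborel)"
    proof (rule nn_integral_mono)
      fix z :: 'a
      show "ennreal (norm z powr e) * indicator (A n) z
          \<le> ennreal (2 powr \<bar>e\<bar> * ?x powr e) * indicator (cball 0 (2 * ?x)) z"
        using shell[of z n] by (auto simp: indicator_def A_def intro!: ennreal_leI)
    qed
    also have "\<dots> = ennreal (2 powr \<bar>e\<bar> * ?x powr e) * ennreal (?V * (2 * ?x) ^ ?d)"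
      using x by (subst nn_integral_cmult_indicator) (auto simp: emeasure_cball)
    also have "\<dots> = ennreal (2 powr \<bar>e\<bar> * ?x powr e * (?V * (2 * ?x) ^ ?d))"
      using x by (simp add: ennreal_mult')
    also have "2 powr \<bar>e\<bar> * ?x powr e * (?V * (2 * ?x) ^ ?d) = c * (l powr (e + ?d)) ^ n"
    proof -
      have "(l ^ n) powr e * (l ^ n) ^ ?d = (l powr (e + ?d)) ^ n"
        using l by (simp add: powr_add powr_realpow power_mult_distrib powr_power mult.commute
            flip: power_mult)
          (metis mult.commute powr_powr powr_realpow)
      then show ?thesis using r l by (simp add: c_def powr_mult power_mult_distrib)
    qed
    finally show "(\<integral>\<^sup>+z. ennreal (norm z powr e) * indicator (A n) z \<partial>lborel) \<le> ennreal (c * (l powr (e + ?d)) ^ n)" .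
  qed auto
  also have "\<dots> = ennreal (\<Sum>n. c * (l powr (e + ?d)) ^ n)"
    using c l by (intro suminf_ennreal2) (auto intro!: summable_mult)
  also have "\<dots> < \<infinity>" by simp
  finally show ?thesis .
qed

lemma ex_dyadic:
  assumes "1 \<le> (x::real)"
  shows "\<exists>n. 2 ^ n \<le> x \<and> x < 2 * 2 ^ n"
proof -
  obtain m where m: "x < 2 ^ m" using real_arch_pow[of 2 x] by auto
  define k where "k = (LEAST m. x < 2 ^ m)"
  have k: "x < 2 ^ k" unfolding k_def using m by (rule LeastI)
  then have "k \<noteq> 0" using assms by (intro notI) simp
  then obtain n where n: "k = Suc n" by (auto simp: gr0_conv_Suc)
  have "\<not> x < 2 ^ n" using n unfolding k_def by (metis lessI not_less_Least)
  then have "2 ^ n \<le> x \<and> x < 2 * 2 ^ n" using k n by simp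
  then show ?thesis ..
qed

lemma nn_integral_norm_powr_ball:
  assumes "- real DIM('a) < e"
  shows "(\<integral>\<^sup>+z. ennreal (norm z powr e) * indicator (ball (0::'a::euclidean_space) r) z \<partial>lborel) < \<infinity>"
proof (cases "0 < r")
  case True
  have "(\<integral>\<^sup>+z. ennreal (norm z powr e) * indicator (ball (0::'a) r - {0}) z \<partial>lborel) < \<infinity>"
  proof (rule nn_integral_norm_powr_shells[of "1/2" _ r])
    show "(1 / 2) powr (e + real DIM('a)) < 1" using assms powr_less_mono'[of "1/2" 0 "e + real DIM('a)"] by simp
    show "ball 0 r - {0} \<subseteq> (\<Union>n. {z::'a. r * (1 / 2) ^ n / 2 \<le> norm z \<and> norm z \<le> 2 * (r * (1 / 2) ^ n)})"
    proof
      fix z :: 'a assume z: "z \<in> ball 0 r - {0}"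
      then have "1 \<le> r / norm z" by simp
      from ex_dyadic[OF this] obtain n where n: "2 ^ n \<le> r / norm z" "r / norm z < 2 * 2 ^ n" by auto
      have "r * (1 / 2) ^ n / 2 \<le> norm z \<and> norm z \<le> 2 * (r * (1 / 2) ^ n)"
      proof
        show "r * (1 / 2) ^ n / 2 \<le> norm z" using n z by (simp add: field_simps)
        have "norm z * 2 ^ n \<le> r" using n z by (simp add: field_simps)
        also have "r \<le> 2 * r" using True by simp
        finally show "norm z \<le> 2 * (r * (1 / 2) ^ n)" by (simp add: field_simps)
      qed
      then show "z \<in> (\<Union>n. {z::'a. r * (1 / 2) ^ n / 2 \<le> norm z \<and> norm z \<le> 2 * (r * (1 / 2) ^ n)})" by auto
    qed
  qed (use True in auto)
  \<comment> \<open>No shell contains the origin, but restoring it changes nothing pointwise, since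
    \<open>0 powr e = 0\<close> for every exponent.\<close>
  also have "(\<integral>\<^sup>+z. ennreal (norm z powr e) * indicator (ball (0::'a) r - {0}) z \<partial>lborel)
     = (\<integral>\<^sup>+z. ennreal (norm z powr e) * indicator (ball (0::'a) r) z \<partial>lborel)"
    by (intro nn_integral_cong) (auto simp: indicator_def)
  finally show ?thesis .
qed (simp add: ball_empty)

lemma nn_integral_norm_powr_outside_ball:
  assumes "e < - real DIM('a)" "0 < r"
  shows "(\<integral>\<^sup>+z. ennreal (norm z powr e) * indicator (- ball (0::'a::euclidean_space) r) z \<partial>lborel) < \<infinity>"
proof (rule nn_integral_norm_powr_shells[of 2 _ r])
  show "2 powr (e + real DIM('a)) < 1" using assms powr_less_mono[of "e + real DIM('a)" 0 2] by simp
  show "- ball 0 r \<subseteq> (\<Union>n. {z::'a. r * 2 ^ n / 2 \<le> norm z \<and> norm z \<le> 2 * (r * 2 ^ n)})"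
  proof
    fix z :: 'a assume z: "z \<in> - ball 0 r"
    then have "1 \<le> norm z / r" using assms by simp
    from ex_dyadic[OF this] obtain n where n: "2 ^ n \<le> norm z / r" "norm z / r < 2 * 2 ^ n" by auto
    have "r * 2 ^ n / 2 \<le> norm z \<and> norm z \<le> 2 * (r * 2 ^ n)"
      using n assms by (simp add: field_simps)
    then show "z \<in> (\<Union>n. {z::'a. r * 2 ^ n / 2 \<le> norm z \<and> norm z \<le> 2 * (r * 2 ^ n)})" by auto
  qed
qed (use assms in auto)

lemma AE_lborel_neq: "AE x in lborel. x \<noteq> (c::'a::euclidean_space)"
  by (rule AE_I[of _ _ "{c}"]) auto

section \<open>Integrals over thin regions around a graph\<close>

lemma nn_integral_lborel_pair:
  fixes f :: "'a::euclidean_space \<times> 'b::euclidean_space \<Rightarrow> ennreal"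
  assumes "f \<in> borel_measurable borel"
  shows "(\<integral>\<^sup>+z. f z \<partial>lborel) = (\<integral>\<^sup>+x. \<integral>\<^sup>+y. f (x, y) \<partial>lborel \<partial>lborel)"
  unfolding lborel_prod[symmetric]
  by (rule lborel.nn_integral_fst[symmetric]) (simp add: lborel_prod assms)

text \<open>The vertical fibre over \<open>x\<close> has length
  \<open>2 * M * norm x powr \<alpha>\<close>, so integrating it out raises the exponent by
  \<open>\<alpha>\<close> and leaves an integral over the horizontal space, which has one dimension
  less.\<close>

lemma nn_integral_thin_region:
  fixes f :: "'m::euclidean_space \<times> real \<Rightarrow> ennreal"
  assumes f[measurable]: "f \<in> borel_measurable borel" and "0 \<le> c" "0 \<le> M"
    and bound: "\<And>z. fst z \<noteq> 0 \<Longrightarrow> f z \<le> ennreal (c * norm (fst z) powr e) *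
        indicator {z. norm (fst z) < r \<and> \<bar>snd z - q (fst z)\<bar> \<le> M * norm (fst z) powr \<alpha>} z"
  shows "(\<integral>\<^sup>+z. f z \<partial>lborel) \<le>
    ennreal (2 * c * M) * (\<integral>\<^sup>+(x::'m). ennreal (norm x powr (e + \<alpha>)) * indicator (ball 0 r) x \<partial>lborel)"
proof -
  have "(\<integral>\<^sup>+z. f z \<partial>lborel) = (\<integral>\<^sup>+x. \<integral>\<^sup>+y. f (x, y) \<partial>lborel \<partial>lborel)"
    by (rule nn_integral_lborel_pair) simp
  also have "\<dots> \<le> (\<integral>\<^sup>+(x::'m). ennreal (2 * c * M) * (ennreal (norm x powr (e + \<alpha>)) * indicator (ball 0 r) x) \<partial>lborel)"
  proof (rule nn_integral_mono_AE, rule AE_mp[OF AE_lborel_neq[of 0]], rule AE_I2, intro impI)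
    fix x :: 'm assume x: "x \<noteq> 0"
    let ?I = "cbox (q x - M * norm x powr \<alpha>) (q x + M * norm x powr \<alpha>)"
    have "(\<integral>\<^sup>+y. f (x, y) \<partial>lborel) \<le> (\<integral>\<^sup>+y. ennreal (c * norm x powr e) * indicator (ball 0 r) x * indicator ?I y \<partial>lborel)"
    proof (rule nn_integral_mono)
      fix y
      show "f (x, y) \<le> ennreal (c * norm x powr e) * indicator (ball 0 r) x * indicator ?I y"
        using bound[of "(x, y)"] x by (auto simp: indicator_def abs_le_iff split: if_splits)
    qed
    also have "\<dots> = ennreal (c * norm x powr e) * indicator (ball 0 r) x * ennreal (2 * (M * norm x powr \<alpha>))"
      using \<open>0 \<le> M\<close> by (subst nn_integral_cmult_indicator) auto
    also have "\<dots> = ennreal (2 * c * M) * (ennreal (norm x powr (e + \<alpha>)) * indicator (ball 0 r) x)"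
      using \<open>0 \<le> M\<close> \<open>0 \<le> c\<close>
      by (auto simp: indicator_def powr_add mult_ac simp flip: ennreal_mult)
    finally show "(\<integral>\<^sup>+y. f (x, y) \<partial>lborel) \<le> \<dots>" .
  qed
  also have "\<dots> = ennreal (2 * c * M) * (\<integral>\<^sup>+(x::'m). ennreal (norm x powr (e + \<alpha>)) * indicator (ball 0 r) x \<partial>lborel)"
    by (rule nn_integral_cmult) (intro borel_measurable_times_ennreal borel_measurable_indicator; simp)
  finally show ?thesis .
qed

text \<open>The two implications put every point outside the cylinder \<open>\<bar>x'\<bar> < r, \<bar>x\<^sub>N\<bar> < r\<close> into the set, so that \<open>thin\<close>
  contains all points at which a squeezed set may differ from the subgraph of \<open>q\<close>.\<close>

definition thin :: "('m::euclidean_space \<Rightarrow> real) \<Rightarrow> real \<Rightarrow> real \<Rightarrow> real \<Rightarrow> ('m \<times> real) set" where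
  "thin q M \<alpha> r = {z. norm (fst z) < r \<longrightarrow> \<bar>snd z\<bar> < r \<longrightarrow> \<bar>snd z - q (fst z)\<bar> \<le> M * norm (fst z) powr \<alpha>}"

lemma sets_thin[measurable]:
  assumes [measurable]: "q \<in> borel_measurable borel"
  shows "thin q M \<alpha> r \<in> sets borel"
proof -
  have [measurable]: "fst \<in> borel_measurable (borel :: ('a \<times> real) measure)" "snd \<in> borel_measurable (borel :: ('a \<times> real) measure)"
    by (simp_all add: borel_measurable_continuous_onI continuous_on_fst continuous_on_snd)
  show ?thesis unfolding thin_def by measurable
qed

lemma norm_fst_le': "norm (fst z) \<le> norm z" and norm_snd_le': "\<bar>snd (z :: 'a::euclidean_space \<times> real)\<bar> \<le> norm z"
  by (cases z; simp add: norm_Pair real_le_rsqrt)+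

text \<open>The bound \<open>B\<close> is fixed before \<open>q\<close>: only the length of the
  fibres enters, not their position. This is what later makes estimates uniform over boundary
  points. The two strict inequalities are integrability at the origin, after the gain of
  \<open>\<alpha>\<close>, and at infinity.\<close>

lemma thin_integral_bound:
  assumes "0 \<le> M" "0 < r" "p - real DIM('m::euclidean_space) < \<alpha>" "real DIM('m) + 1 < p"
  obtains B where "0 \<le> B" and "\<And>q :: 'm \<Rightarrow> real. q \<in> borel_measurable borel \<Longrightarrow>
    (\<integral>\<^sup>+z. ennreal (norm z powr - p) * indicator (thin q M \<alpha> r) z \<partial>lborel) \<le> ennreal B"
proof -
  define B1 where "B1 = (\<integral>\<^sup>+(x::'m). ennreal (norm x powr (- p + \<alpha>)) * indicator (ball 0 r) x \<partial>lborel)"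
  define B2 where "B2 = (\<integral>\<^sup>+(z::'m \<times> real). ennreal (norm z powr - p) * indicator (- ball 0 r) z \<partial>lborel)"
  have "B1 < \<infinity>" unfolding B1_def using assms by (intro nn_integral_norm_powr_ball) auto
  moreover have "B2 < \<infinity>" unfolding B2_def using assms by (intro nn_integral_norm_powr_outside_ball) auto
  ultimately have fin: "ennreal (2 * 1 * M) * B1 + B2 < \<infinity>" by (simp add: ennreal_mult_less_top)
  show ?thesis
  proof
    show "0 \<le> enn2real (ennreal (2 * 1 * M) * B1 + B2)" by simp
    fix q :: "'m \<Rightarrow> real" assume [measurable]: "q \<in> borel_measurable borel"
    have [measurable]: "fst \<in> borel_measurable (borel :: ('m \<times> real) measure)" "snd \<in> borel_measurable (borel :: ('m \<times> real) measure)"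
      by (simp_all add: borel_measurable_continuous_onI continuous_on_fst continuous_on_snd)
    define X where "X = {z :: 'm \<times> real. norm (fst z) < r \<and> \<bar>snd z - q (fst z)\<bar> \<le> M * norm (fst z) powr \<alpha>}"
    have [measurable]: "X \<in> sets borel" unfolding X_def by measurable
    have sub: "thin q M \<alpha> r \<subseteq> X \<union> - ball 0 r"
    proof
      fix z assume z: "z \<in> thin q M \<alpha> r"
      show "z \<in> X \<union> - ball 0 r"
      proof (cases "norm z < r")
        case True
        then have "norm (fst z) < r" "\<bar>snd z\<bar> < r" using norm_fst_le'[of z] norm_snd_le'[of z] by linarith+
        then show ?thesis using z by (simp add: thin_def X_def)
      qed simp
    qed
    have "(\<integral>\<^sup>+z. ennreal (norm z powr - p) * indicator (thin q M \<alpha> r) z \<partial>lborel)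
      \<le> (\<integral>\<^sup>+z. ennreal (norm z powr - p) * indicator X z + ennreal (norm z powr - p) * indicator (- ball 0 r) z \<partial>lborel)"
    proof (rule nn_integral_mono)
      fix z
      show "ennreal (norm z powr - p) * indicator (thin q M \<alpha> r) z
        \<le> ennreal (norm z powr - p) * indicator X z + ennreal (norm z powr - p) * indicator (- ball 0 r) z"
        using sub by (cases "z \<in> thin q M \<alpha> r") (auto simp: indicator_def)
    qed
    also have "\<dots> = (\<integral>\<^sup>+z. ennreal (norm z powr - p) * indicator X z \<partial>lborel) + B2"
      unfolding B2_def by (rule nn_integral_add) auto
    also have "(\<integral>\<^sup>+z. ennreal (norm z powr - p) * indicator X z \<partial>lborel) \<le> ennreal (2 * 1 * M) * B1"
      unfolding B1_def
    proof (rule nn_integral_thin_region[where q = q and e = "- p" and \<alpha> = \<alpha>])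
      fix z :: "'m \<times> real" assume z: "fst z \<noteq> 0"
      have "norm z powr - p \<le> norm (fst z) powr - p"
        using z assms norm_fst_le'[of z] by (intro powr_mono2') auto
      then show "ennreal (norm z powr - p) * indicator X z \<le> ennreal (1 * norm (fst z) powr - p) *
        indicator {z. norm (fst z) < r \<and> \<bar>snd z - q (fst z)\<bar> \<le> M * norm (fst z) powr \<alpha>} z"
        by (auto simp: indicator_def X_def intro!: ennreal_leI)
    qed (use assms in auto)
    finally show "(\<integral>\<^sup>+z. ennreal (norm z powr - p) * indicator (thin q M \<alpha> r) z \<partial>lborel)
        \<le> ennreal (enn2real (ennreal (2 * 1 * M) * B1 + B2))"
      using ennreal_enn2real[of "ennreal (2 * 1 * M) * B1 + B2"] fin by (simp only: add_right_mono infinity_ennreal_def)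
  qed
qed

subsection \<open>Charts and normals\<close>

text \<open>A description of the normal direction without reference to a chart, by the rays that
  enter or leave \<open>E\<close>. It fixes \<open>n\<close> only up to a positive factor, so that
  graph normals need not be normalised.\<close>

definition tangent :: "'a::euclidean_space set \<Rightarrow> 'a \<Rightarrow> 'a \<Rightarrow> bool" where
  "tangent E y n \<longleftrightarrow> (\<forall>w. (w \<bullet> n < 0 \<longrightarrow> (\<forall>\<^sub>F \<epsilon> in at_right 0. y + \<epsilon> *\<^sub>R w \<in> E)) \<and>
     (0 < w \<bullet> n \<longrightarrow> (\<forall>\<^sub>F \<epsilon> in at_right 0. y + \<epsilon> *\<^sub>R w \<notin> E)))"

text \<open>The open half space of \<open>n\<close> lies in the closed half space of
  \<open>m\<close>. Let \<open>u\<close> be the part of \<open>m\<close> orthogonal to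
  \<open>n\<close>; testing with \<open>u - \<epsilon> *\<^sub>R n\<close> gives
  \<open>u \<bullet> u \<le> \<epsilon> * (n \<bullet> m)\<close> for all positive
  \<open>\<epsilon>\<close>, hence \<open>u = 0\<close>.\<close>

lemma tangent_unique:
  assumes n: "tangent E y n" "n \<noteq> 0" and m: "tangent E y m" "m \<noteq> 0"
  shows "\<exists>c>0. m = c *\<^sub>R n"
proof -
  have le: "w \<bullet> m \<le> 0" if "w \<bullet> n < 0" for w
  proof (rule ccontr)
    assume "\<not> w \<bullet> m \<le> 0"
    then have "\<forall>\<^sub>F \<epsilon> in at_right 0. y + \<epsilon> *\<^sub>R w \<notin> E" using m by (simp add: tangent_def)
    moreover have "\<forall>\<^sub>F \<epsilon> in at_right 0. y + \<epsilon> *\<^sub>R w \<in> E" using n that by (simp add: tangent_def)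
    ultimately have "\<forall>\<^sub>F \<epsilon> in at_right (0::real). False" by eventually_elim simp
    then show False by simp
  qed
  define c where "c = (m \<bullet> n) / (n \<bullet> n)"
  define u where "u = m - c *\<^sub>R n"
  have nn: "0 < n \<bullet> n" using n by simp
  have un: "u \<bullet> n = 0" using nn by (simp add: u_def c_def inner_diff_left)
  have um: "u \<bullet> m = u \<bullet> u" using un by (simp add: u_def inner_diff_right)
  have "u \<bullet> u \<le> \<epsilon> * (n \<bullet> m)" if "0 < \<epsilon>" for \<epsilon>
    using le[of "u - \<epsilon> *\<^sub>R n"] that nn by (simp add: inner_diff_left un um)
  then have "u \<bullet> u \<le> 0"
  proof (rule_tac ccontr)
    assume *: "\<And>\<epsilon>. 0 < \<epsilon> \<Longrightarrow> u \<bullet> u \<le> \<epsilon> * (n \<bullet> m)" and "\<not> u \<bullet> u \<le> 0"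
    then have "0 < u \<bullet> u" by linarith
    moreover from this *[OF zero_less_one] have "0 < n \<bullet> m" by linarith
    ultimately have pos: "0 < u \<bullet> u" "0 < n \<bullet> m" .
    then have "0 < u \<bullet> u / (2 * (n \<bullet> m))" by simp
    from *[OF this] show False using pos by simp
  qed
  then have "u = 0" by (metis antisym inner_eq_zero_iff inner_ge_zero)
  then have mc: "m = c *\<^sub>R n" by (simp add: u_def)
  moreover have "0 \<le> c * (n \<bullet> n)" using le[of "- n"] nn mc by (simp add: inner_commute)
  then have "0 \<le> c" using nn by (simp add: zero_le_mult_iff)
  with mc m have "0 < c" by (cases "c = 0") auto
  ultimately show ?thesis by blast
qed

text \<open>The vector \<open>adjoint D 1\<close> is the gradient of \<open>\<gamma>\<close> at
  \<open>a\<close>, so the normal is the familiar (-gradient, 1), carried along by \<open>R\<close>.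
  Along a ray the difference quotient of \<open>\<gamma>\<close> decides on which side of the graph
  the ray starts.\<close>

lemma tangent_graph:
  fixes \<gamma> :: "'m::euclidean_space \<Rightarrow> real" and R :: "'m \<times> real \<Rightarrow> 'm \<times> real"
  assumes R: "orthogonal_transformation R"
    and desc: "\<And>w. w \<in> ball 0 r \<Longrightarrow> y0 + R w \<in> E \<longleftrightarrow> snd w < \<gamma> (fst w)"
    and a: "(a, \<gamma> a) \<in> ball 0 r"
    and D: "(\<gamma> has_derivative D) (at a)"
  shows "tangent E (y0 + R (a, \<gamma> a)) (R (- adjoint D 1, 1))"
proof -
  have linD: "linear D" using D by (rule has_derivative_linear)
  have linR: "linear R" using R by (simp add: orthogonal_transformation_linear)
  have main: "(w \<bullet> R (- adjoint D 1, 1) < 0 \<longrightarrow> (\<forall>\<^sub>F \<epsilon> in at_right 0. y0 + R (a, \<gamma> a) + \<epsilon> *\<^sub>R w \<in> E)) \<and>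
     (0 < w \<bullet> R (- adjoint D 1, 1) \<longrightarrow> (\<forall>\<^sub>F \<epsilon> in at_right 0. y0 + R (a, \<gamma> a) + \<epsilon> *\<^sub>R w \<notin> E))" for w
  proof -
    obtain \<xi> where \<xi>: "w = R \<xi>" using orthogonal_transformation_surj[OF R] by (metis surjD)
    obtain x z where xz: "\<xi> = (x, z)" by (cases \<xi>)
    have ip: "w \<bullet> R (- adjoint D 1, 1) = z - D x"
    proof -
      have "w \<bullet> R (- adjoint D 1, 1) = \<xi> \<bullet> (- adjoint D 1, 1)"
        unfolding \<xi> using R[unfolded orthogonal_transformation_def] by blast
      then show ?thesis using adjoint_works[OF linD, of x 1] by (simp add: xz inner_Pair)
    qed
    have pt: "y0 + R (a, \<gamma> a) + \<epsilon> *\<^sub>R w = y0 + R (a + \<epsilon> *\<^sub>R x, \<gamma> a + \<epsilon> * z)" for \<epsilon>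
    proof -
      have "(a + \<epsilon> *\<^sub>R x, \<gamma> a + \<epsilon> * z) = (a, \<gamma> a) + \<epsilon> *\<^sub>R (x, z)" by simp
      then show ?thesis using linR by (simp only: linear_add linear_scale \<xi> xz add.assoc)
    qed
    have in_ball: "\<forall>\<^sub>F \<epsilon> in at_right 0. (a + \<epsilon> *\<^sub>R x, \<gamma> a + \<epsilon> * z) \<in> ball 0 r"
    proof -
      have "((\<lambda>\<epsilon>. (a + \<epsilon> *\<^sub>R x, \<gamma> a + \<epsilon> * z)) \<longlongrightarrow> (a + 0 *\<^sub>R x, \<gamma> a + 0 * z)) (at_right 0)"
        by (intro tendsto_intros)
      from topological_tendstoD[OF this open_ball, of 0 r] show ?thesis using a by simp
    qed
    have "((\<lambda>\<epsilon>. \<gamma> (a + \<epsilon> *\<^sub>R x)) has_derivative (\<lambda>h. D (h *\<^sub>R x))) (at 0)"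
      by (rule has_derivative_compose[of "\<lambda>\<epsilon>. a + \<epsilon> *\<^sub>R x", where g = \<gamma>]) (use D in \<open>auto intro!: derivative_eq_intros\<close>)
    then have "((\<lambda>\<epsilon>. \<gamma> (a + \<epsilon> *\<^sub>R x)) has_field_derivative D x) (at 0)"
      using linD by (simp add: has_field_derivative_def linear_scale mult_commute_abs)
    then have "((\<lambda>\<epsilon>. (\<gamma> (a + \<epsilon> *\<^sub>R x) - \<gamma> a) / \<epsilon>) \<longlongrightarrow> D x) (at_right 0)"
      by (simp add: has_field_derivative_iff filterlim_at_split)
    note lim = order_tendstoD[OF this]
    have pos: "\<forall>\<^sub>F \<epsilon> in at_right 0. 0 < (\<epsilon>::real)" by (simp add: eventually_at_right_less)
    show ?thesis
    proof (intro conjI impI)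
      assume "w \<bullet> R (- adjoint D 1, 1) < 0"
      then have "z < D x" by (simp add: ip)
      from lim(1)[OF this] in_ball pos
      show "\<forall>\<^sub>F \<epsilon> in at_right 0. y0 + R (a, \<gamma> a) + \<epsilon> *\<^sub>R w \<in> E"
      proof eventually_elim
        case (elim \<epsilon>)
        then show ?case unfolding pt by (subst desc) (simp_all add: field_simps)
      qed
    next
      assume "0 < w \<bullet> R (- adjoint D 1, 1)"
      then have "D x < z" by (simp add: ip)
      from lim(2)[OF this] in_ball pos
      show "\<forall>\<^sub>F \<epsilon> in at_right 0. y0 + R (a, \<gamma> a) + \<epsilon> *\<^sub>R w \<notin> E"
      proof eventually_elim
        case (elim \<epsilon>)
        then show ?case unfolding pt by (subst desc) (simp_all add: field_simps)
      qed
    qed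
  qed
  then show ?thesis by (simp add: tangent_def)
qed

lemma chart_tangent:
  assumes "chart E y R \<gamma> r"
  shows "tangent E y (R (0, 1))"
proof -
  have R: "orthogonal_transformation R" and r: "0 < r" and g: "\<gamma> 0 = 0"
    and D: "(\<gamma> has_derivative (\<lambda>h. 0)) (at 0)"
    and desc: "\<And>w. w \<in> ball 0 r \<Longrightarrow> y + R w \<in> E \<longleftrightarrow> snd w < \<gamma> (fst w)"
    using assms by (auto simp: chart_def)
  have adj: "adjoint (\<lambda>h::'a. 0::real) 1 = 0"
    by (rule fun_cong[OF adjoint_unique, of _ "\<lambda>_. 0", simplified]) simp
  have R0: "R (0, 0) = 0" using R by (metis linear_0 orthogonal_transformation_linear zero_prod_def)
  have "tangent E (y + R (0, \<gamma> 0)) (R (- adjoint (\<lambda>h. 0::real) 1, 1))"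
  proof (rule tangent_graph[where r = r])
    show "(0, \<gamma> 0) \<in> ball 0 r" using r g by (simp add: zero_prod_def[symmetric])
  qed (use R desc D in auto)
  then show ?thesis using R0 by (simp add: adj g)
qed

lemma norm_chart_normal: "chart E y R \<gamma> r \<Longrightarrow> norm (R (0, 1)) = 1"
  by (simp add: chart_def orthogonal_transformation_norm norm_Pair)

lemma chart_normal_unique:
  assumes "chart E y R \<gamma> r" "chart E y R' \<gamma>' r'"
  shows "R (0, 1) = R' (0, 1)"
proof -
  have n: "norm (R (0, 1)) = 1" "norm (R' (0, 1)) = 1" using assms by (auto intro: norm_chart_normal)
  then have "R (0, 1) \<noteq> 0" "R' (0, 1) \<noteq> 0" by (metis norm_zero zero_neq_one)+
  from tangent_unique[OF chart_tangent[OF assms(1)] this(1) chart_tangent[OF assms(2)] this(2)]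
  obtain c where c: "0 < c" "R' (0, 1) = c *\<^sub>R R (0, 1)" by blast
  then have "c = 1" using n by simp
  then show ?thesis using c by simp
qed

lemma ext_normal_eq:
  assumes "chart E y R \<gamma> r"
  shows "ext_normal E y = R (0, 1)"
  unfolding ext_normal_def
proof (rule the_equality)
  show "\<exists>R' \<gamma> r. chart E y R' \<gamma> r \<and> R (0, 1) = R' (0, 1)" using assms by blast
  show "n = R (0, 1)" if "\<exists>R \<gamma> r. chart E y R \<gamma> r \<and> n = R (0, 1)" for n
    using that assms chart_normal_unique by blast
qed

text \<open>A chart describes \<open>E\<close> and not its frontier. A frontier point lies outside
  the open set \<open>E\<close>, hence on or above the graph; it is also a limit of points below the
  graph, and continuity of \<open>\<gamma>\<close> closes the gap.\<close>

lemma chart_cont_graph: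
  fixes \<gamma> :: "'m::euclidean_space \<Rightarrow> real"
  assumes ch: "chart E y0 R \<gamma> r" and E: "open E" and y: "y \<in> frontier E" and d: "dist y0 y < r"
    and cont: "\<And>x. x \<in> ball 0 r \<Longrightarrow> isCont \<gamma> x"
  shows "\<exists>a. y = y0 + R (a, \<gamma> a) \<and> norm (a, \<gamma> a) = dist y0 y"
proof -
  have R: "orthogonal_transformation R"
    and desc: "\<And>w. w \<in> ball 0 r \<Longrightarrow> y0 + R w \<in> E \<longleftrightarrow> snd w < \<gamma> (fst w)"
    using ch by (auto simp: chart_def)
  have R': "orthogonal_transformation (inv R)" using R by (rule orthogonal_transformation_inv)
  have RR: "R (inv R w) = w" for w using R by (metis orthogonal_transformation_surj surj_f_inv_f)
  define w where "w = inv R (y - y0)"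
  have Rw: "y = y0 + R w" by (simp add: w_def RR)
  have nw: "norm w = dist y0 y" using R' by (simp add: w_def orthogonal_transformation_norm dist_norm norm_minus_commute)
  have fw: "fst w \<in> ball 0 r" using d nw norm_fst_le'[of w] by simp
  have "y \<notin> E" using y E by (simp add: frontier_def interior_open)
  then have ge: "\<gamma> (fst w) \<le> snd w" using desc[of w] d nw Rw by simp
  obtain u where u: "\<And>n. u n \<in> E" "u \<longlonglongrightarrow> y"
    using y by (auto simp: frontier_def closure_sequential)
  define v where "v n = inv R (u n - y0)" for n
  have contR: "isCont (inv R) x" for x
    using R' by (intro linear_continuous_at) (simp add: orthogonal_transformation_linear flip: linear_conv_bounded_linear)
  have v: "v \<longlonglongrightarrow> w" unfolding v_def w_def
    by (rule isCont_tendsto_compose[OF contR]) (intro tendsto_intros u)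
  have "\<forall>\<^sub>F n in sequentially. v n \<in> ball 0 r"
    using v d nw by (intro topological_tendstoD[OF v]) auto
  then have ev: "\<forall>\<^sub>F n in sequentially. snd (v n) \<le> \<gamma> (fst (v n))"
  proof eventually_elim
    case (elim n)
    then show ?case using desc[OF elim] u(1)[of n] by (simp add: v_def RR)
  qed
  have "(\<lambda>n. \<gamma> (fst (v n))) \<longlonglongrightarrow> \<gamma> (fst w)"
    by (rule isCont_tendsto_compose[OF cont[OF fw]]) (intro tendsto_intros v)
  moreover have "(\<lambda>n. snd (v n)) \<longlonglongrightarrow> snd w" by (intro tendsto_intros v)
  ultimately have "snd w \<le> \<gamma> (fst w)"
    using tendsto_le[OF sequentially_bot _ _ ev] by blast
  with ge have "w = (fst w, \<gamma> (fst w))" by (simp add: prod_eq_iff)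
  then show ?thesis using Rw nw by metis
qed

text \<open>The uniform estimates near \<open>y\<close> come from one fixed chart at a nearby \<open>y0\<close>. Tilting the coordinates, instead of solving for
  the graph over the tangent plane at \<open>y\<close>, makes the implicit function theorem unnecessary.\<close>

lemma chart_tilt:
  fixes \<gamma>0 :: "'m::euclidean_space \<Rightarrow> real"
  assumes ch0: "chart E y0 R0 \<gamma>0 r0"
    and y: "y = y0 + R0 (a, \<gamma>0 a)" "norm (a, \<gamma>0 a) < r0 / 2"
    and D: "(\<gamma>0 has_derivative D) (at a)"
    and ch: "chart E y R \<gamma> r"
  defines "\<mu> \<equiv> norm (- adjoint D 1, 1::real)"
  shows "1 \<le> \<mu>"
    and "\<And>z. norm z < r0 / 2 \<Longrightarrow> y + R z \<in> E \<longleftrightarrow>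
      \<mu> * snd z < \<gamma>0 (a + fst (inv R0 (R z))) - \<gamma>0 a - D (fst (inv R0 (R z)))"
proof -
  have R0: "orthogonal_transformation R0" and R: "orthogonal_transformation R"
    and desc: "\<And>w. w \<in> ball 0 r0 \<Longrightarrow> y0 + R0 w \<in> E \<longleftrightarrow> snd w < \<gamma>0 (fst w)"
    using ch0 ch by (auto simp: chart_def)
  have RR: "R0 (inv R0 w) = w" for w using R0 by (metis orthogonal_transformation_surj surj_f_inv_f)
  have iR0: "orthogonal_transformation (inv R0)" using R0 by (rule orthogonal_transformation_inv)
  define n where "n = R0 (- adjoint D 1, 1)"
  have linD: "linear D" using D by (rule has_derivative_linear)
  have nn: "norm n = \<mu>" using R0 by (simp add: n_def \<mu>_def orthogonal_transformation_norm)
  show mu: "1 \<le> \<mu>" unfolding \<mu>_def using norm_snd_le'[of "(- adjoint D 1, 1::real)"] by simp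
  have n1: "norm (R (0, 1)) = 1" using ch by (rule norm_chart_normal)
  have "0 \<le> norm (a, \<gamma>0 a)" by simp
  with y(2) have "norm (a, \<gamma>0 a) < r0" by linarith
  then have tan: "tangent E y n" unfolding n_def y(1)
    by (intro tangent_graph[OF R0 desc _ D]) auto
  have "R (0, 1) \<noteq> 0" "n \<noteq> 0" using n1 nn mu by auto
  from tangent_unique[OF chart_tangent[OF ch] this(1) tan this(2)]
  obtain c where c: "0 < c" "n = c *\<^sub>R R (0, 1)" by blast
  then have cmu: "c = \<mu>" using n1 nn by simp
  fix z :: "'m \<times> real" assume z: "norm z < r0 / 2"
  define \<xi> where "\<xi> = inv R0 (R z)"
  have R0\<xi>: "R0 \<xi> = R z" by (simp add: \<xi>_def RR)
  have n\<xi>: "norm \<xi> = norm z" using R iR0 by (simp add: \<xi>_def orthogonal_transformation_norm)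
  \<comment> \<open>Height over the tangent plane of the fixed graph and height in the frame
    \<open>R\<close> are both inner products with the normal, which has length \<open>\<mu>\<close>
    in the first case and \<open>1\<close> in the second. Hence the factor
    \<open>\<mu>\<close>.\<close>
  have "snd \<xi> - D (fst \<xi>) = \<xi> \<bullet> (- adjoint D 1, 1)"
    using adjoint_works[OF linD, of "fst \<xi>" 1] by (cases \<xi>) (simp add: inner_Pair)
  also have "\<dots> = R0 \<xi> \<bullet> n" unfolding n_def using R0[unfolded orthogonal_transformation_def] by metis
  also have "\<dots> = \<mu> * (R z \<bullet> R (0, 1))" by (simp add: R0\<xi> c cmu)
  also have "R z \<bullet> R (0, 1) = z \<bullet> (0, 1)" using R[unfolded orthogonal_transformation_def] by blast
  also have "\<dots> = snd z" by (cases z) (simp add: inner_Pair)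
  finally have eq: "\<mu> * snd z = snd \<xi> - D (fst \<xi>)" by simp
  have "y + R z = y0 + R0 ((a, \<gamma>0 a) + \<xi>)"
    using R0 by (simp add: y(1) R0\<xi> linear_add orthogonal_transformation_linear add.assoc)
  moreover have "norm ((a, \<gamma>0 a) + \<xi>) < r0"
    using y(2) z n\<xi> norm_triangle_ineq[of "(a, \<gamma>0 a)" \<xi>] by linarith
  ultimately have "y + R z \<in> E \<longleftrightarrow> \<gamma>0 a + snd \<xi> < \<gamma>0 (a + fst \<xi>)"
    using desc[of "(a, \<gamma>0 a) + \<xi>"] by simp
  then show "y + R z \<in> E \<longleftrightarrow> \<mu> * snd z < \<gamma>0 (a + fst (inv R0 (R z))) - \<gamma>0 a - D (fst (inv R0 (R z)))"
    using eq by (auto simp flip: \<xi>_def)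
qed

section \<open>Enclosing the set between two graphs\<close>

text \<open>Only membership outside a band around the graph of \<open>q\<close> is prescribed.
  Inside the band nothing is claimed, so \<open>E\<close> need not be a graph in the frame
  \<open>R\<close>.\<close>

definition squeezed :: "('m::euclidean_space \<times> real) set \<Rightarrow> 'm \<times> real \<Rightarrow> ('m \<times> real \<Rightarrow> 'm \<times> real) \<Rightarrow>
    ('m \<Rightarrow> real) \<Rightarrow> real \<Rightarrow> real \<Rightarrow> real \<Rightarrow> bool" where
  "squeezed E y R q M \<alpha> r \<longleftrightarrow> (\<forall>z. norm z < r \<longrightarrow>
     (snd z < q (fst z) - M * norm (fst z) powr \<alpha> \<longrightarrow> y + R z \<in> E) \<and>
     (snd z > q (fst z) + M * norm (fst z) powr \<alpha> \<longrightarrow> y + R z \<notin> E))"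

lemma squeezed_mono:
  assumes "squeezed E y R q M \<alpha> r" "r' \<le> r" "M \<le> M'"
  shows "squeezed E y R q M' \<alpha> r'"
  unfolding squeezed_def
proof (intro allI impI)
  fix z :: "'a \<times> real" assume z: "norm z < r'"
  have "M * norm (fst z) powr \<alpha> \<le> M' * norm (fst z) powr \<alpha>" using assms(3) by (simp add: mult_right_mono)
  then show "(snd z < q (fst z) - M' * norm (fst z) powr \<alpha> \<longrightarrow> y + R z \<in> E) \<and>
    (snd z > q (fst z) + M' * norm (fst z) powr \<alpha> \<longrightarrow> y + R z \<notin> E)"
    using assms(1,2) z unfolding squeezed_def by (smt (verit))
qed

text \<open>A finite subcover, with the monotonicity of \<open>Q\<close> allowing the smallest
  radius and the largest constant to serve everywhere.\<close>

lemma compact_uniform: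
  fixes K :: "'a::metric_space set" and Q :: "'a \<Rightarrow> real \<Rightarrow> real \<Rightarrow> bool"
  assumes K: "compact K"
    and loc: "\<And>y0. y0 \<in> K \<Longrightarrow> \<exists>\<delta>>0. \<exists>r>0. \<exists>M. \<forall>y\<in>K. dist y0 y < \<delta> \<longrightarrow> Q y r M"
    and mono: "\<And>y r M r' M'. Q y r M \<Longrightarrow> 0 < r' \<Longrightarrow> r' \<le> r \<Longrightarrow> M \<le> M' \<Longrightarrow> Q y r' M'"
  shows "\<exists>r>0. \<exists>M\<ge>0. \<forall>y\<in>K. Q y r M"
proof -
  obtain \<delta> r M where d: "\<And>y0. y0 \<in> K \<Longrightarrow> 0 < \<delta> y0 \<and> 0 < r y0 \<and> (\<forall>y\<in>K. dist y0 y < \<delta> y0 \<longrightarrow> Q y (r y0) (M y0))"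
    using loc by metis
  obtain C where C: "C \<subseteq> K" "finite C" "K \<subseteq> (\<Union>c\<in>C. ball c (\<delta> c))"
  proof (rule compactE_image[OF K, of K "\<lambda>c. ball c (\<delta> c)"])
    show "K \<subseteq> (\<Union>c\<in>K. ball c (\<delta> c))" using d by force
  qed auto
  \<comment> \<open>The inserted values \<open>1\<close> and \<open>0\<close> keep both extrema
    defined for an empty cover; the latter also makes \<open>M'\<close> nonnegative.\<close>
  define r' where "r' = Min (insert 1 (r ` C))"
  define M' where "M' = Max (insert 0 (M ` C))"
  have "0 < r'" using C d by (auto simp: r'_def)
  moreover have "0 \<le> M'" using C by (simp add: M'_def)
  moreover have "Q y r' M'" if "y \<in> K" for y
  proof -
    have "y \<in> (\<Union>c\<in>C. ball c (\<delta> c))" using C(3) that by blast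
    then obtain c where c: "c \<in> C" "dist c y < \<delta> c" by auto
    then have "Q y (r c) (M c)" using d C that by blast
    then show ?thesis
      by (rule mono) (use c C \<open>0 < r'\<close> in \<open>auto simp: r'_def M'_def intro: Min_le Max_ge\<close>)
  qed
  ultimately show ?thesis by blast
qed

lemma C1_holder_taylor:
  fixes \<gamma> :: "'m::euclidean_space \<Rightarrow> real"
  assumes d: "\<And>a. a \<in> U \<Longrightarrow> (\<gamma> has_derivative blinfun_apply (D1 a)) (at a)"
    and h: "\<And>a b. a \<in> U \<Longrightarrow> b \<in> U \<Longrightarrow> norm (D1 a - D1 b) \<le> L * norm (a - b) powr \<beta>"
    and U: "convex U" "a \<in> U" "a + x \<in> U" and L: "0 \<le> L" "0 \<le> \<beta>"
  shows "\<bar>\<gamma> (a + x) - \<gamma> a - D1 a x\<bar> \<le> L * norm x powr (1 + \<beta>)"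
proof (cases "x = 0")
  case False
  have seg: "a + t *\<^sub>R x \<in> U" if "0 \<le> t" "t \<le> 1" for t
  proof -
    have "(1 - t) *\<^sub>R a + t *\<^sub>R (a + x) \<in> U" using U that by (intro convexD) auto
    then show ?thesis by (simp add: algebra_simps)
  qed
  have der: "((\<lambda>t. \<gamma> (a + t *\<^sub>R x) - t * D1 a x) has_field_derivative D1 (a + t *\<^sub>R x) x - D1 a x) (at t)"
    if "0 \<le> t" "t \<le> 1" for t
  proof -
    have "((\<lambda>t. \<gamma> (a + t *\<^sub>R x)) has_derivative (\<lambda>h. D1 (a + t *\<^sub>R x) (h *\<^sub>R x))) (at t)"
      by (rule has_derivative_compose[of "\<lambda>t. a + t *\<^sub>R x", where g = \<gamma>])
        (use d[OF seg[OF that]] in \<open>auto intro!: derivative_eq_intros\<close>)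
    then have "((\<lambda>t. \<gamma> (a + t *\<^sub>R x)) has_field_derivative D1 (a + t *\<^sub>R x) x) (at t)"
      by (simp add: has_field_derivative_def blinfun.scaleR_right mult_commute_abs)
    then show ?thesis by (auto intro!: derivative_eq_intros)
  qed
  obtain t where t: "0 < t" "t < 1" and eq: "\<gamma> (a + x) - D1 a x - \<gamma> a = D1 (a + t *\<^sub>R x) x - D1 a x"
    using MVT2[of 0 1 "\<lambda>t. \<gamma> (a + t *\<^sub>R x) - t * D1 a x" "\<lambda>t. D1 (a + t *\<^sub>R x) x - D1 a x"] der by auto
  have "\<bar>D1 (a + t *\<^sub>R x) x - D1 a x\<bar> \<le> norm (D1 (a + t *\<^sub>R x) - D1 a) * norm x"
    using norm_blinfun[of "D1 (a + t *\<^sub>R x) - D1 a" x] by (simp add: blinfun.diff_left)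
  also have "\<dots> \<le> (L * norm (t *\<^sub>R x) powr \<beta>) * norm x"
    using h[OF seg[of t] U(2)] t by (intro mult_right_mono) auto
  also have "norm (t *\<^sub>R x) powr \<beta> \<le> norm x powr \<beta>"
    using t L by (intro powr_mono2) (auto intro: mult_left_le_one_le)
  finally have "\<bar>D1 (a + t *\<^sub>R x) x - D1 a x\<bar> \<le> L * norm x powr \<beta> * norm x"
    using L by (simp add: mult_left_mono mult_right_mono)
  then show ?thesis using eq False by (simp add: powr_add mult_ac)
qed simp

text \<open>Taylor's formula in the fixed chart leaves an error in powers of the full
  \<open>norm z\<close>, because the tilt mixes horizontal and vertical coordinates, whereas the
  band is measured by \<open>norm (fst z)\<close>. If \<open>snd z\<close> is within the error, then
  it is at most half of \<open>norm z\<close> once \<open>r\<close> is small, so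
  \<open>norm z \<le> 2 * norm (fst z)\<close>; this is the origin of the factor
  \<open>2 powr (1 + \<beta>)\<close>.\<close>

lemma squeezed_C1_holder_local:
  assumes E: "open E" and ch0: "chart E y0 R0 \<gamma>0 r0" and hol: "C1_holder_on \<beta> \<gamma>0 (ball 0 r0)" and b: "0 < \<beta>"
  shows "\<exists>\<delta>>0. \<exists>r>0. \<exists>M. \<forall>y\<in>frontier E. dist y0 y < \<delta> \<longrightarrow>
    (\<forall>R \<gamma> r'. chart E y R \<gamma> r' \<longrightarrow> squeezed E y R (\<lambda>x. 0) M (1 + \<beta>) r)"
proof -
  obtain D1 :: "'a \<Rightarrow> 'a \<Rightarrow>\<^sub>L real" and L0 where d: "\<And>a. a \<in> ball 0 r0 \<Longrightarrow> (\<gamma>0 has_derivative blinfun_apply (D1 a)) (at a)"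
    and h0: "\<And>a b. a \<in> ball 0 r0 \<Longrightarrow> b \<in> ball 0 r0 \<Longrightarrow> norm (D1 a - D1 b) \<le> L0 * norm (a - b) powr \<beta>"
    using hol unfolding C1_holder_on_def by blast
  define L where "L = max L0 0"
  have h: "norm (D1 a - D1 b) \<le> L * norm (a - b) powr \<beta>" if "a \<in> ball 0 r0" "b \<in> ball 0 r0" for a b
    using h0[OF that] by (rule order_trans) (simp add: L_def mult_right_mono)
  have L: "0 \<le> L" by (simp add: L_def)
  have r0: "0 < r0" using ch0 by (simp add: chart_def)
  have R0: "orthogonal_transformation R0" using ch0 by (simp add: chart_def)
  have iR0: "orthogonal_transformation (inv R0)" using R0 by (rule orthogonal_transformation_inv)
  \<comment> \<open>The second bound ensures \<open>L * r powr \<beta> \<le> 1 / 2\<close>; the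
    \<open>+ 1\<close> avoids a division by zero when \<open>L = 0\<close>.\<close>
  define r where "r = min (r0 / 2) ((1 / (2 * (L + 1))) powr (1 / \<beta>))"
  have r: "0 < r" "r \<le> r0 / 2" using r0 L by (auto simp: r_def)
  have rb: "L * r powr \<beta> \<le> 1 / 2"
  proof -
    have "r powr \<beta> \<le> ((1 / (2 * (L + 1))) powr (1 / \<beta>)) powr \<beta>"
      using r b by (intro powr_mono2) (auto simp: r_def)
    also have "\<dots> = 1 / (2 * (L + 1))" using b L by (simp add: powr_powr)
    finally have "L * r powr \<beta> \<le> L * (1 / (2 * (L + 1)))" using L by (rule mult_left_mono)
    also have "\<dots> \<le> 1 / 2" using L by (simp add: field_simps)
    finally show ?thesis .
  qed
  have sq: "squeezed E y R (\<lambda>x. 0) (L * 2 powr (1 + \<beta>)) (1 + \<beta>) r"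
    if y: "y \<in> frontier E" "dist y0 y < r0 / 2" and ch: "chart E y R \<gamma> r'" for y R \<gamma> r'
  proof -
    have R: "orthogonal_transformation R" using ch by (simp add: chart_def)
    have "dist y0 y < r0" using y zero_le_dist[of y0 y] by linarith
    moreover have "isCont \<gamma>0 x" if "x \<in> ball 0 r0" for x using d[OF that] by (rule has_derivative_continuous)
    ultimately obtain a where a: "y = y0 + R0 (a, \<gamma>0 a)" "norm (a, \<gamma>0 a) = dist y0 y"
      using chart_cont_graph[OF ch0 E y(1)] by blast
    have na: "norm a < r0 / 2" using norm_fst_le'[of "(a, \<gamma>0 a)"] a y by simp
    then have aU: "a \<in> ball 0 r0" using r0 by simp
    have na2: "norm (a, \<gamma>0 a) < r0 / 2" using a y by simp
    note tilt = chart_tilt[OF ch0 a(1) na2 d[OF aU] ch]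
    define \<mu> where "\<mu> = norm (- adjoint (D1 a) 1, 1::real)"
    have mu: "1 \<le> \<mu>" using tilt(1) by (simp add: \<mu>_def)
    show ?thesis unfolding squeezed_def
    proof (intro allI impI)
      fix z :: "'a \<times> real" assume z: "norm z < r"
      define x where "x = fst (inv R0 (R z))"
      have nx: "norm x \<le> norm z"
        using norm_fst_le'[of "inv R0 (R z)"] R iR0 by (simp add: x_def orthogonal_transformation_norm)
      have E_iff: "y + R z \<in> E \<longleftrightarrow> \<mu> * snd z < \<gamma>0 (a + x) - \<gamma>0 a - D1 a x"
        using tilt(2)[of z] z r by (simp add: x_def \<mu>_def)
      have "norm (a + x) < r0" using norm_triangle_ineq[of a x] na nx z r by linarith
      then have "\<bar>\<gamma>0 (a + x) - \<gamma>0 a - D1 a x\<bar> \<le> L * norm x powr (1 + \<beta>)"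
        using aU L b by (intro C1_holder_taylor[where U = "ball 0 r0"]) (auto intro: d h)
      also have "\<dots> \<le> L * norm z powr (1 + \<beta>)"
        using nx L b by (intro mult_left_mono powr_mono2) auto
      finally have tay: "\<bar>\<gamma>0 (a + x) - \<gamma>0 a - D1 a x\<bar> \<le> L * norm z powr (1 + \<beta>)" .
      have thin: "L * norm z powr (1 + \<beta>) < \<bar>snd z\<bar>"
        if "L * 2 powr (1 + \<beta>) * norm (fst z) powr (1 + \<beta>) < \<bar>snd z\<bar>"
      proof (rule ccontr)
        assume "\<not> L * norm z powr (1 + \<beta>) < \<bar>snd z\<bar>"
        then have le: "\<bar>snd z\<bar> \<le> L * norm z powr (1 + \<beta>)" by simp
        also have "\<dots> = L * norm z powr \<beta> * norm z" by (cases "z = 0") (simp_all add: powr_add mult_ac)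
        also have "\<dots> \<le> (L * r powr \<beta>) * norm z"
          using z L b by (intro mult_right_mono mult_left_mono powr_mono2) auto
        also have "\<dots> \<le> 1 / 2 * norm z" using rb by (intro mult_right_mono) auto
        finally have "\<bar>snd z\<bar> \<le> norm z / 2" by simp
        moreover have "norm z \<le> norm (fst z) + \<bar>snd z\<bar>" using norm_Pair_le[of "fst z" "snd z"] by simp
        ultimately have "norm z \<le> 2 * norm (fst z)" by linarith
        then have "L * norm z powr (1 + \<beta>) \<le> L * (2 * norm (fst z)) powr (1 + \<beta>)"
          using L b by (intro mult_left_mono powr_mono2) auto
        then show False using le that by (simp add: powr_mult mult_ac)
      qed
      show "(snd z < 0 - L * 2 powr (1 + \<beta>) * norm (fst z) powr (1 + \<beta>) \<longrightarrow> y + R z \<in> E) \<and>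
        (0 + L * 2 powr (1 + \<beta>) * norm (fst z) powr (1 + \<beta>) < snd z \<longrightarrow> y + R z \<notin> E)"
      proof (intro conjI impI)
        assume *: "snd z < 0 - L * 2 powr (1 + \<beta>) * norm (fst z) powr (1 + \<beta>)"
        have "0 \<le> L * 2 powr (1 + \<beta>) * norm (fst z) powr (1 + \<beta>)" using L by simp
        then have neg: "snd z < 0" using * by linarith
        \<comment> \<open>Since \<open>\<mu> \<ge> 1\<close>, the tilt factor only moves
          \<open>snd z\<close> further away from zero, in the favourable direction.\<close>
        then have "\<mu> * snd z \<le> snd z" using mu by (simp add: mult_le_cancel_right2)
        moreover have "L * norm z powr (1 + \<beta>) < - snd z" using thin * neg by simp
        ultimately show "y + R z \<in> E" unfolding E_iff using tay by linarith
      next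
        assume *: "0 + L * 2 powr (1 + \<beta>) * norm (fst z) powr (1 + \<beta>) < snd z"
        have "0 \<le> L * 2 powr (1 + \<beta>) * norm (fst z) powr (1 + \<beta>)" using L by simp
        then have pos: "0 < snd z" using * by linarith
        then have "snd z \<le> \<mu> * snd z" using mu by simp
        moreover have "L * norm z powr (1 + \<beta>) < snd z" using thin * pos by simp
        ultimately show "y + R z \<notin> E" unfolding E_iff using tay by linarith
      qed
    qed
  qed
  show ?thesis
  proof (intro exI conjI ballI impI allI)
    show "0 < r0 / 2" "0 < r" using r0 r by auto
  qed (rule sq)
qed

lemma squeezed_C1_holder:
  assumes E: "open E" and bd: "boundary_C1beta \<beta> E" and b: "0 < \<beta>" and K: "compact K" "K \<subseteq> frontier E"
  shows "\<exists>r>0. \<exists>M\<ge>0. \<forall>y\<in>K. \<forall>R \<gamma> r'. chart E y R \<gamma> r' \<longrightarrow> squeezed E y R (\<lambda>x. 0) M (1 + \<beta>) r"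
proof (rule compact_uniform[OF K(1)])
  fix y0 assume y0: "y0 \<in> K"
  then obtain R0 \<gamma>0 r0 where "chart E y0 R0 \<gamma>0 r0" "C1_holder_on \<beta> \<gamma>0 (ball 0 r0)"
    using bd K by (meson boundary_C1beta_def subsetD)
  from squeezed_C1_holder_local[OF E this b]
  show "\<exists>\<delta>>0. \<exists>r>0. \<exists>M. \<forall>y\<in>K. dist y0 y < \<delta> \<longrightarrow>
    (\<forall>R \<gamma> r'. chart E y R \<gamma> r' \<longrightarrow> squeezed E y R (\<lambda>x. 0) M (1 + \<beta>) r)"
    using K by blast
qed (blast intro: squeezed_mono)

section \<open>Quadratic enclosure of a boundary of class C3\<close>

lemma C3_taylor:
  fixes \<gamma> :: "'m::euclidean_space \<Rightarrow> real"
  assumes d1: "\<And>a. a \<in> U \<Longrightarrow> (\<gamma> has_derivative blinfun_apply (D1 a)) (at a)"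
    and d2: "\<And>a. a \<in> U \<Longrightarrow> (D1 has_derivative blinfun_apply (D2 a)) (at a)"
    and d3: "\<And>a. a \<in> U \<Longrightarrow> (D2 has_derivative blinfun_apply (D3 a)) (at a)"
    and B: "\<And>a. a \<in> U \<Longrightarrow> norm (D3 a) \<le> B"
    and U: "convex U" "a \<in> U" "a + x \<in> U"
  shows "\<bar>\<gamma> (a + x) - \<gamma> a - D1 a x - D2 a x x / 2\<bar> \<le> B * norm x ^ 3"
proof -
  have seg: "a + t *\<^sub>R x \<in> U" if "0 \<le> t" "t \<le> 1" for t
  proof -
    have "(1 - t) *\<^sub>R a + t *\<^sub>R (a + x) \<in> U" using U that by (intro convexD) auto
    then show ?thesis by (simp add: algebra_simps)
  qed
  have line: "((\<lambda>t. a + t *\<^sub>R x) has_derivative (\<lambda>h. h *\<^sub>R x)) (at t)" for t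
    by (auto intro!: derivative_eq_intros)
  have e1: "((\<lambda>t. \<gamma> (a + t *\<^sub>R x)) has_field_derivative D1 (a + t *\<^sub>R x) x) (at t)"
    if "0 \<le> t" "t \<le> 1" for t
    using has_derivative_compose[OF line d1[OF seg[OF that]]]
    by (simp add: has_field_derivative_def blinfun.scaleR_right mult_commute_abs)
  have e2: "((\<lambda>t. D1 (a + t *\<^sub>R x) x) has_field_derivative D2 (a + t *\<^sub>R x) x x) (at t)"
    if "0 \<le> t" "t \<le> 1" for t
    using bounded_linear.has_derivative[OF blinfun.bounded_linear_left[of x] has_derivative_compose[OF line d2[OF seg[OF that]]]]
    by (simp add: has_field_derivative_def blinfun.scaleR_right blinfun.scaleR_left mult_commute_abs)
  have e3: "((\<lambda>t. D2 (a + t *\<^sub>R x) x x) has_field_derivative D3 (a + t *\<^sub>R x) x x x) (at t)"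
    if "0 \<le> t" "t \<le> 1" for t
    using bounded_linear.has_derivative[OF blinfun.bounded_linear_left[of x]
        bounded_linear.has_derivative[OF blinfun.bounded_linear_left[of x] has_derivative_compose[OF line d3[OF seg[OF that]]]]]
    by (simp add: has_field_derivative_def blinfun.scaleR_right blinfun.scaleR_left mult_commute_abs)
  \<comment> \<open>The successive derivatives along the segment, as the sequence that
    \<open>Maclaurin\<close> expects; indices beyond 3 are never reached.\<close>
  define f where "f m = (if m = 0 then (\<lambda>t. \<gamma> (a + t *\<^sub>R x)) else if m = 1 then (\<lambda>t. D1 (a + t *\<^sub>R x) x)
    else if m = 2 then (\<lambda>t. D2 (a + t *\<^sub>R x) x x) else (\<lambda>t. D3 (a + t *\<^sub>R x) x x x))" for m :: nat
  have "\<forall>m t. m < 3 \<and> 0 \<le> t \<and> t \<le> 1 \<longrightarrow> DERIV (f m) t :> f (Suc m) t"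
  proof (intro allI impI)
    fix m :: nat and t :: real assume *: "m < 3 \<and> 0 \<le> t \<and> t \<le> 1"
    then consider "m = 0" | "m = 1" | "m = 2" by linarith
    then show "DERIV (f m) t :> f (Suc m) t" using * e1 e2 e3 by cases (simp_all add: f_def)
  qed
  from Maclaurin[of 1 3 f "f 0", OF _ _ refl this] obtain t where t: "0 < t" "t < 1"
    and eq: "f 0 1 = (\<Sum>m<3. f m 0 / fact m * 1 ^ m) + f 3 t / fact 3 * 1 ^ 3" by auto
  have "\<gamma> (a + x) - \<gamma> a - D1 a x - D2 a x x / 2 = D3 (a + t *\<^sub>R x) x x x / 6"
    using eq by (simp add: f_def numeral_eq_Suc)
  moreover have "\<bar>D3 (a + t *\<^sub>R x) x x x\<bar> \<le> B * norm x ^ 3"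
  proof -
    have "\<bar>D3 (a + t *\<^sub>R x) x x x\<bar> \<le> norm (D3 (a + t *\<^sub>R x) x x) * norm x"
      using norm_blinfun[of "D3 (a + t *\<^sub>R x) x x" x] by simp
    also have "\<dots> \<le> norm (D3 (a + t *\<^sub>R x) x) * norm x * norm x"
      by (intro mult_right_mono norm_blinfun) simp
    also have "\<dots> \<le> norm (D3 (a + t *\<^sub>R x)) * norm x * norm x * norm x"
      by (intro mult_right_mono norm_blinfun) simp_all
    also have "\<dots> \<le> B * norm x * norm x * norm x"
      using B[OF seg[of t]] t by (intro mult_right_mono) simp_all
    finally show ?thesis by (simp add: power3_eq_cube mult_ac)
  qed
  ultimately show ?thesis by simp
qed

text \<open>\<open>B\<close> lives in ambient coordinates, so that it does not depend on the rotation \<open>R\<close> of the chart.\<close>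

definition curved :: "('m::euclidean_space \<times> real) set \<Rightarrow> 'm \<times> real \<Rightarrow> real \<Rightarrow> real \<Rightarrow> bool" where
  "curved E y r M \<longleftrightarrow> (\<exists>B :: 'm \<times> real \<Rightarrow> 'm \<times> real \<Rightarrow> real. bilinear B \<and> (\<forall>w. \<bar>B w w\<bar> \<le> M * (norm w)\<^sup>2) \<and>
     (\<forall>R \<gamma> r'. chart E y R \<gamma> r' \<longrightarrow> squeezed E y R (\<lambda>x. B (R (x, 0)) (R (x, 0))) M 3 r))"

lemma curved_mono:
  assumes "curved E y r M" "r' \<le> r" "M \<le> M'"
  shows "curved E y r' M'"
proof -
  have "M * (norm w)\<^sup>2 \<le> M' * (norm w)\<^sup>2" for w :: "'a \<times> real" using assms(3) by (simp add: mult_right_mono)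
  then show ?thesis using assms unfolding curved_def by (meson order_trans squeezed_mono)
qed

text \<open>Here \<open>x\<close>, \<open>z\<close> and \<open>l\<close> stand for the horizontal,
  vertical and full size of a point, and \<open>K * l * (\<bar>z\<bar> + x\<^sup>2)\<close> is the
  Taylor error after the tilt. With D = |z - q| one has |z| \<le> D + Q x^2 and l \<le> (1 + Q) x +
  D. The terms containing D are absorbed into D / 2 by the smallness of \<open>r\<close>; what is
  left is a multiple of x^3, which is half of the assumed lower bound for D.\<close>

lemma quadratic_error_absorbed:
  fixes x z q D K Q r l :: real
  assumes x: "0 \<le> x" "x \<le> r" and K: "0 \<le> K" and Q: "0 \<le> Q" and r: "K * (2 + Q) * r \<le> 1 / 2" "r \<le> 1"
    and l: "0 \<le> l" "l \<le> r" "l \<le> x + \<bar>z\<bar>" and q: "\<bar>q\<bar> \<le> Q * x\<^sup>2"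
    and gt: "2 * K * (1 + Q)\<^sup>2 * x ^ 3 < \<bar>z - q\<bar>"
  shows "K * l * (\<bar>z\<bar> + x\<^sup>2) < \<bar>z - q\<bar>"
proof -
  define D where "D = \<bar>z - q\<bar>"
  have D0: "0 \<le> D" by (simp add: D_def)
  have z: "\<bar>z\<bar> \<le> D + Q * x\<^sup>2" using q by (simp add: D_def)
  have x2: "x\<^sup>2 \<le> x" using x r by (simp add: power2_eq_square mult_left_le_one_le)
  have "Q * x\<^sup>2 \<le> Q * x" using x2 Q by (rule mult_left_mono)
  then have l2: "l \<le> (1 + Q) * x + D" using l z by (simp add: algebra_simps)
  have "K * l * (\<bar>z\<bar> + x\<^sup>2) \<le> K * l * (D + (1 + Q) * x\<^sup>2)"
    using z K l by (intro mult_left_mono) (auto simp: algebra_simps)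
  also have "\<dots> = K * l * D + K * ((1 + Q) * x\<^sup>2) * l" by (simp add: algebra_simps)
  also have "\<dots> \<le> K * r * D + K * ((1 + Q) * x\<^sup>2) * ((1 + Q) * x + D)"
    using l2 l K Q D0 by (intro add_mono mult_right_mono mult_left_mono) auto
  also have "\<dots> = K * r * D + K * (1 + Q) * x\<^sup>2 * D + K * (1 + Q)\<^sup>2 * x ^ 3"
    by (simp add: algebra_simps power2_eq_square power3_eq_cube)
  also have "\<dots> \<le> K * r * D + K * (1 + Q) * r * D + K * (1 + Q)\<^sup>2 * x ^ 3"
    using x2 x K Q D0 by (intro add_mono mult_right_mono mult_left_mono) auto
  also have "\<dots> = K * (2 + Q) * r * D + K * (1 + Q)\<^sup>2 * x ^ 3" by (simp add: algebra_simps)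
  also have "\<dots> \<le> 1 / 2 * D + K * (1 + Q)\<^sup>2 * x ^ 3"
    using mult_right_mono[OF r(1) D0] by simp
  also have "\<dots> < D" using gt by (simp add: D_def)
  finally show ?thesis by (simp add: D_def)
qed

lemma curved_C3_local:
  assumes E: "open E" and ch0: "chart E y0 R0 \<gamma>0 r0" and C3: "C3_on \<gamma>0 (ball 0 r0)"
  shows "\<exists>\<delta>>0. \<exists>r>0. \<exists>M. \<forall>y\<in>frontier E. dist y0 y < \<delta> \<longrightarrow> curved E y r M"
proof -
  obtain D1 :: "'a \<Rightarrow> 'a \<Rightarrow>\<^sub>L real" and D2 :: "'a \<Rightarrow> 'a \<Rightarrow>\<^sub>L 'a \<Rightarrow>\<^sub>L real" and D3 :: "'a \<Rightarrow> 'a \<Rightarrow>\<^sub>L 'a \<Rightarrow>\<^sub>L 'a \<Rightarrow>\<^sub>L real"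
    where d1: "\<And>a. a \<in> ball 0 r0 \<Longrightarrow> (\<gamma>0 has_derivative blinfun_apply (D1 a)) (at a)"
    and d2: "\<And>a. a \<in> ball 0 r0 \<Longrightarrow> (D1 has_derivative blinfun_apply (D2 a)) (at a)"
    and d3: "\<And>a. a \<in> ball 0 r0 \<Longrightarrow> (D2 has_derivative blinfun_apply (D3 a)) (at a)"
    and c3: "continuous_on (ball 0 r0) D3"
    using C3 unfolding C3_on_def by blast
  have r0: "0 < r0" using ch0 by (simp add: chart_def)
  have R0: "orthogonal_transformation R0" using ch0 by (simp add: chart_def)
  have iR0: "orthogonal_transformation (inv R0)" using R0 by (rule orthogonal_transformation_inv)
  have ilin: "linear (inv R0)" using iR0 by (simp add: orthogonal_transformation_linear)
  define U where "U = cball (0::'a) (r0 / 2)"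
  have U: "convex U" "compact U" "U \<subseteq> ball 0 r0" using r0 by (auto simp: U_def)
  have "compact (D3 ` U)" using U c3 by (meson compact_continuous_image continuous_on_subset)
  then obtain B3 where B3: "0 < B3" "\<And>a. a \<in> U \<Longrightarrow> norm (D3 a) \<le> B3"
    using compact_imp_bounded bounded_pos by (metis imageI)
  have "continuous_on (ball 0 r0) D2"
    using d3 by (meson continuous_at_imp_continuous_on has_derivative_continuous)
  then have "compact (D2 ` U)" using U by (meson compact_continuous_image continuous_on_subset)
  then obtain B2 where B2: "0 < B2" "\<And>a. a \<in> U \<Longrightarrow> norm (D2 a) \<le> B2"
    using compact_imp_bounded bounded_pos by (metis imageI)
  \<comment> \<open>\<open>B3\<close> comes from the Taylor remainder and \<open>2 * B2\<close> from
    half of the cross terms that appear when the tangential coordinate is replaced by its purely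
    horizontal part.\<close>
  define K where "K = 2 * B2 + B3"
  \<comment> \<open>The three bounds keep \<open>a + x\<close> in the compact ball \<open>U\<close>,
    give \<open>(snd z)\<^sup>2 \<le> \<bar>snd z\<bar>\<close>, and meet the smallness condition of
    \<open>quadratic_error_absorbed\<close>.\<close>
  define r where "r = min (min (r0 / 4) 1) (1 / (2 * (K * (2 + B2))))"
  have K: "0 < K" using B2 B3 by (simp add: K_def)
  have r: "0 < r" "r \<le> r0 / 4" "r \<le> 1" using r0 K B2 by (auto simp: r_def)
  have Kr: "K * (2 + B2) * r \<le> 1 / 2"
  proof -
    have "K * (2 + B2) * r \<le> K * (2 + B2) * (1 / (2 * (K * (2 + B2))))"
      using K B2 by (intro mult_left_mono) (auto simp: r_def)
    then show ?thesis using K B2 by simp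
  qed
  define M where "M = max B2 (2 * K * (1 + B2)\<^sup>2)"
  have cv: "curved E y r M" if y: "y \<in> frontier E" "dist y0 y < r0 / 4" for y
  proof -
    have "dist y0 y < r0" using y zero_le_dist[of y0 y] by linarith
    moreover have "isCont \<gamma>0 x" if "x \<in> ball 0 r0" for x using d1[OF that] by (rule has_derivative_continuous)
    ultimately obtain a where a: "y = y0 + R0 (a, \<gamma>0 a)" "norm (a, \<gamma>0 a) = dist y0 y"
      using chart_cont_graph[OF ch0 E y(1)] by blast
    have na: "norm a < r0 / 4" using norm_fst_le'[of "(a, \<gamma>0 a)"] a y by simp
    then have aU: "a \<in> U" using r0 by (simp add: U_def)
    have aB: "a \<in> ball 0 r0" using aU U by blast
    have na2: "norm (a, \<gamma>0 a) < r0 / 2" using a y r0 by simp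
    note tilt = chart_tilt[OF ch0 a(1) na2 d1[OF aB]]
    define \<mu> where "\<mu> = norm (- adjoint (D1 a) 1, 1::real)"
    have mu: "1 \<le> \<mu>" unfolding \<mu>_def using norm_snd_le'[of "(- adjoint (D1 a) 1, 1::real)"] by simp
    have D2le: "\<bar>D2 a x x'\<bar> \<le> B2 * norm x * norm x'" for x x'
    proof -
      have "\<bar>D2 a x x'\<bar> \<le> norm (D2 a x) * norm x'" using norm_blinfun[of "D2 a x" x'] by simp
      also have "\<dots> \<le> norm (D2 a) * norm x * norm x'" by (intro mult_right_mono norm_blinfun) simp
      also have "\<dots> \<le> B2 * norm x * norm x'" using B2(2)[OF aU] by (intro mult_right_mono) simp_all
      finally show ?thesis .
    qed
    \<comment> \<open>Half the second derivative of the fixed graph at \<open>a\<close>, pulled back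
      to the ambient space. The division by \<open>\<mu>\<close> matches the factor in front of
      \<open>snd z\<close> in the tilted description of \<open>E\<close>.\<close>
    define B where "B w w' = D2 a (fst (inv R0 w)) (fst (inv R0 w')) / (2 * \<mu>)" for w w'
    have bil: "bilinear B" unfolding bilinear_def
    proof (intro conjI allI)
      fix w
      show "linear (B w)" using ilin
        by (intro linearI) (simp_all add: B_def linear_add linear_scale blinfun.add_right blinfun.scaleR_right add_divide_distrib)
      show "linear (\<lambda>w'. B w' w)" using ilin
        by (intro linearI) (simp_all add: B_def linear_add linear_scale blinfun.add_left blinfun.scaleR_left blinfun.add_right blinfun.scaleR_right add_divide_distrib)
    qed
    have Bw: "\<bar>B w w\<bar> \<le> B2 * (norm w)\<^sup>2" for w
    proof -
      have "\<bar>B w w\<bar> \<le> \<bar>D2 a (fst (inv R0 w)) (fst (inv R0 w))\<bar>"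
        using mu mult_left_mono[of 1 "2 * \<mu>" "\<bar>D2 a (fst (inv R0 w)) (fst (inv R0 w))\<bar>"]
        by (simp add: B_def divide_le_eq)
      also have "\<dots> \<le> B2 * norm (fst (inv R0 w)) * norm (fst (inv R0 w))" by (rule D2le)
      also have "\<dots> \<le> B2 * norm w * norm w"
        using norm_fst_le'[of "inv R0 w"] iR0 B2 by (intro mult_mono) (auto simp: orthogonal_transformation_norm)
      finally show ?thesis by (simp add: power2_eq_square)
    qed
    have sq: "squeezed E y R (\<lambda>x. B (R (x, 0)) (R (x, 0))) (2 * K * (1 + B2)\<^sup>2) 3 r" if ch: "chart E y R \<gamma> r'" for R \<gamma> r'
      unfolding squeezed_def
    proof (intro allI impI)
      have R: "orthogonal_transformation R" using ch by (simp add: chart_def)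
      then have linR: "linear R" by (simp add: orthogonal_transformation_linear)
      fix z :: "'a \<times> real" assume z: "norm z < r"
      define x where "x = fst (inv R0 (R z))"
      define x0 where "x0 = fst (inv R0 (R (fst z, 0)))"
      define e where "e = fst (inv R0 (R (0, 1)))"
      let ?q = "B (R (fst z, 0)) (R (fst z, 0))"
      have nf: "norm (fst (inv R0 (R w))) \<le> norm w" for w
        using norm_fst_le'[of "inv R0 (R w)"] R iR0 by (simp add: orthogonal_transformation_norm)
      have nx: "norm x \<le> norm z" and nx0: "norm x0 \<le> norm (fst z)" and ne: "norm e \<le> 1"
        using nf[of z] nf[of "(fst z, 0)"] nf[of "(0, 1)"] by (simp_all add: x_def x0_def e_def norm_Pair)
      \<comment> \<open>The tangential coordinate seen by the fixed chart differs from that of the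
        horizontal part by a multiple of \<open>snd z\<close>. Hence replacing one by the other in
        the Hessian costs only \<open>\<bar>snd z\<bar> * norm z\<close> up to a constant.\<close>
      have xe: "x = x0 + snd z *\<^sub>R e"
      proof -
        have z_eq: "(fst z, 0) + snd z *\<^sub>R (0, 1) = z" by (cases z) simp
        have "inv R0 (R ((fst z, 0) + snd z *\<^sub>R (0, 1))) = inv R0 (R (fst z, 0)) + snd z *\<^sub>R inv R0 (R (0, 1))"
          by (simp only: linear_add[OF linR] linear_scale[OF linR] linear_add[OF ilin] linear_scale[OF ilin])
        then have "inv R0 (R z) = inv R0 (R (fst z, 0)) + snd z *\<^sub>R inv R0 (R (0, 1))"
          by (simp only: z_eq)
        then show ?thesis by (simp add: x_def x0_def e_def)
      qed
      have q: "2 * \<mu> * ?q = D2 a x0 x0" using mu by (simp add: B_def x0_def)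
      have "norm z < r0 / 2" using z r r0 by linarith
      then have E_iff: "y + R z \<in> E \<longleftrightarrow> \<mu> * snd z < \<gamma>0 (a + x) - \<gamma>0 a - D1 a x"
        using tilt(2)[OF ch, of z] by (simp add: x_def \<mu>_def)
      have "norm (a + x) \<le> r0 / 2" using norm_triangle_ineq[of a x] na nx z r by linarith
      then have "\<bar>\<gamma>0 (a + x) - \<gamma>0 a - D1 a x - D2 a x x / 2\<bar> \<le> B3 * norm x ^ 3"
        using aU U by (intro C3_taylor[where U = U and ?D3.0 = D3]) (auto intro: d1 d2 d3 B3 simp: U_def)
      also have "\<dots> \<le> B3 * norm z ^ 3" using nx B3 by (intro mult_left_mono power_mono) auto
      also have "\<dots> = B3 * norm z * (norm z)\<^sup>2" by (simp add: power2_eq_square power3_eq_cube)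
      also have "\<dots> \<le> B3 * norm z * (\<bar>snd z\<bar> + (norm (fst z))\<^sup>2)"
      proof (rule mult_left_mono)
        have "\<bar>snd z\<bar> \<le> 1" using norm_snd_le'[of z] z r by linarith
        then have "\<bar>snd z\<bar> * \<bar>snd z\<bar> \<le> \<bar>snd z\<bar> * 1" by (intro mult_left_mono) auto
        moreover have "(norm z)\<^sup>2 = (norm (fst z))\<^sup>2 + \<bar>snd z\<bar> * \<bar>snd z\<bar>"
          by (cases z) (simp add: norm_Pair power2_eq_square)
        ultimately show "(norm z)\<^sup>2 \<le> \<bar>snd z\<bar> + (norm (fst z))\<^sup>2" by simp
      qed (use B3 in auto)
      finally have tay: "\<bar>\<gamma>0 (a + x) - \<gamma>0 a - D1 a x - D2 a x x / 2\<bar> \<le> B3 * norm z * (\<bar>snd z\<bar> + (norm (fst z))\<^sup>2)" .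
      have "D2 a x x - D2 a x0 x0 = snd z * (D2 a x0 e + D2 a e x)"
        unfolding xe by (simp add: blinfun.add_left blinfun.add_right blinfun.scaleR_left blinfun.scaleR_right algebra_simps)
      also have "\<bar>\<dots>\<bar> \<le> \<bar>snd z\<bar> * (2 * B2 * norm z)"
      proof -
        have "\<bar>D2 a x0 e\<bar> \<le> B2 * norm z * 1"
          using D2le[of x0 e] nx0 ne B2 norm_fst_le'[of z]
          by (intro order_trans[OF D2le] mult_mono) auto
        moreover have "\<bar>D2 a e x\<bar> \<le> B2 * 1 * norm z"
          using nx ne B2 by (intro order_trans[OF D2le] mult_mono) auto
        ultimately have "\<bar>D2 a x0 e + D2 a e x\<bar> \<le> 2 * B2 * norm z" by linarith
        then show ?thesis by (simp add: abs_mult mult_left_mono)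
      qed
      also have "\<dots> \<le> 4 * B2 * norm z * (\<bar>snd z\<bar> + (norm (fst z))\<^sup>2)"
      proof -
        have "0 \<le> B2 * norm z * (\<bar>snd z\<bar> + 2 * (norm (fst z))\<^sup>2)" using B2 by simp
        then show ?thesis by (simp add: algebra_simps)
      qed
      finally have err: "\<bar>\<gamma>0 (a + x) - \<gamma>0 a - D1 a x - \<mu> * ?q\<bar> \<le> K * norm z * (\<bar>snd z\<bar> + (norm (fst z))\<^sup>2)"
        using tay q unfolding K_def by (simp add: algebra_simps)
      have absorbed: "K * norm z * (\<bar>snd z\<bar> + (norm (fst z))\<^sup>2) < \<bar>snd z - ?q\<bar>"
        if "2 * K * (1 + B2)\<^sup>2 * norm (fst z) powr 3 < \<bar>snd z - ?q\<bar>"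
      proof (rule quadratic_error_absorbed[where r = r and Q = B2])
        show "norm (fst z) \<le> r" using norm_fst_le'[of z] z by simp
        show "norm z \<le> norm (fst z) + \<bar>snd z\<bar>" using norm_Pair_le[of "fst z" "snd z"] by simp
        show "\<bar>?q\<bar> \<le> B2 * (norm (fst z))\<^sup>2"
          using Bw[of "R (fst z, 0)"] R by (simp add: orthogonal_transformation_norm norm_Pair)
      qed (use K B2 r Kr z that in auto)
      show "(snd z < ?q - 2 * K * (1 + B2)\<^sup>2 * norm (fst z) powr 3 \<longrightarrow> y + R z \<in> E) \<and>
        (?q + 2 * K * (1 + B2)\<^sup>2 * norm (fst z) powr 3 < snd z \<longrightarrow> y + R z \<notin> E)"
      proof (intro conjI impI)
        assume *: "snd z < ?q - 2 * K * (1 + B2)\<^sup>2 * norm (fst z) powr 3"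
        have "0 \<le> 2 * K * (1 + B2)\<^sup>2 * norm (fst z) powr 3" using K by simp
        then have neg: "snd z - ?q < 0" using * by linarith
        then have "\<mu> * (snd z - ?q) \<le> snd z - ?q" using mu by (simp add: mult_le_cancel_right2)
        moreover have "K * norm z * (\<bar>snd z\<bar> + (norm (fst z))\<^sup>2) < - (snd z - ?q)" using absorbed * neg by simp
        ultimately show "y + R z \<in> E" unfolding E_iff using err by (simp add: right_diff_distrib)
      next
        assume *: "?q + 2 * K * (1 + B2)\<^sup>2 * norm (fst z) powr 3 < snd z"
        have "0 \<le> 2 * K * (1 + B2)\<^sup>2 * norm (fst z) powr 3" using K by simp
        then have pos: "0 < snd z - ?q" using * by linarith
        then have "snd z - ?q \<le> \<mu> * (snd z - ?q)" using mu by simp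
        moreover have "K * norm z * (\<bar>snd z\<bar> + (norm (fst z))\<^sup>2) < snd z - ?q" using absorbed * pos by simp
        ultimately show "y + R z \<notin> E" unfolding E_iff using err by (simp add: right_diff_distrib)
      qed
    qed
    show ?thesis unfolding curved_def
    proof (intro exI conjI allI impI)
      show "bilinear B" by (rule bil)
      show "\<bar>B w w\<bar> \<le> M * (norm w)\<^sup>2" for w
        by (rule order_trans[OF Bw]) (simp add: M_def mult_right_mono)
      show "squeezed E y R (\<lambda>x. B (R (x, 0)) (R (x, 0))) M 3 r" if "chart E y R \<gamma> r'" for R \<gamma> r'
        by (rule squeezed_mono[OF sq[OF that]]) (simp_all add: M_def)
    qed
  qed
  show ?thesis
  proof (intro exI conjI ballI impI allI)
    show "0 < r0 / 4" "0 < r" using r0 r by auto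
  qed (rule cv)
qed

lemma curved_C3:
  assumes E: "open E" and bd: "boundary_C3 E" and K: "compact K" "K \<subseteq> frontier E"
  shows "\<exists>r>0. \<exists>M\<ge>0. \<forall>y\<in>K. curved E y r M"
proof (rule compact_uniform[OF K(1)])
  fix y0 assume y0: "y0 \<in> K"
  then obtain R0 \<gamma>0 r0 where "chart E y0 R0 \<gamma>0 r0" "C3_on \<gamma>0 (ball 0 r0)"
    using bd K by (meson boundary_C3_def subsetD)
  from curved_C3_local[OF E this]
  show "\<exists>\<delta>>0. \<exists>r>0. \<exists>M. \<forall>y\<in>K. dist y0 y < \<delta> \<longrightarrow> curved E y r M"
    using K by blast
qed (blast intro: curved_mono)

subsection \<open>Mean curvature\<close>

lemma bilinear_Basis_expansion:
  fixes B :: "'a::euclidean_space \<Rightarrow> 'a \<Rightarrow> real"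
  assumes B: "bilinear B"
  shows "B x x = (\<Sum>c\<in>Basis. \<Sum>d\<in>Basis. (x \<bullet> c) * (x \<bullet> d) * B c d)"
proof -
  have "B x x = B (\<Sum>c\<in>Basis. (x \<bullet> c) *\<^sub>R c) (\<Sum>c\<in>Basis. (x \<bullet> c) *\<^sub>R c)"
    by (simp add: euclidean_representation)
  also have "\<dots> = (\<Sum>c\<in>Basis. \<Sum>d\<in>Basis. B ((x \<bullet> c) *\<^sub>R c) ((x \<bullet> d) *\<^sub>R d))"
    by (simp only: bilinear_sum[OF B] sum.cartesian_product)
  finally show ?thesis by (simp add: bilinear_lmul[OF B] bilinear_rmul[OF B] mult_ac)
qed

text \<open>After expansion in the basis, summing over \<open>b\<close> first produces the inner
  products of \<open>inv R c\<close> and \<open>inv R d\<close>, which are those of \<open>c\<close>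
  and \<open>d\<close>.\<close>

lemma trace_orthogonal_invariant:
  fixes B :: "'a::euclidean_space \<Rightarrow> 'a \<Rightarrow> real" and R :: "'a \<Rightarrow> 'a"
  assumes B: "bilinear B" and R: "orthogonal_transformation R"
  shows "(\<Sum>b\<in>Basis. B (R b) (R b)) = (\<Sum>c\<in>Basis. B c c)"
proof -
  have iR: "orthogonal_transformation (inv R)" using R by (rule orthogonal_transformation_inv)
  have RR: "R (inv R w) = w" for w using R by (metis orthogonal_transformation_surj surj_f_inv_f)
  have ip: "R b \<bullet> c = inv R c \<bullet> b" for b c
    using R[unfolded orthogonal_transformation_def] by (metis RR inner_commute)
  note exp = bilinear_Basis_expansion[OF B]
  have "(\<Sum>b\<in>Basis. B (R b) (R b)) = (\<Sum>c\<in>Basis. \<Sum>d\<in>Basis. \<Sum>b\<in>Basis. (R b \<bullet> c) * (R b \<bullet> d) * B c d)"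
    by (subst exp, subst sum.swap, rule sum.cong[OF refl], rule sum.swap)
  also have "\<dots> = (\<Sum>c\<in>Basis. \<Sum>d\<in>Basis. (inv R c \<bullet> inv R d) * B c d)"
  proof (intro sum.cong refl)
    fix c d :: 'a
    show "(\<Sum>b\<in>Basis. (R b \<bullet> c) * (R b \<bullet> d) * B c d) = (inv R c \<bullet> inv R d) * B c d"
      unfolding euclidean_inner[of "inv R c" "inv R d"] ip sum_distrib_right ..
  qed
  also have "\<dots> = (\<Sum>c\<in>Basis. \<Sum>d\<in>Basis. (c \<bullet> d) * B c d)"
    using iR by (simp add: orthogonal_transformation_def)
  also have "\<dots> = (\<Sum>c\<in>Basis. \<Sum>d\<in>Basis. if d = c then B c c else 0)"
    by (intro sum.cong refl) (auto simp: inner_Basis)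
  finally show ?thesis by simp
qed

text \<open>The right side depends on \<open>R\<close> only through the normal
  \<open>R (0, 1)\<close>. Since all charts at a point share the normal, the tangential trace is the
  same in all of them.\<close>

lemma sum_horizontal_Basis:
  fixes B :: "'m::euclidean_space \<times> real \<Rightarrow> 'm \<times> real \<Rightarrow> real" and R :: "'m \<times> real \<Rightarrow> 'm \<times> real"
  assumes "bilinear B" "orthogonal_transformation R"
  shows "(\<Sum>b\<in>Basis. B (R (b, 0)) (R (b, 0))) = (\<Sum>c\<in>Basis. B c c) - B (R (0, 1)) (R (0, 1))"
proof -
  have "(\<Sum>b\<in>Basis. B (R b) (R b)) = (\<Sum>b\<in>(\<lambda>u. (u, 0)) ` Basis. B (R b) (R b)) + (\<Sum>b\<in>Pair 0 ` Basis. B (R b) (R b))"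
    unfolding Basis_prod_def by (rule sum.union_disjoint) auto
  also have "(\<Sum>b\<in>(\<lambda>u. (u, 0)) ` Basis. B (R b) (R b)) = (\<Sum>b\<in>Basis. B (R (b, 0)) (R (b, 0)))"
    by (subst sum.reindex) (auto simp: inj_on_def)
  finally show ?thesis using trace_orthogonal_invariant[OF assms] by simp
qed

text \<open>The enclosure forces \<open>\<gamma> (t *\<^sub>R x)\<close> to be within a cubic error
  of \<open>t\<^sup>2 * q x\<close>, so the quotient by \<open>t\<^sup>2\<close> tends to
  \<open>q x\<close>. By l'Hospital's rule the same quotient tends to half the second
  derivative.\<close>

lemma second_deriv_squeezed:
  fixes \<gamma> :: "'m::euclidean_space \<Rightarrow> real"
  assumes ch: "chart E y R \<gamma> r" and C2: "C2_on \<gamma> (ball 0 r)"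
    and sq: "squeezed E y R q M 3 r1" and r1: "0 < r1" and M: "0 \<le> M"
    and q: "\<And>t x. q (t *\<^sub>R x) = t\<^sup>2 * q x"
  shows "deriv (deriv (\<lambda>\<tau>. \<gamma> (\<tau> *\<^sub>R x))) 0 = 2 * q x"
proof -
  have r: "0 < r" and g0: "\<gamma> 0 = 0" and dg0: "(\<gamma> has_derivative (\<lambda>h. 0)) (at 0)"
    and desc: "\<And>w. w \<in> ball 0 r \<Longrightarrow> y + R w \<in> E \<longleftrightarrow> snd w < \<gamma> (fst w)"
    using ch by (auto simp: chart_def)
  obtain D1 :: "'m \<Rightarrow> 'm \<Rightarrow>\<^sub>L real" and D2 :: "'m \<Rightarrow> 'm \<Rightarrow>\<^sub>L 'm \<Rightarrow>\<^sub>L real"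
    where d1: "\<And>a. a \<in> ball 0 r \<Longrightarrow> (\<gamma> has_derivative blinfun_apply (D1 a)) (at a)"
      and d2: "\<And>a. a \<in> ball 0 r \<Longrightarrow> (D1 has_derivative blinfun_apply (D2 a)) (at a)"
    using C2 unfolding C2_on_def by blast
  define f where "f t = \<gamma> (t *\<^sub>R x)" for t
  define f1 where "f1 t = D1 (t *\<^sub>R x) x" for t
  have line: "((\<lambda>t. t *\<^sub>R x) has_derivative (\<lambda>h. h *\<^sub>R x)) (at t)" for t
    by (auto intro!: derivative_eq_intros)
  have line_tendsto: "((\<lambda>t. t *\<^sub>R x) \<longlongrightarrow> 0) (at (0::real))"
    by (auto intro!: tendsto_eq_intros)
  have small: "\<forall>\<^sub>F t in nhds 0. t *\<^sub>R x \<in> ball 0 r"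
    using eventually_nhds_in_open[OF open_vimage[OF open_ball, of "\<lambda>t. t *\<^sub>R x" 0 r], of 0] r
    by (simp add: continuous_intros)
  have e1: "(f has_field_derivative f1 t) (at t)" if "t *\<^sub>R x \<in> ball 0 r" for t
    using has_derivative_compose[OF line d1[OF that]]
    by (simp add: f_def[abs_def] f1_def has_field_derivative_def blinfun.scaleR_right mult_commute_abs)
  have e2: "(f1 has_field_derivative D2 0 x x) (at 0)"
    using bounded_linear.has_derivative[OF blinfun.bounded_linear_left[of x] has_derivative_compose[OF line, of D1 "D2 0" 0]] d2[of 0] r
    by (simp add: f1_def[abs_def] has_field_derivative_def blinfun.scaleR_right blinfun.scaleR_left mult_commute_abs)
  have f10: "f1 0 = 0"
    using has_derivative_unique[OF dg0 d1[of 0]] r by (simp add: f1_def fun_eq_iff)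
  have f0: "f 0 = 0" by (simp add: f_def g0)
  have "\<forall>\<^sub>F t in nhds 0. deriv f t = f1 t"
    using small by eventually_elim (rule DERIV_imp_deriv, rule e1)
  then have "deriv (deriv f) 0 = deriv f1 0" by (rule deriv_cong_ev) simp
  also have "\<dots> = D2 0 x x" using e2 by (rule DERIV_imp_deriv)
  finally have dd: "deriv (deriv f) 0 = D2 0 x x" .
  have small_right: "\<forall>\<^sub>F t in at_right 0. t *\<^sub>R x \<in> ball 0 r"
    using small by (auto simp: eventually_at_filter elim: eventually_mono)
  have pos: "\<forall>\<^sub>F t in at_right 0. 0 < (t::real)" by (simp add: eventually_at_right_less)
  have contf: "isCont f 0" using e1[of 0] r by (auto intro: DERIV_isCont)
  then have f_lim: "(f \<longlongrightarrow> 0) (at_right 0)" using f0 by (simp add: isCont_def filterlim_at_split)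
  have lim1: "((\<lambda>t. f t / t\<^sup>2) \<longlongrightarrow> D2 0 x x / 2) (at_right 0)"
  proof (rule lhopital_right_0[where f' = f1 and g' = "\<lambda>t. 2 * t"])
    show "((\<lambda>t. t\<^sup>2) \<longlongrightarrow> 0) (at_right (0::real))" by (auto intro!: tendsto_eq_intros)
    show "\<forall>\<^sub>F t in at_right 0. (t::real)\<^sup>2 \<noteq> 0" "\<forall>\<^sub>F t in at_right 0. 2 * (t::real) \<noteq> 0"
      using pos by (auto elim: eventually_mono)
    show "\<forall>\<^sub>F t in at_right 0. (f has_real_derivative f1 t) (at t)"
      using small_right by eventually_elim (rule e1)
    show "\<forall>\<^sub>F t in at_right 0. ((\<lambda>t. t\<^sup>2) has_real_derivative 2 * t) (at (t::real))"
      by (auto intro!: always_eventually derivative_eq_intros)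
    have "((\<lambda>t. (f1 t - f1 0) / (t - 0)) \<longlongrightarrow> D2 0 x x) (at_right 0)"
      using e2 by (simp add: has_field_derivative_iff filterlim_at_split)
    then have "((\<lambda>t. f1 t / t / 2) \<longlongrightarrow> D2 0 x x / 2) (at_right 0)"
      by (intro tendsto_intros) (simp_all add: f10)
    then show "((\<lambda>t. f1 t / (2 * t)) \<longlongrightarrow> D2 0 x x / 2) (at_right 0)" by (simp add: mult.commute)
  qed (rule f_lim)
  define e where "e t = M * norm (t *\<^sub>R x) powr 3" for t
  have e_eq: "e t = M * norm x ^ 3 * t ^ 3" if "0 < t" for t
    using that by (simp add: e_def powr_numeral power_mult_distrib)
  have e_ev: "\<forall>\<^sub>F t in at_right 0. M * norm x ^ 3 * t ^ 3 = e t"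
    using pos by eventually_elim (simp add: e_eq)
  have e_lim: "(e \<longlongrightarrow> 0) (at_right 0)"
    by (rule Lim_transform_eventually[OF _ e_ev]) (auto intro!: tendsto_eq_intros)
  have xl: "((\<lambda>t. t *\<^sub>R x) \<longlongrightarrow> 0) (at_right (0::real))"
    using line_tendsto by (simp add: filterlim_at_split)
  have ql: "((\<lambda>t. t\<^sup>2 * q x) \<longlongrightarrow> 0) (at_right 0)" by (auto intro!: tendsto_eq_intros)
  have b1: "\<forall>\<^sub>F t in at_right 0. (t *\<^sub>R x, f t) \<in> ball 0 (min r r1)"
    using topological_tendstoD[OF tendsto_Pair[OF xl f_lim] open_ball, of 0 "min r r1"] r r1 by (simp add: zero_prod_def)
  \<comment> \<open>Points of the graph lie outside \<open>E\<close> and therefore yield only the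
    lower bound for \<open>f t\<close>. For the upper bound the test point is halfway between the
    upper barrier and the graph: were the graph higher, that point would lie below it, hence in
    \<open>E\<close>, yet above the band, hence not in \<open>E\<close>.\<close>
  have "((\<lambda>t. (t\<^sup>2 * q x + e t + f t) / 2) \<longlongrightarrow> (0 + 0 + 0) / 2) (at_right 0)"
    by (intro tendsto_intros ql e_lim f_lim) simp
  then have b2: "\<forall>\<^sub>F t in at_right 0. (t *\<^sub>R x, (t\<^sup>2 * q x + e t + f t) / 2) \<in> ball 0 (min r r1)"
    using topological_tendstoD[OF tendsto_Pair[OF xl] open_ball, of _ 0 0 "min r r1"] r r1 by (simp add: zero_prod_def)
  have bound: "\<forall>\<^sub>F t in at_right 0. \<bar>f t / t\<^sup>2 - q x\<bar> \<le> M * norm x ^ 3 * t"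
    using b1 b2 pos
  proof eventually_elim
    case (elim t)
    have "y + R (t *\<^sub>R x, f t) \<notin> E" using elim(1) by (subst desc) (auto simp: f_def)
    then have 1: "t\<^sup>2 * q x - e t \<le> f t"
      using sq elim(1) unfolding squeezed_def by (force simp: q e_def)
    have 2: "f t \<le> t\<^sup>2 * q x + e t"
    proof (rule ccontr)
      assume "\<not> f t \<le> t\<^sup>2 * q x + e t"
      then have gt: "t\<^sup>2 * q x + e t < f t" by simp
      define u where "u = t\<^sup>2 * q x + e t"
      let ?z = "(t *\<^sub>R x, (u + f t) / 2)"
      have "y + R ?z \<in> E" using elim(2) gt by (subst desc) (auto simp: f_def u_def)
      moreover have eq: "q (fst ?z) + M * norm (fst ?z) powr 3 = u"
        by (simp only: fst_conv q e_def u_def)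
      have "u < snd ?z" using gt by (simp add: u_def[symmetric])
      then have "q (fst ?z) + M * norm (fst ?z) powr 3 < snd ?z" by (simp only: eq)
      then have "y + R ?z \<notin> E"
        using sq elim(2) unfolding squeezed_def u_def by auto
      ultimately show False by simp
    qed
    have "\<bar>f t - t\<^sup>2 * q x\<bar> \<le> e t" using 1 2 by (simp add: abs_le_iff)
    then have "\<bar>f t - t\<^sup>2 * q x\<bar> / t\<^sup>2 \<le> e t / t\<^sup>2" by (rule divide_right_mono) simp
    also have "\<bar>f t - t\<^sup>2 * q x\<bar> / t\<^sup>2 = \<bar>(f t - t\<^sup>2 * q x) / t\<^sup>2\<bar>"
      by (simp only: abs_divide abs_power2)
    also have "(f t - t\<^sup>2 * q x) / t\<^sup>2 = f t / t\<^sup>2 - q x"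
      using elim(3) by (simp add: diff_divide_distrib)
    finally show ?case using elim(3) by (simp add: e_eq power2_eq_square power3_eq_cube)
  qed
  have "((\<lambda>t. M * norm x ^ 3 * t) \<longlongrightarrow> 0) (at_right 0)" by (auto intro!: tendsto_eq_intros)
  then have "((\<lambda>t. \<bar>f t / t\<^sup>2 - q x\<bar>) \<longlongrightarrow> 0) (at_right 0)"
    by (intro tendsto_sandwich[OF always_eventually bound tendsto_const]) auto
  then have "((\<lambda>t. f t / t\<^sup>2 - q x) \<longlongrightarrow> 0) (at_right 0)" by (rule tendsto_rabs_zero_cancel)
  then have "((\<lambda>t. f t / t\<^sup>2) \<longlongrightarrow> q x) (at_right 0)" by (rule LIM_zero_cancel)
  with lim1 have "D2 0 x x / 2 = q x" by (intro tendsto_unique[OF trivial_limit_at_right_real])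
  then show ?thesis using dd by (simp add: f_def[abs_def])
qed

lemma C3_on_imp_C2_on:
  fixes \<gamma> :: "'m::euclidean_space \<Rightarrow> real"
  assumes "C3_on \<gamma> U"
  shows "C2_on \<gamma> U"
proof -
  obtain D1 :: "'m \<Rightarrow> 'm \<Rightarrow>\<^sub>L real" and D2 :: "'m \<Rightarrow> 'm \<Rightarrow>\<^sub>L 'm \<Rightarrow>\<^sub>L real" and D3
    where d: "\<forall>a\<in>U. (\<gamma> has_derivative blinfun_apply (D1 a)) (at a)"
      "\<forall>a\<in>U. (D1 has_derivative blinfun_apply (D2 a)) (at a)"
      "\<forall>a\<in>U. (D2 has_derivative blinfun_apply (D3 a)) (at a)"
    using assms unfolding C3_on_def by blast
  then have "continuous_on U D2"
    by (intro continuous_at_imp_continuous_on ballI) (rule has_derivative_continuous, blast)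
  with d show ?thesis unfolding C2_on_def by blast
qed

text \<open>In every chart the Laplacian is twice the trace of \<open>B\<close> without its normal
  entry, a value common to all charts. So the definite description in \<open>mean_curv\<close> has
  exactly one candidate.\<close>

lemma mean_curv_eq:
  fixes B :: "'m::euclidean_space \<times> real \<Rightarrow> 'm \<times> real \<Rightarrow> real"
  assumes B: "bilinear B"
    and sq: "\<And>R \<gamma> r. chart E y R \<gamma> r \<Longrightarrow> squeezed E y R (\<lambda>x. B (R (x, 0)) (R (x, 0))) M 3 r1"
    and r1: "0 < r1" and M: "0 \<le> M"
    and ch: "chart E y R \<gamma> r" and C2: "C2_on \<gamma> (ball 0 r)"
  shows "mean_curv E y = 2 * (\<Sum>b\<in>Basis. B (R (b, 0)) (R (b, 0))) / real DIM('m)"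
proof -
  have lap: "laplacian0 \<gamma> = 2 * ((\<Sum>c\<in>Basis. B c c) - B (ext_normal E y) (ext_normal E y))"
    if ch: "chart E y R \<gamma> r" and C2: "C2_on \<gamma> (ball 0 r)" for R \<gamma> r
  proof -
    have R: "orthogonal_transformation R" using ch by (simp add: chart_def)
    have "R (t *\<^sub>R x, 0) = t *\<^sub>R R (x, 0)" for t x
      using linear_scale[OF orthogonal_transformation_linear[OF R], of t "(x, 0)"] by simp
    then have "deriv (deriv (\<lambda>\<tau>. \<gamma> (\<tau> *\<^sub>R b))) 0 = 2 * B (R (b, 0)) (R (b, 0))" for b
      by (intro second_deriv_squeezed[OF ch C2 sq[OF ch] r1 M])
        (simp add: bilinear_lmul[OF B] bilinear_rmul[OF B] power2_eq_square)
    then show ?thesis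
      by (simp add: laplacian0_def ext_normal_eq[OF ch] sum_horizontal_Basis[OF B R] flip: sum_distrib_left)
  qed
  have "mean_curv E y = laplacian0 \<gamma> / real DIM('m)"
    unfolding mean_curv_def
  proof (rule the_equality)
    show "\<exists>R \<gamma>' r. chart E y R \<gamma>' r \<and> C2_on \<gamma>' (ball 0 r) \<and> laplacian0 \<gamma> / real DIM('m) = laplacian0 \<gamma>' / real DIM('m)"
      using ch C2 by blast
    show "h = laplacian0 \<gamma> / real DIM('m)"
      if "\<exists>R \<gamma> r. chart E y R \<gamma> r \<and> C2_on \<gamma> (ball 0 r) \<and> h = laplacian0 \<gamma> / real DIM('m)" for h
    proof -
      from that obtain R' \<gamma>' r' where "chart E y R' \<gamma>' r'" "C2_on \<gamma>' (ball 0 r')" "h = laplacian0 \<gamma>' / real DIM('m)" by blast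
      then show ?thesis by (simp only: lap[OF ch C2] lap[of R' \<gamma>' r'])
    qed
  qed
  moreover have "orthogonal_transformation R" using ch by (simp add: chart_def)
  ultimately show ?thesis
    by (simp add: lap[OF ch C2] ext_normal_eq[OF ch] sum_horizontal_Basis[OF B])
qed

subsection \<open>The kernel and the half space\<close>

lemma powr_le_one_plus_powr:
  fixes x :: real
  assumes "0 \<le> x" "0 \<le> \<kappa>" "\<kappa> \<le> q"
  shows "x powr \<kappa> \<le> 1 + x powr q"
proof (cases "x \<le> 1")
  case True
  then have "x powr \<kappa> \<le> 1" using assms by (cases "x = 0") (auto intro: powr_le1)
  then show ?thesis by (simp add: add_increasing2)
next
  case False
  then have "x powr \<kappa> \<le> x powr q" using assms by (intro powr_mono) auto
  then show ?thesis by simp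
qed

text \<open>Decay of order \<open>q\<close> may be traded for any weaker order
  \<open>\<kappa>\<close>. After scaling, a larger \<open>\<kappa>\<close> gives a higher power of
  the scale and a stronger singularity at the origin; the balance is chosen anew in each
  estimate.\<close>

lemma inverse_one_plus_powr_le:
  fixes x :: real
  assumes "0 < x" "0 \<le> \<kappa>" "\<kappa> \<le> q"
  shows "1 / (1 + x powr q) \<le> x powr - \<kappa>"
proof -
  have "x powr \<kappa> * x powr - \<kappa> = 1" using assms by (simp flip: powr_add)
  then have "1 \<le> (1 + x powr q) * x powr - \<kappa>"
    using mult_right_mono[OF powr_le_one_plus_powr[of x \<kappa> q], of "x powr - \<kappa>"] assms by simp
  moreover have "0 < 1 + x powr q" by (simp add: add_pos_nonneg)
  ultimately show ?thesis by (simp add: divide_le_eq mult.commute)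
qed

lemma norm_scaleR_inverse_powr:
  fixes z :: "'a::real_normed_vector"
  assumes "0 < \<rho>"
  shows "norm (z /\<^sub>R \<rho>) powr - \<kappa> = \<rho> powr \<kappa> * norm z powr - \<kappa>"
proof -
  have "norm (z /\<^sub>R \<rho>) = norm z / \<rho>" using assms by (simp add: divide_inverse mult.commute)
  then show ?thesis using assms by (simp add: powr_divide powr_minus field_simps)
qed

text \<open>Moving the centre by at most one unit changes the weight only by a constant factor, so
  kernels centred at different shifts share one majorant.\<close>

lemma one_plus_norm_powr_shift:
  fixes z w :: "'a::real_normed_vector"
  assumes "norm w \<le> 1" "0 \<le> q"
  shows "1 + norm z powr q \<le> (1 + 2 powr q) * (1 + norm (z - w) powr q)"
proof -
  have tri: "norm z \<le> norm (z - w) + 1" using norm_triangle_ineq[of "z - w" w] assms by simp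
  have "norm z powr q \<le> 2 powr q * (1 + norm (z - w) powr q)"
  proof (cases "norm (z - w) \<le> 1")
    case True
    then have "norm z powr q \<le> 2 powr q" using tri assms by (intro powr_mono2) auto
    also have "\<dots> \<le> 2 powr q * (1 + norm (z - w) powr q)" by simp
    finally show ?thesis .
  next
    case False
    then have "norm z powr q \<le> (2 * norm (z - w)) powr q" using tri assms by (intro powr_mono2) auto
    also have "\<dots> = 2 powr q * norm (z - w) powr q" by (simp add: powr_mult)
    also have "\<dots> \<le> 2 powr q * (1 + norm (z - w) powr q)" by simp
    finally show ?thesis .
  qed
  moreover have "0 \<le> norm (z - w) powr q" by simp
  ultimately show ?thesis unfolding distrib_left distrib_right mult_1_left mult_1_right by linarith
qed

lemma integrable_inverse_one_plus_norm_powr: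
  assumes "real DIM('a::euclidean_space) < q"
  shows "integrable lborel (\<lambda>z::'a. 1 / (1 + norm z powr q))"
proof (rule integrableI_bounded)
  have "(\<integral>\<^sup>+z. ennreal (norm (1 / (1 + norm (z::'a) powr q))) \<partial>lborel)
    \<le> (\<integral>\<^sup>+z. indicator (ball (0::'a) 1) z + ennreal (norm z powr - q) * indicator (- ball 0 1) z \<partial>lborel)"
  proof (rule nn_integral_mono)
    fix z :: 'a
    have "0 < 1 + norm z powr q" by (simp add: add_pos_nonneg)
    then have "1 / (1 + norm z powr q) \<le> 1" by simp
    moreover have "1 / (1 + norm z powr q) \<le> norm z powr - q" if "1 \<le> norm z"
      using that assms by (intro inverse_one_plus_powr_le) auto
    ultimately show "ennreal (norm (1 / (1 + norm z powr q))) \<le> indicator (ball 0 1) z + ennreal (norm z powr - q) * indicator (- ball 0 1) z"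
      by (auto simp: indicator_def ennreal_le_1 intro!: ennreal_leI)
  qed
  also have "\<dots> = (\<integral>\<^sup>+z. indicator (ball (0::'a) 1) z \<partial>lborel) + (\<integral>\<^sup>+z. ennreal (norm (z::'a) powr - q) * indicator (- ball 0 1) z \<partial>lborel)"
    by (rule nn_integral_add) (auto intro!: borel_measurable_indicator)
  also have "\<dots> < \<infinity>"
    using nn_integral_norm_powr_outside_ball[where 'a='a and e="- q" and r=1] assms emeasure_lborel_ball_finite[of "0::'a" 1] by simp
  finally show "(\<integral>\<^sup>+z. ennreal (norm (1 / (1 + norm (z::'a) powr q))) \<partial>lborel) < \<infinity>" .
qed simp

section \<open>Integrals under rigid motions, scaling and reflection\<close>

lemma lborel_distr_rigid:
  fixes R :: "'a::euclidean_space \<Rightarrow> 'a"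
  assumes R: "orthogonal_transformation R"
  shows "distr lborel borel (\<lambda>z. y + R z) = lborel"
proof -
  note [measurable] = orthogonal_transformation_measurable[OF R]
  have "distr lborel borel (\<lambda>z. y + R z) = distr (distr lborel borel R) borel ((+) y)"
    by (simp add: distr_distr comp_def)
  then show ?thesis by (simp add: lborel_distr_orthogonal[OF R] lborel_distr_plus)
qed

lemma integral_rigid:
  fixes R :: "'a::euclidean_space \<Rightarrow> 'a" and f :: "'a \<Rightarrow> real"
  assumes R: "orthogonal_transformation R" and [measurable]: "f \<in> borel_measurable borel"
  shows "(LBINT z. f (y + R z)) = (LBINT z. f z)"
    and "integrable lborel f \<Longrightarrow> integrable lborel (\<lambda>z. f (y + R z))"
proof -
  note [measurable] = orthogonal_transformation_measurable[OF R]
  show "(LBINT z. f (y + R z)) = (LBINT z. f z)"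
    using integral_distr[of "\<lambda>z. y + R z" lborel borel f] by (simp add: lborel_distr_rigid[OF R])
  show "integrable lborel f \<Longrightarrow> integrable lborel (\<lambda>z. f (y + R z))"
    using integrable_distr[of "\<lambda>z. y + R z" lborel borel f] by (simp add: lborel_distr_rigid[OF R])
qed

lemma integral_translate:
  fixes f :: "'a::euclidean_space \<Rightarrow> real"
  assumes [measurable]: "f \<in> borel_measurable borel"
  shows "(LBINT z. f (y + z)) = (LBINT z. f z)"
    and "integrable lborel f \<Longrightarrow> integrable lborel (\<lambda>z. f (y + z))"
  using integral_rigid[of "\<lambda>z. z" f y] by (simp_all add: orthogonal_transformation_id[unfolded id_def])

lemma integral_scale:
  fixes f :: "'a::euclidean_space \<Rightarrow> real"
  assumes \<rho>: "0 < \<rho>" and [measurable]: "f \<in> borel_measurable borel"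
  shows "(LBINT x. f (x /\<^sub>R \<rho>)) = \<rho> ^ DIM('a) * (LBINT x. f x)"
    and "integrable lborel f \<Longrightarrow> integrable lborel (\<lambda>x. f (x /\<^sub>R \<rho>))"
proof -
  have scale: "lborel = density (distr lborel borel (\<lambda>w::'a. \<rho> *\<^sub>R w)) (\<lambda>_. ennreal (\<rho> ^ DIM('a)))"
    using lborel_affine[of \<rho> "0 :: 'a"] \<rho> by simp
  have "(LBINT x. f (x /\<^sub>R \<rho>)) = (\<integral>x. f (x /\<^sub>R \<rho>) \<partial>density (distr lborel borel (\<lambda>w. \<rho> *\<^sub>R w)) (\<lambda>_. ennreal (\<rho> ^ DIM('a))))"
    using scale by (simp only:)
  also have "\<dots> = \<rho> ^ DIM('a) * (LBINT w. f ((\<rho> *\<^sub>R w) /\<^sub>R \<rho>))"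
    using \<rho> by (subst integral_density) (auto simp: integral_distr)
  finally show "(LBINT x. f (x /\<^sub>R \<rho>)) = \<rho> ^ DIM('a) * (LBINT x. f x)" using \<rho> by simp
  assume "integrable lborel f"
  then have "integrable (density (distr lborel borel (\<lambda>w. \<rho> *\<^sub>R w)) (\<lambda>_. ennreal (\<rho> ^ DIM('a)))) (\<lambda>x. f (x /\<^sub>R \<rho>))"
    using \<rho> by (subst integrable_density) (auto simp: integrable_distr_eq)
  then show "integrable lborel (\<lambda>x. f (x /\<^sub>R \<rho>))" using scale by (simp only:)
qed

text \<open>The reflection in the last coordinate preserves the measure, so the integral equals its
  own negative; a non-integrable \<open>f\<close> has integral \<open>0\<close> by convention.
  Equality of norms is part of the oddness condition so that radial weights can be
  discharged.\<close>

lemma integral_vertically_odd: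
  fixes f :: "'m::euclidean_space \<times> real \<Rightarrow> real"
  assumes f: "f \<in> borel_measurable borel"
    and odd: "\<And>z z'. norm z' = norm z \<Longrightarrow> fst z' = fst z \<Longrightarrow> snd z' = - snd z \<Longrightarrow> f z' = - f z"
  shows "(LBINT z. f z) = 0"
proof -
  define T :: "'m \<times> real \<Rightarrow> 'm \<times> real" where "T z = (fst z, - snd z)" for z
  have T: "orthogonal_transformation T"
    unfolding orthogonal_transformation_def
    by (auto simp: T_def inner_Pair intro!: linearI)
  have "(LBINT z. f z) = (LBINT z. f (0 + T z))"
    by (rule integral_rigid(1)[OF T f, symmetric])
  also have "\<dots> = (LBINT z. - f z)"
  proof (rule Bochner_Integration.integral_cong[OF refl])
    fix z
    show "f (0 + T z) = - f z"
      using orthogonal_transformation_norm[OF T, of z] by (intro odd) (simp_all add: T_def)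
  qed
  finally show ?thesis by simp
qed

lemma frontier_superlevel:
  fixes f :: "'a::topological_space \<Rightarrow> real"
  assumes f: "continuous_on UNIV f" and x: "x \<in> frontier {x. 0 < f x}"
  shows "f x = 0"
proof -
  have "open {x. 0 < f x}" using f by (intro open_Collect_less) auto
  then have "f x \<le> 0" using x by (auto simp: frontier_def interior_open)
  moreover have "closed {x. 0 \<le> f x}" using f by (intro closed_Collect_le) auto
  then have "closure {x. 0 < f x} \<subseteq> {x. 0 \<le> f x}" by (intro closure_minimal) auto
  then have "0 \<le> f x" using x by (auto simp: frontier_def)
  ultimately show ?thesis by simp
qed

text \<open>\<open>psi a\<close> is, up to the sign and null sets, twice the indicator function of the interval between \<open>0\<close> and \<open>- a\<close>.\<close>

definition psi :: "real \<Rightarrow> real \<Rightarrow> real" where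
  "psi a \<zeta> = sgn (\<zeta> + a) - sgn \<zeta>"

lemma psi_measurable[measurable]:
  assumes [measurable]: "a \<in> borel_measurable M" "b \<in> borel_measurable M"
  shows "(\<lambda>z. psi (a z) (b z)) \<in> borel_measurable M"
  unfolding psi_def by measurable

lemma psi_AE: "AE \<zeta> in lborel. psi a \<zeta> = 2 * indicator {- a..0} \<zeta> - 2 * indicator {0..- a} \<zeta>"
  using AE_lborel_neq[of 0] AE_lborel_neq[of "- a"]
proof eventually_elim
  case (elim \<zeta>)
  then show ?case by (auto simp: psi_def indicator_def sgn_if)
qed

lemma psi_integral: "integrable lborel (psi a)" "(LBINT \<zeta>. psi a \<zeta>) = 2 * a" "(LBINT \<zeta>. \<bar>psi a \<zeta>\<bar>) = 2 * \<bar>a\<bar>"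
proof -
  let ?f = "\<lambda>\<zeta>. 2 * indicator {- a..0} \<zeta> - 2 * indicator {0..- a} \<zeta> :: real"
  have ind: "integrable lborel (indicator {x..y} :: real \<Rightarrow> real)" for x y :: real
    by (rule integrable_real_indicator) (auto simp: emeasure_lborel_Icc_eq)
  have int: "integrable lborel ?f"
    by (intro Bochner_Integration.integrable_diff integrable_mult_right ind)
  show "integrable lborel (psi a)"
    using int psi_AE[of a] by (subst integrable_cong_AE[of _ _ ?f]) auto
  have "(LBINT \<zeta>. psi a \<zeta>) = (LBINT \<zeta>. ?f \<zeta>)"
    using psi_AE[of a] by (intro integral_cong_AE) auto
  also have "\<dots> = 2 * a" by (subst Bochner_Integration.integral_diff) (auto simp: max_def ind)
  finally show *: "(LBINT \<zeta>. psi a \<zeta>) = 2 * a" .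
  have "\<bar>psi a \<zeta>\<bar> = sgn a * psi a \<zeta>" for \<zeta> by (auto simp: psi_def sgn_if)
  then show "(LBINT \<zeta>. \<bar>psi a \<zeta>\<bar>) = 2 * \<bar>a\<bar>" by (simp add: * abs_sgn[of a] mult.commute)
qed

lemma psi_support: "\<bar>a\<bar> < \<bar>\<zeta>\<bar> \<Longrightarrow> psi a \<zeta> = 0"
  by (auto simp: psi_def sgn_if)

lemma abs_psi_le: "\<bar>psi a \<zeta>\<bar> \<le> 2"
  by (auto simp: psi_def sgn_if)

lemma abs_psi_eq: "\<bar>psi a \<zeta>\<bar> = sgn a * psi a \<zeta>"
  by (auto simp: psi_def sgn_if)

lemma borel_measurable_fst'[measurable]: "fst \<in> borel_measurable (borel :: ('a::euclidean_space \<times> 'b::euclidean_space) measure)"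
  and borel_measurable_snd'[measurable]: "snd \<in> borel_measurable (borel :: ('a::euclidean_space \<times> 'b::euclidean_space) measure)"
  by (simp_all add: borel_measurable_continuous_onI continuous_on_fst continuous_on_snd)

text \<open>Integrating \<open>psi\<close> over a vertical fibre gives twice the signed height
  \<open>b x\<close>, so a layer next to the plane turns into an integral over the plane. The third
  part uses that \<open>psi\<close> has constant sign on each fibre.\<close>

lemma integral_psi_prod:
  fixes u b :: "'m::euclidean_space \<Rightarrow> real"
  assumes [measurable]: "u \<in> borel_measurable borel" "b \<in> borel_measurable borel"
    and int: "integrable lborel (\<lambda>x. u x * b x)"
  shows "integrable lborel (\<lambda>z. u (fst z) * psi (b (fst z)) (snd z))"
    and "(LBINT z. u (fst z) * psi (b (fst z)) (snd z)) = 2 * (LBINT x. u x * b x)"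
    and "(LBINT z. \<bar>u (fst z) * psi (b (fst z)) (snd z)\<bar>) = 2 * (LBINT x. \<bar>u x * b x\<bar>)"
proof -
  let ?f = "\<lambda>z. u (fst z) * psi (b (fst z)) (snd z)"
  have f: "integrable (lborel \<Otimes>\<^sub>M lborel) ?f"
  proof (rule lborel_pair.Fubini_integrable)
    show "?f \<in> borel_measurable (lborel \<Otimes>\<^sub>M lborel)" by measurable
    have "integrable lborel (\<lambda>x. 2 * \<bar>u x * b x\<bar>)" using int by simp
    then show "integrable lborel (\<lambda>x. LBINT y. norm (?f (x, y)))"
      by (simp add: abs_mult psi_integral mult_ac)
    show "AE x in lborel. integrable lborel (\<lambda>y. ?f (x, y))" by (simp add: psi_integral)
  qed
  then show "integrable lborel ?f" by (simp add: lborel_prod)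
  show "(LBINT z. ?f z) = 2 * (LBINT x. u x * b x)"
  proof -
    have "(LBINT z. ?f z) = (LBINT x. 2 * (u x * b x))"
      using lborel_pair.integral_fst'[OF f] by (simp add: lborel_prod psi_integral mult_ac)
    then show ?thesis by simp
  qed
  show "(LBINT z. \<bar>?f z\<bar>) = 2 * (LBINT x. \<bar>u x * b x\<bar>)"
  proof -
    have "(LBINT z. \<bar>?f z\<bar>) = (LBINT x. 2 * \<bar>u x * b x\<bar>)"
      using lborel_pair.integral_fst'[OF integrable_abs[OF f]] by (simp add: lborel_prod psi_integral abs_mult mult_ac)
    then show ?thesis by simp
  qed
qed

section \<open>The rescaled kernel\<close>

locale fractional_kernel =
  fixes P :: "'m::euclidean_space \<times> real \<Rightarrow> real" and s Cc N p :: real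
    and DP :: "'m \<times> real \<Rightarrow> ('m \<times> real) \<Rightarrow>\<^sub>L real"
  assumes s: "0 < s" "s < 1"
    and N_eq: "N = real DIM('m) + 1" and p_eq: "p = N + 2 * s"
    and DP: "\<And>y. (P has_derivative blinfun_apply (DP y)) (at y)"
    and DP_bound: "\<And>y. norm (DP y) \<le> Cc / (1 + norm y powr (real DIM('m \<times> real) + 2 * s + 1))"
    and P_radial: "\<And>x y. norm x = norm y \<Longrightarrow> P x = P y"
    and Cc_pos: "0 < Cc"
    and P_lower': "\<And>y. 1 / Cc / (1 + norm y powr (real DIM('m \<times> real) + 2 * s)) \<le> P y"
    and P_upper': "\<And>y. P y \<le> Cc / (1 + norm y powr (real DIM('m \<times> real) + 2 * s))"
begin

lemma DIM_pos: "0 < real DIM('m)"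
  by simp

lemma real_DIM: "real DIM('m) = N - 1"
  using N_eq by simp

lemma N_gt: "1 < N" and p_gt: "N < p"
  using s N_eq p_eq DIM_pos by auto

lemma P_lower: "1 / Cc / (1 + norm y powr p) \<le> P y"
  and P_upper: "P y \<le> Cc / (1 + norm y powr p)"
  using P_lower'[of y] P_upper'[of y] by (simp_all add: real_DIM p_eq)

lemma DP_le: "norm (DP y) \<le> Cc / (1 + norm y powr (p + 1))"
  using DP_bound[of y] by (simp add: real_DIM p_eq)

lemma P_pos: "0 < P y"
proof -
  have "0 < 1 + norm y powr p" by (simp add: add_pos_nonneg)
  then have "0 < 1 / Cc / (1 + norm y powr p)" using Cc_pos by simp
  then show ?thesis using P_lower[of y] by linarith
qed

lemma P_continuous: "continuous_on UNIV P"
  using DP by (meson continuous_at_imp_continuous_on has_derivative_continuous)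

lemma P_measurable[measurable]: "P \<in> borel_measurable borel"
  by (rule borel_measurable_continuous_onI[OF P_continuous])

text \<open>The upper constant of \<open>P\<close>, enlarged so that it remains valid for all shifts
  of the centre by at most one unit.\<close>

definition Kb :: real where "Kb = Cc * (1 + 2 powr p)"

lemma Kb_pos: "0 < Kb" using Cc_pos by (simp add: Kb_def add_pos_nonneg)

lemma P_shift_le: "norm w \<le> 1 \<Longrightarrow> P (z - w) \<le> Kb / (1 + norm z powr p)"
proof -
  assume "norm w \<le> 1"
  then have le: "1 + norm z powr p \<le> (1 + 2 powr p) * (1 + norm (z - w) powr p)"
    using p_gt N_gt by (intro one_plus_norm_powr_shift) auto
  have pos: "0 < 1 + norm z powr p" "0 < 1 + norm (z - w) powr p" by (simp_all add: add_pos_nonneg)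
  have "P (z - w) \<le> Cc / (1 + norm (z - w) powr p)" by (rule P_upper)
  also have "\<dots> \<le> Kb / (1 + norm z powr p)"
  proof -
    have "Cc * (1 + norm z powr p) \<le> Cc * ((1 + 2 powr p) * (1 + norm (z - w) powr p))"
      using le Cc_pos by (intro mult_left_mono) auto
    then show ?thesis using pos by (simp add: Kb_def divide_le_eq le_divide_eq mult_ac)
  qed
  finally show ?thesis .
qed

lemma P_integrable_shift: "norm w \<le> 1 \<Longrightarrow> integrable lborel (\<lambda>z. P (z - w))"
proof (rule Bochner_Integration.integrable_bound)
  show "integrable lborel (\<lambda>z::'m \<times> real. Kb * (1 / (1 + norm z powr p)))"
    using p_gt by (intro integrable_mult_right integrable_inverse_one_plus_norm_powr) (simp add: N_eq)
  show "(\<lambda>z. P (z - w)) \<in> borel_measurable lborel" by measurable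
  assume "norm w \<le> 1"
  then show "AE z in lborel. norm (P (z - w)) \<le> norm (Kb * (1 / (1 + norm z powr p)))"
    using P_shift_le P_pos Kb_pos by (auto simp: abs_of_pos add_pos_nonneg)
qed

lemma P_integrable: "integrable lborel P"
  using P_integrable_shift[of 0] by simp

text \<open>The kernel at time \<open>\<rho> powr (2 * s)\<close>, so that the parameter is a
  length, namely the width of the kernel's core.\<close>

definition k :: "real \<Rightarrow> 'm \<times> real \<Rightarrow> real" where
  "k \<rho> z = \<rho> powr - N * P (z /\<^sub>R \<rho>)"

lemma kernel_eq: "0 < \<rho> \<Longrightarrow> kernel P s z (\<rho> powr (2 * s)) = k \<rho> z"
  using s by (simp add: kernel_def k_def powr_powr powr_minus real_DIM)

lemma k_pos: "0 < \<rho> \<Longrightarrow> 0 < k \<rho> z"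
  by (simp add: k_def P_pos)

lemma k_measurable[measurable]: "k \<rho> \<in> borel_measurable borel"
  unfolding k_def[abs_def] by measurable

lemma k_radial: "norm x = norm y \<Longrightarrow> k \<rho> x = k \<rho> y"
  unfolding k_def by (rule arg_cong2[of _ _ _ _ "(*)"]) (auto intro: P_radial)

lemma k_shift_le0:
  assumes "0 < \<rho>" "norm w \<le> \<rho>"
  shows "k \<rho> (z - w) \<le> \<rho> powr - N * (Kb / (1 + norm (z /\<^sub>R \<rho>) powr p))"
proof -
  have "norm (w /\<^sub>R \<rho>) \<le> 1" using assms by (simp add: field_simps)
  then have "P (z /\<^sub>R \<rho> - w /\<^sub>R \<rho>) \<le> Kb / (1 + norm (z /\<^sub>R \<rho>) powr p)" by (rule P_shift_le)
  then show ?thesis unfolding k_def scaleR_diff_right by (intro mult_left_mono) auto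
qed

text \<open>The free exponent is used in two ways: \<open>\<kappa> = p\<close> gives the factor
  \<open>\<rho> powr (2 * s)\<close> with the full singularity, and \<open>\<kappa> = N + s\<close>
  gives \<open>\<rho> powr s\<close> with a singularity that a paraboloidal layer can still
  integrate.\<close>

lemma k_shift_le:
  assumes "0 < \<rho>" "norm w \<le> \<rho>" "0 \<le> \<kappa>" "\<kappa> \<le> p" "z \<noteq> 0"
  shows "k \<rho> (z - w) \<le> Kb * \<rho> powr (\<kappa> - N) * norm z powr - \<kappa>"
proof -
  have "k \<rho> (z - w) \<le> \<rho> powr - N * (Kb * (1 / (1 + norm (z /\<^sub>R \<rho>) powr p)))"
    using k_shift_le0[OF assms(1,2)] by simp
  also have "\<dots> \<le> \<rho> powr - N * (Kb * norm (z /\<^sub>R \<rho>) powr - \<kappa>)"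
    using assms Kb_pos by (intro mult_left_mono inverse_one_plus_powr_le) auto
  also have "norm (z /\<^sub>R \<rho>) powr - \<kappa> = \<rho> powr \<kappa> * norm z powr - \<kappa>"
    using assms(1) by (rule norm_scaleR_inverse_powr)
  also have "\<rho> powr - N * (Kb * (\<rho> powr \<kappa> * norm z powr - \<kappa>)) = Kb * \<rho> powr (\<kappa> - N) * norm z powr - \<kappa>"
    using powr_add[of \<rho> "- N" \<kappa>] by (simp add: mult_ac)
  finally show ?thesis .
qed

lemma k_majorant_integrable:
  assumes "0 < \<rho>"
  shows "integrable lborel (\<lambda>z::'m \<times> real. \<rho> powr - N * (Kb * (1 / (1 + norm (z /\<^sub>R \<rho>) powr p))))"
  using p_gt assms
  by (intro integrable_mult_right integral_scale(2)[of _ "\<lambda>z. 1 / (1 + norm z powr p)"] integrable_inverse_one_plus_norm_powr)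
    (simp_all add: N_eq)

lemma k_shift_integrable:
  assumes "0 < \<rho>" "norm w \<le> \<rho>"
  shows "integrable lborel (\<lambda>z. k \<rho> (z - w))"
proof (rule Bochner_Integration.integrable_bound)
  show "integrable lborel (\<lambda>z::'m \<times> real. \<rho> powr - N * (Kb * (1 / (1 + norm (z /\<^sub>R \<rho>) powr p))))"
    using assms(1) by (rule k_majorant_integrable)
  show "(\<lambda>z. k \<rho> (z - w)) \<in> borel_measurable lborel" by measurable
  show "AE z in lborel. norm (k \<rho> (z - w)) \<le> norm (\<rho> powr - N * (Kb * (1 / (1 + norm (z /\<^sub>R \<rho>) powr p))))"
    using k_shift_le0[OF assms] k_pos[OF assms(1)] Kb_pos by (auto simp: abs_of_pos add_pos_nonneg abs_mult)
qed

text \<open>The mean value inequality on a vertical line. The gradient bound decreases with the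
  norm, so its value at the foot \<open>(x, 0)\<close> is valid along the whole line.\<close>

lemma P_vertical_diff:
  "\<bar>P (x, \<zeta>) - P (x, \<zeta>')\<bar> \<le> Cc / (1 + norm x powr (p + 1)) * \<bar>\<zeta> - \<zeta>'\<bar>"
proof -
  let ?S = "{x} \<times> (UNIV :: real set)"
  have "norm (P (x, \<zeta>) - P (x, \<zeta>')) \<le> Cc / (1 + norm x powr (p + 1)) * norm ((x, \<zeta>) - (x, \<zeta>'))"
  proof (rule differentiable_bound[where S = ?S and f' = "\<lambda>z. blinfun_apply (DP z)"])
    show "convex ?S" by (intro convex_Times) auto
    show "(P has_derivative blinfun_apply (DP z)) (at z within ?S)" for z
      using DP by (rule has_derivative_at_withinI)
    fix z assume z: "z \<in> ?S"
    have "norm x powr (p + 1) \<le> norm z powr (p + 1)"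
      using z norm_fst_le'[of z] p_gt N_gt by (intro powr_mono2) auto
    then have "Cc / (1 + norm z powr (p + 1)) \<le> Cc / (1 + norm x powr (p + 1))"
      using Cc_pos by (intro divide_left_mono) (auto intro!: mult_pos_pos add_pos_nonneg)
    then show "onorm (blinfun_apply (DP z)) \<le> Cc / (1 + norm x powr (p + 1))"
      using DP_le[of z] by (simp add: norm_blinfun.rep_eq)
  qed auto
  then show ?thesis by (simp add: norm_Pair)
qed

lemma k_vertical_diff:
  assumes "0 < \<rho>" "0 \<le> \<kappa>" "\<kappa> \<le> p + 1" "x \<noteq> 0"
  shows "\<bar>k \<rho> (x, \<zeta>) - k \<rho> (x, \<zeta>')\<bar> \<le> Cc * \<rho> powr (\<kappa> - N - 1) * norm x powr - \<kappa> * \<bar>\<zeta> - \<zeta>'\<bar>"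
proof -
  have "\<bar>k \<rho> (x, \<zeta>) - k \<rho> (x, \<zeta>')\<bar> = \<rho> powr - N * \<bar>P (x /\<^sub>R \<rho>, \<zeta> / \<rho>) - P (x /\<^sub>R \<rho>, \<zeta>' / \<rho>)\<bar>"
    by (simp add: k_def abs_mult divide_inverse mult.commute flip: right_diff_distrib)
  also have "\<dots> \<le> \<rho> powr - N * (Cc * (1 / (1 + norm (x /\<^sub>R \<rho>) powr (p + 1))) * \<bar>\<zeta> / \<rho> - \<zeta>' / \<rho>\<bar>)"
    using P_vertical_diff[of "x /\<^sub>R \<rho>" "\<zeta> / \<rho>" "\<zeta>' / \<rho>"] by (intro mult_left_mono) auto
  also have "\<dots> \<le> \<rho> powr - N * (Cc * norm (x /\<^sub>R \<rho>) powr - \<kappa> * \<bar>\<zeta> / \<rho> - \<zeta>' / \<rho>\<bar>)"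
    using assms Cc_pos by (intro mult_left_mono mult_right_mono inverse_one_plus_powr_le) auto
  also have "norm (x /\<^sub>R \<rho>) powr - \<kappa> = \<rho> powr \<kappa> * norm x powr - \<kappa>"
    using assms(1) by (rule norm_scaleR_inverse_powr)
  also have "\<bar>\<zeta> / \<rho> - \<zeta>' / \<rho>\<bar> = \<bar>\<zeta> - \<zeta>'\<bar> * \<rho> powr - 1"
    using assms by (simp add: powr_minus divide_inverse flip: left_diff_distrib) (simp add: abs_mult)
  also have "\<rho> powr - N * (Cc * (\<rho> powr \<kappa> * norm x powr - \<kappa>) * (\<bar>\<zeta> - \<zeta>'\<bar> * \<rho> powr - 1))
      = Cc * (\<rho> powr - N * \<rho> powr \<kappa> * \<rho> powr - 1) * norm x powr - \<kappa> * \<bar>\<zeta> - \<zeta>'\<bar>" by (simp add: mult_ac)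
  also have "\<rho> powr - N * \<rho> powr \<kappa> * \<rho> powr - 1 = \<rho> powr (\<kappa> - N - 1)"
    by (simp only: powr_add[symmetric]) (simp add: algebra_simps)
  finally show ?thesis .
qed

lemma tau_measurable:
  assumes "open E"
  shows "tau E \<in> borel_measurable (borel :: 'a::euclidean_space measure)"
proof -
  have [measurable]: "E \<in> sets borel" "closure E \<in> sets borel" using assms by auto
  show ?thesis unfolding tau_def[abs_def] by measurable
qed

lemma abs_tau_le: "\<bar>tau E y\<bar> \<le> 1"
  using closure_subset[of E] by (auto simp: tau_def indicator_def)

lemma uu_chart:
  assumes E: "open E" and R: "orthogonal_transformation R" and \<rho>: "0 < \<rho>"
  shows "uu P s E (y + h *\<^sub>R R (0, 1)) (\<rho> powr (2 * s)) = (LBINT z. k \<rho> (z - (0, h)) * tau E (y + R z))"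
proof -
  note [measurable] = tau_measurable[OF E]
  let ?x = "y + h *\<^sub>R R (0, 1)"
  have "uu P s E ?x (\<rho> powr (2 * s)) = (LBINT w. k \<rho> (?x - w) * tau E w)"
    by (simp add: uu_def kernel_eq[OF \<rho>])
  also have "\<dots> = (LBINT z. k \<rho> (?x - (y + R z)) * tau E (y + R z))"
    by (rule integral_rigid(1)[OF R, symmetric]) measurable
  also have "\<dots> = (LBINT z. k \<rho> (z - (0, h)) * tau E (y + R z))"
  proof (intro Bochner_Integration.integral_cong refl arg_cong2[of _ _ _ _ "(*)"] k_radial)
    fix z
    have lin: "linear R" using R by (rule orthogonal_transformation_linear)
    have "R ((0, h) - z) = h *\<^sub>R R (0, 1) - R z"
      using linear_scale[OF lin, of h "(0, 1)"] by (simp add: linear_diff[OF lin])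
    then have "?x - (y + R z) = R ((0, h) - z)" by simp
    then show "norm (?x - (y + R z)) = norm (z - (0, h))"
      using R by (simp only: orthogonal_transformation_norm norm_minus_commute)
  qed
  finally show ?thesis .
qed

text \<open>Continuity is what makes a frontier point of the superlevel set \<open>Et\<close> a zero
  of \<open>uu\<close>.\<close>

lemma uu_continuous:
  assumes E: "open E" and \<rho>: "0 < \<rho>"
  shows "continuous_on UNIV (\<lambda>x. uu P s E x (\<rho> powr (2 * s)))"
proof (intro continuous_at_imp_continuous_on ballI continuous_at_sequentiallyI)
  note [measurable] = tau_measurable[OF E]
  fix x u assume u: "u \<longlonglongrightarrow> (x :: 'm \<times> real)"
  have eq: "uu P s E x (\<rho> powr (2 * s)) = (LBINT w. k \<rho> (x - w) * tau E w)" for x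
    by (simp add: uu_def kernel_eq[OF \<rho>])
  have "\<forall>\<^sub>F n in sequentially. dist (u n) x < \<rho>" using u \<rho> by (rule tendstoD)
  \<comment> \<open>Dropping the first terms makes every displacement at most \<open>\<rho>\<close>,
    so that one majorant centred at \<open>x\<close> dominates the whole tail.\<close>
  then obtain n0 where n0: "\<And>n. n0 \<le> n \<Longrightarrow> dist (u n) x < \<rho>" by (auto simp: eventually_sequentially)
  have "(\<lambda>n. LBINT w. k \<rho> (u (n + n0) - w) * tau E w) \<longlonglongrightarrow> (LBINT w. k \<rho> (x - w) * tau E w)"
  proof (rule integral_dominated_convergence)
    let ?w = "\<lambda>z::'m \<times> real. \<rho> powr - N * (Kb / (1 + norm ((z - x) /\<^sub>R \<rho>) powr p))"
    show "integrable lborel ?w"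
    proof -
      have "integrable lborel (\<lambda>z::'m \<times> real. \<rho> powr - N * (Kb / (1 + norm (z /\<^sub>R \<rho>) powr p)))"
        using k_majorant_integrable[OF \<rho>] by simp
      from integral_translate(2)[OF _ this, of "- x"] show ?thesis
        by (simp only: uminus_add_conv_diff) measurable
    qed
    show "AE w in lborel. (\<lambda>n. k \<rho> (u (n + n0) - w) * tau E w) \<longlonglongrightarrow> k \<rho> (x - w) * tau E w"
    proof (rule AE_I2, rule tendsto_mult_right)
      fix w
      have cP: "isCont P z" for z using DP by (rule has_derivative_continuous)
      have "isCont (k \<rho>) z" for z
        unfolding k_def[abs_def]
        by (rule continuous_mult[OF continuous_const isCont_o2[OF _ cP]]) (intro continuous_intros)
      then show "(\<lambda>n. k \<rho> (u (n + n0) - w)) \<longlonglongrightarrow> k \<rho> (x - w)"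
        by (rule isCont_tendsto_compose) (intro tendsto_intros LIMSEQ_ignore_initial_segment u)
    qed
    show "AE w in lborel. norm (k \<rho> (u (n + n0) - w) * tau E w) \<le> ?w w" for n
    proof (rule AE_I2)
      fix w
      have "norm (u (n + n0) - x) \<le> \<rho>" using n0[of "n + n0"] by (simp add: dist_norm)
      from k_shift_le0[OF \<rho> this, of "w - x"]
      have "k \<rho> (u (n + n0) - w) \<le> ?w w"
        using k_radial[of "w - u (n + n0)" "u (n + n0) - w"] by (simp add: norm_minus_commute)
      moreover have "norm (k \<rho> (u (n + n0) - w) * tau E w) \<le> k \<rho> (u (n + n0) - w) * 1"
        using abs_tau_le[of E w] k_pos[OF \<rho>, of "u (n + n0) - w"] by (simp add: abs_mult mult_left_le)
      ultimately show "norm (k \<rho> (u (n + n0) - w) * tau E w) \<le> ?w w" by simp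
    qed
  qed measurable
  then show "(\<lambda>n. uu P s E (u n) (\<rho> powr (2 * s))) \<longlonglongrightarrow> uu P s E x (\<rho> powr (2 * s))"
    unfolding eq by (rule LIMSEQ_offset)
qed

lemma frontier_Et_zero:
  assumes "open E" "sigma s t = \<rho> powr (2 * s)" "0 < \<rho>" "x \<in> frontier (Et P s E t)"
  shows "uu P s E x (\<rho> powr (2 * s)) = 0"
  using frontier_superlevel[OF uu_continuous[OF assms(1,3)]] assms(2,4) by (simp add: Et_def)

section \<open>Expansion and lower bound of the half space term\<close>

definition g0 :: real where "g0 = (LBINT x. P (x, 0))"

lemma P_horizontal_measurable[measurable]: "(\<lambda>x. P (x, 0)) \<in> borel_measurable borel"
  using measurable_compose[OF borel_measurable_continuous_onI P_measurable, of "\<lambda>x. (x, 0)"]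
  by (simp add: continuous_intros)

lemma P_horizontal_le: "P (x, 0) \<le> Cc / (1 + norm x powr p)"
  using P_upper[of "(x, 0)"] by (simp add: norm_Pair)

lemma P_horizontal_integrable: "integrable lborel (\<lambda>x. P (x, 0))"
proof (rule Bochner_Integration.integrable_bound)
  show "integrable lborel (\<lambda>x::'m. Cc * (1 / (1 + norm x powr p)))"
    using p_gt by (intro integrable_mult_right integrable_inverse_one_plus_norm_powr) (simp add: real_DIM)
  show "AE x in lborel. norm (P (x, 0)) \<le> norm (Cc * (1 / (1 + norm x powr p)))"
    using P_horizontal_le P_pos Cc_pos by (auto simp: abs_of_pos add_pos_nonneg)
qed measurable

text \<open>Substituting \<open>(0, a * \<rho>) + \<rho> *\<^sub>R w\<close> removes the scale and
  turns the sign into \<open>sgn (snd w + a)\<close>. Subtracting \<open>sgn (snd w)\<close>, whose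
  integral against the radial \<open>P\<close> vanishes, leaves \<open>psi\<close>.\<close>

lemma half_space_identity:
  assumes \<rho>: "0 < \<rho>"
  shows "(LBINT z. k \<rho> (z - (0, a * \<rho>)) * - sgn (snd z)) = - (LBINT w. P w * psi a (snd w))"
proof -
  let ?f = "\<lambda>z. k \<rho> (z - (0, a * \<rho>)) * - sgn (snd z)"
  have "(LBINT z. ?f z) = (\<integral>z. ?f z \<partial>density (distr lborel borel (\<lambda>w. (0, a * \<rho>) + \<rho> *\<^sub>R w)) (\<lambda>_. ennreal (\<bar>\<rho>\<bar> ^ DIM('m \<times> real))))"
    using lborel_affine[of \<rho> "(0, a * \<rho>) :: 'm \<times> real"] \<rho> by (simp only:)
  also have "\<dots> = \<rho> ^ DIM('m \<times> real) * (LBINT w. ?f ((0, a * \<rho>) + \<rho> *\<^sub>R w))"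
    using \<rho> by (subst integral_density) (auto simp: integral_distr)
  also have "\<dots> = (LBINT w. P w * - sgn (snd w + a))"
  proof -
    have "\<rho> ^ DIM('m \<times> real) * ?f ((0, a * \<rho>) + \<rho> *\<^sub>R w) = P w * - sgn (snd w + a)" for w
    proof -
      have "\<rho> ^ DIM('m \<times> real) = \<rho> powr N"
        using powr_realpow[OF \<rho>, of "DIM('m \<times> real)"] by (simp add: N_eq add.commute)
      then have "\<rho> ^ DIM('m \<times> real) * \<rho> powr - N = 1"
        using \<rho> by (simp only: powr_add[symmetric]) simp
      moreover have "a * \<rho> + \<rho> * snd w = \<rho> * (snd w + a)" by (simp add: algebra_simps)
      ultimately show ?thesis using \<rho> by (simp add: k_def sgn_mult mult_ac)
    qed
    then show ?thesis by (simp flip: integral_mult_right_zero)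
  qed
  also have "\<dots> = - (LBINT w. P w * psi a (snd w) + P w * sgn (snd w))"
    by (simp add: psi_def algebra_simps)
  also have "(LBINT w. P w * psi a (snd w) + P w * sgn (snd w)) = (LBINT w. P w * psi a (snd w)) + (LBINT w. P w * sgn (snd w))"
  proof (rule Bochner_Integration.integral_add)
    show "integrable lborel (\<lambda>w. P w * psi a (snd w))"
      by (rule Bochner_Integration.integrable_bound[OF integrable_mult_right[OF P_integrable, of 2]])
        (use P_pos abs_psi_le in \<open>auto simp: abs_mult mult.commute intro!: mult_mono\<close>)
    show "integrable lborel (\<lambda>w. P w * sgn (snd w))"
      by (rule Bochner_Integration.integrable_bound[OF P_integrable])
        (use P_pos in \<open>auto simp: abs_mult abs_sgn_eq\<close>)
  qed
  also have "(LBINT w. P w * sgn (snd w)) = 0"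
  proof (rule integral_vertically_odd)
    fix z z' :: "'m \<times> real" assume "norm z' = norm z" "snd z' = - snd z"
    then show "P z' * sgn (snd z') = - (P z * sgn (snd z))" using P_radial[of z' z] by (simp add: sgn_minus)
  qed measurable
  finally show ?thesis by simp
qed

lemma P_psi_integrable: "integrable lborel (\<lambda>w. P w * psi a (snd w))"
  by (rule Bochner_Integration.integrable_bound[OF integrable_mult_right[OF P_integrable, of 2]])
    (use P_pos abs_psi_le in \<open>auto simp: abs_mult mult.commute intro!: mult_mono\<close>)

text \<open>The integral over the plane of the vertical Lipschitz bound of \<open>P\<close>; the
  factor 2 is the one in the fibre mass \<open>2 * \<bar>a\<bar>\<close> of
  \<open>psi\<close>.\<close>

definition quad_const :: real where
  "quad_const = 2 * (LBINT x. Cc * (1 / (1 + norm (x::'m) powr (p + 1))))"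

lemma quad_const_nonneg: "0 \<le> quad_const"
  unfolding quad_const_def using Cc_pos
  by (intro mult_nonneg_nonneg integral_nonneg_AE AE_I2) (auto simp: add_nonneg_nonneg)

text \<open>\<open>psi a\<close> lives on heights of size at most |a| and has integral
  \<open>2 * a\<close>. Freezing \<open>P\<close> at height zero therefore costs one factor |a| from
  the Lipschitz bound and another from the width of the layer.\<close>

lemma half_space_quadratic: "\<bar>(LBINT w. P w * psi a (snd w)) - 2 * g0 * a\<bar> \<le> quad_const * a\<^sup>2"
proof -
  let ?e = "\<lambda>x::'m. Cc * (1 / (1 + norm x powr (p + 1)))"
  have e_int: "integrable lborel ?e"
    using p_gt by (intro integrable_mult_right integrable_inverse_one_plus_norm_powr) (simp add: real_DIM)
  have e_pos: "0 \<le> ?e x" for x using Cc_pos by (simp add: add_nonneg_nonneg)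
  have abs_id: "\<bar>e * \<bar>a\<bar> * a\<bar> = e * a\<^sup>2" if "0 \<le> e" for e :: real
    using that by (simp add: abs_mult power2_eq_square)
  have i0: "integrable lborel (\<lambda>z. P (fst z, 0) * psi a (snd z))" "(LBINT z. P (fst z, 0) * psi a (snd z)) = 2 * g0 * a"
    using integral_psi_prod(1,2)[of "\<lambda>x. P (x, 0)" "\<lambda>_. a"] P_horizontal_integrable by (simp_all add: g0_def)
  have i1: "integrable lborel (\<lambda>z. ?e (fst z) * \<bar>a\<bar> * psi a (snd z))"
    "(LBINT z. \<bar>?e (fst z) * \<bar>a\<bar> * psi a (snd z)\<bar>) = 2 * (LBINT x. ?e x) * a\<^sup>2"
  proof -
    have *: "integrable lborel (\<lambda>x. ?e x * \<bar>a\<bar> * a)" by (rule integrable_mult_left, rule integrable_mult_left, rule e_int)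
    show "integrable lborel (\<lambda>z. ?e (fst z) * \<bar>a\<bar> * psi a (snd z))"
      using integral_psi_prod(1)[OF _ _ *] by simp
    have "(LBINT z. \<bar>?e (fst z) * \<bar>a\<bar> * psi a (snd z)\<bar>) = 2 * (LBINT x. \<bar>?e x * \<bar>a\<bar> * a\<bar>)"
      using integral_psi_prod(3)[OF _ _ *] by simp
    also have "(LBINT x. \<bar>?e x * \<bar>a\<bar> * a\<bar>) = (LBINT x. ?e x * a\<^sup>2)"
      by (intro Bochner_Integration.integral_cong refl abs_id e_pos)
    also have "\<dots> = (LBINT x. ?e x) * a\<^sup>2" by (rule integral_mult_left_zero)
    finally show "(LBINT z. \<bar>?e (fst z) * \<bar>a\<bar> * psi a (snd z)\<bar>) = 2 * (LBINT x. ?e x) * a\<^sup>2" by simp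
  qed
  have "(LBINT w. P w * psi a (snd w)) - 2 * g0 * a = (LBINT w. P w * psi a (snd w) - P (fst w, 0) * psi a (snd w))"
    by (simp add: Bochner_Integration.integral_diff[OF P_psi_integrable i0(1)] i0(2))
  also have "\<bar>\<dots>\<bar> \<le> (LBINT w. \<bar>P w * psi a (snd w) - P (fst w, 0) * psi a (snd w)\<bar>)"
    by (rule integral_abs_bound)
  also have "\<dots> \<le> (LBINT z. \<bar>?e (fst z) * \<bar>a\<bar> * psi a (snd z)\<bar>)"
  proof (rule integral_mono)
    show "integrable lborel (\<lambda>w. \<bar>P w * psi a (snd w) - P (fst w, 0) * psi a (snd w)\<bar>)"
      by (intro integrable_abs Bochner_Integration.integrable_diff P_psi_integrable i0)
    show "integrable lborel (\<lambda>z. \<bar>?e (fst z) * \<bar>a\<bar> * psi a (snd z)\<bar>)" by (intro integrable_abs i1)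
    fix w :: "'m \<times> real"
    show "\<bar>P w * psi a (snd w) - P (fst w, 0) * psi a (snd w)\<bar> \<le> \<bar>?e (fst w) * \<bar>a\<bar> * psi a (snd w)\<bar>"
    proof (cases "\<bar>a\<bar> < \<bar>snd w\<bar>")
      case True
      then show ?thesis by (simp add: psi_support)
    next
      case False
      have "\<bar>P w - P (fst w, 0)\<bar> \<le> ?e (fst w) * \<bar>snd w\<bar>"
        using P_vertical_diff[of "fst w" "snd w" 0] by simp
      also have "\<dots> \<le> ?e (fst w) * \<bar>a\<bar>" using False e_pos by (intro mult_left_mono) auto
      finally have "\<bar>P w - P (fst w, 0)\<bar> * \<bar>psi a (snd w)\<bar> \<le> ?e (fst w) * \<bar>a\<bar> * \<bar>psi a (snd w)\<bar>"
        by (rule mult_right_mono) simp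
      then show ?thesis using Cc_pos by (simp add: abs_mult flip: left_diff_distrib)
    qed
  qed
  also have "\<dots> = 2 * (LBINT x. ?e x) * a\<^sup>2" by (rule i1(2))
  finally show ?thesis unfolding quad_const_def .
qed

text \<open>The middle factor bounds \<open>P\<close> from below on the ball of radius 2, which
  contains the cylinder over the unit ball with heights at most 1; 2 times the volume is the mass of
  \<open>\<bar>psi a\<bar>\<close> there, per unit of |a|.\<close>

definition lower_const :: real where
  "lower_const = 2 * (1 / Cc / (1 + 2 powr p) * measure lborel (ball (0::'m) 1))"

lemma lower_const_pos: "0 < lower_const"
  unfolding lower_const_def using Cc_pos by (intro mult_pos_pos divide_pos_pos content_ball_pos add_pos_nonneg) auto

text \<open>Since \<open>psi a\<close> does not change sign, nothing cancels and the part over the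
  unit ball already suffices. Unlike the quadratic expansion, this controls \<open>a\<close> on the
  whole range |a| \<le> 1 and yields its first smallness estimate.\<close>

lemma half_space_lower:
  assumes a: "\<bar>a\<bar> \<le> 1"
  shows "lower_const * \<bar>a\<bar> \<le> \<bar>LBINT w. P w * psi a (snd w)\<bar>"
proof -
  define c0 where "c0 = 1 / Cc / (1 + 2 powr p)"
  have c0: "0 < c0" using Cc_pos by (simp add: c0_def add_pos_nonneg)
  define V where "V = measure lborel (ball (0::'m) 1)"
  let ?u = "\<lambda>x::'m. c0 * indicator (ball 0 1) x"
  have um: "?u \<in> borel_measurable borel"
    by (intro borel_measurable_times borel_measurable_const borel_measurable_indicator) simp
  have u_int: "integrable lborel ?u"
    using emeasure_lborel_ball_finite[of "0::'m" 1] by (intro integrable_mult_right integrable_real_indicator) auto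
  have *: "integrable lborel (\<lambda>x. ?u x * a)" by (rule integrable_mult_left, rule u_int)
  have "2 * (c0 * V) * \<bar>a\<bar> = 2 * (LBINT x. \<bar>?u x * a\<bar>)"
  proof -
    have "(LBINT x. \<bar>?u x * a\<bar>) = (LBINT x. ?u x * \<bar>a\<bar>)"
      using c0 by (intro Bochner_Integration.integral_cong refl) (simp add: abs_mult)
    also have "\<dots> = (LBINT x. ?u x) * \<bar>a\<bar>" by (rule integral_mult_left_zero)
    also have "(LBINT x. ?u x) = c0 * V" by (simp add: V_def)
    finally show ?thesis by simp
  qed
  also have "\<dots> = (LBINT z. \<bar>?u (fst z) * psi a (snd z)\<bar>)"
    by (rule integral_psi_prod(3)[where b = "\<lambda>_. a", OF um _ *, symmetric]) simp
  also have "\<dots> \<le> (LBINT w. \<bar>P w * psi a (snd w)\<bar>)"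
  proof (rule integral_mono)
    show "integrable lborel (\<lambda>z. \<bar>?u (fst z) * psi a (snd z)\<bar>)"
      by (rule integrable_abs, rule integral_psi_prod(1)[where b = "\<lambda>_. a", OF um _ *]) simp
    show "integrable lborel (\<lambda>w. \<bar>P w * psi a (snd w)\<bar>)" by (intro integrable_abs P_psi_integrable)
    fix w :: "'m \<times> real"
    show "\<bar>?u (fst w) * psi a (snd w)\<bar> \<le> \<bar>P w * psi a (snd w)\<bar>"
    proof (cases "\<bar>a\<bar> < \<bar>snd w\<bar> \<or> fst w \<notin> ball 0 1")
      case True
      then show ?thesis by (auto simp: psi_support)
    next
      case False
      then have "norm w \<le> 2" using norm_Pair_le[of "fst w" "snd w"] a by simp
      then have "norm w powr p \<le> 2 powr p" using p_gt N_gt by (intro powr_mono2) auto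
      then have "c0 \<le> 1 / Cc / (1 + norm w powr p)"
        unfolding c0_def using Cc_pos by (intro divide_left_mono) (auto intro!: mult_pos_pos add_pos_nonneg)
      then have "c0 \<le> P w" using P_lower[of w] by linarith
      then show ?thesis using False c0 P_pos[of w] by (simp add: abs_mult mult_right_mono)
    qed
  qed
  also have "\<dots> = (LBINT w. sgn a * (P w * psi a (snd w)))"
    by (intro Bochner_Integration.integral_cong refl) (simp add: abs_mult abs_psi_eq abs_of_pos[OF P_pos])
  also have "\<dots> = sgn a * (LBINT w. P w * psi a (snd w))" by (rule integral_mult_right_zero)
  also have "\<dots> \<le> \<bar>LBINT w. P w * psi a (snd w)\<bar>" by (auto simp: sgn_if)
  finally show ?thesis by (simp only: lower_const_def c0_def V_def)
qed

end

subsection \<open>Deviation from the half space\<close>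

text \<open>The value \<open>- 1\<close> of \<open>tau\<close> requires a point outside the closure
  of \<open>E\<close>, while the enclosure only excludes it from \<open>E\<close>. The region above
  the band is open, so a whole neighbourhood misses \<open>E\<close>.\<close>

lemma squeezed_tau:
  fixes q :: "'m::euclidean_space \<Rightarrow> real"
  assumes sq: "squeezed E y R q M \<alpha> r" and R: "orthogonal_transformation R"
    and q: "continuous_on UNIV q" and \<alpha>: "0 < \<alpha>" and z: "norm z < r"
  shows "snd z < q (fst z) - M * norm (fst z) powr \<alpha> \<Longrightarrow> tau E (y + R z) = 1"
    and "q (fst z) + M * norm (fst z) powr \<alpha> < snd z \<Longrightarrow> tau E (y + R z) = - 1"
proof -
  assume "snd z < q (fst z) - M * norm (fst z) powr \<alpha>"
  then have "y + R z \<in> E" using sq z unfolding squeezed_def by blast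
  then show "tau E (y + R z) = 1" using closure_subset[of E] by (auto simp: tau_def indicator_def)
next
  assume gt: "q (fst z) + M * norm (fst z) powr \<alpha> < snd z"
  let ?W = "ball 0 r \<inter> {w. q (fst w) + M * norm (fst w) powr \<alpha> < snd w}"
  have "continuous_on UNIV (\<lambda>w::'m \<times> real. q (fst w))"
    using continuous_on_compose2[OF q, of UNIV fst] by (simp add: continuous_on_fst)
  moreover have "continuous_on UNIV (\<lambda>w::'m \<times> real. norm (fst w) powr \<alpha>)"
    using \<alpha> by (intro continuous_on_powr' continuous_on_norm continuous_on_fst continuous_on_id continuous_on_const) auto
  ultimately have op: "open ?W"
    by (intro open_Int open_ball open_Collect_less continuous_on_add continuous_on_mult
        continuous_on_snd continuous_on_id continuous_on_const)
  have iR: "orthogonal_transformation (inv R)" using R by (rule orthogonal_transformation_inv)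
  have RR: "R (inv R w) = w" for w using R by (metis orthogonal_transformation_surj surj_f_inv_f)
  have iRR: "inv R (R w) = w" for w using R by (metis inv_f_f orthogonal_transformation_inj)
  have contR: "isCont (inv R) x" for x
    using iR by (intro linear_continuous_at) (simp add: orthogonal_transformation_linear flip: linear_conv_bounded_linear)
  have "y + R z \<notin> closure E"
  proof
    assume "y + R z \<in> closure E"
    then obtain u where u: "\<And>n. u n \<in> E" "u \<longlonglongrightarrow> y + R z" by (auto simp: closure_sequential)
    have "(\<lambda>n. inv R (u n - y)) \<longlonglongrightarrow> inv R (y + R z - y)"
      by (rule isCont_tendsto_compose[OF contR]) (intro tendsto_diff u tendsto_const)
    then have "(\<lambda>n. inv R (u n - y)) \<longlonglongrightarrow> z" by (simp add: iRR)
    then have "\<forall>\<^sub>F n in sequentially. inv R (u n - y) \<in> ?W"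
      by (rule topological_tendstoD[OF _ op]) (use gt z in auto)
    then obtain n where "inv R (u n - y) \<in> ?W" using eventually_happens'[OF sequentially_bot] by blast
    then have "y + R (inv R (u n - y)) \<notin> E"
      using sq[unfolded squeezed_def, rule_format, of "inv R (u n - y)"] by auto
    then show False using u(1)[of n] by (simp add: RR)
  qed
  then show "tau E (y + R z) = - 1" using closure_subset[of E] by (auto simp: tau_def indicator_def)
qed

lemma thin_region_integral:
  fixes f :: "'m::euclidean_space \<times> real \<Rightarrow> real"
  assumes f[measurable]: "f \<in> borel_measurable borel" and c: "0 \<le> c" and M: "0 \<le> M"
    and e: "- real DIM('m) < e + \<alpha>"
    and bound: "\<And>z. fst z \<noteq> 0 \<Longrightarrow> \<bar>f z\<bar> \<le> c * norm (fst z) powr e *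
        indicator {z. norm (fst z) < r \<and> \<bar>snd z\<bar> \<le> M * norm (fst z) powr \<alpha>} z"
  shows "integrable lborel f"
    and "(LBINT z. \<bar>f z\<bar>) \<le> 2 * c * M * enn2real (\<integral>\<^sup>+(x::'m). ennreal (norm x powr (e + \<alpha>)) * indicator (ball 0 r) x \<partial>lborel)"
proof -
  let ?J = "\<integral>\<^sup>+(x::'m). ennreal (norm x powr (e + \<alpha>)) * indicator (ball 0 r) x \<partial>lborel"
  have J: "?J < \<infinity>" using e by (rule nn_integral_norm_powr_ball)
  have le: "(\<integral>\<^sup>+z. ennreal \<bar>f z\<bar> \<partial>lborel) \<le> ennreal (2 * c * M) * ?J"
  proof (rule nn_integral_thin_region[where q = "\<lambda>_. 0" and e = e and \<alpha> = \<alpha>])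
    fix z :: "'m \<times> real" assume "fst z \<noteq> 0"
    from bound[OF this] show "ennreal \<bar>f z\<bar> \<le> ennreal (c * norm (fst z) powr e) *
        indicator {z. norm (fst z) < r \<and> \<bar>snd z - 0\<bar> \<le> M * norm (fst z) powr \<alpha>} z"
      by (auto simp: indicator_def intro!: ennreal_leI split: if_splits)
  qed (use c M in auto)
  also have "\<dots> = ennreal (2 * c * M * enn2real ?J)"
    using J c M by (simp add: ennreal_mult'' ennreal_enn2real)
  finally have le': "(\<integral>\<^sup>+z. ennreal \<bar>f z\<bar> \<partial>lborel) \<le> ennreal (2 * c * M * enn2real ?J)" .
  then show int: "integrable lborel f"
    by (intro integrableI_bounded) (auto simp: le_less_trans)
  have "ennreal (LBINT z. \<bar>f z\<bar>) = (\<integral>\<^sup>+z. ennreal \<bar>f z\<bar> \<partial>lborel)"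
    using int by (intro nn_integral_eq_integral[symmetric]) auto
  with le' have "ennreal (LBINT z. \<bar>f z\<bar>) \<le> ennreal (2 * c * M * enn2real ?J)" by (simp only:)
  moreover have "0 \<le> 2 * c * M * enn2real ?J" using c M by simp
  ultimately show "(LBINT z. \<bar>f z\<bar>) \<le> 2 * c * M * enn2real ?J" by (simp only: ennreal_le_iff)
qed

section \<open>Second moments of radial functions\<close>

text \<open>The reflection in the hyperplane orthogonal to \<open>u\<close>: for a basis vector it
  flips one coordinate, for the difference of two basis vectors it swaps two.\<close>

definition mirror :: "'a::euclidean_space \<Rightarrow> 'a \<Rightarrow> 'a" where
  "mirror u x = x - (2 * (x \<bullet> u) / (u \<bullet> u)) *\<^sub>R u"

lemma mirror_orthogonal:
  assumes "u \<noteq> 0"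
  shows "orthogonal_transformation (mirror u)"
  unfolding orthogonal_transformation_def
proof (intro conjI allI)
  show "linear (mirror u)"
    by (rule linearI) (simp_all add: mirror_def inner_left_distrib distrib_left add_divide_distrib
        scaleR_left_distrib scaleR_diff_right)
  fix x y
  have d: "u \<bullet> u \<noteq> 0" using assms by simp
  have "mirror u x \<bullet> mirror u y = x \<bullet> y - 2 * (y \<bullet> u) / (u \<bullet> u) * (x \<bullet> u) - 2 * (x \<bullet> u) / (u \<bullet> u) * (y \<bullet> u)
      + 2 * (x \<bullet> u) / (u \<bullet> u) * (2 * (y \<bullet> u) / (u \<bullet> u) * (u \<bullet> u))"
    unfolding mirror_def inner_diff_left inner_diff_right inner_scaleR_left inner_scaleR_right inner_commute[of u y] by simp
  also have "\<dots> = x \<bullet> y" using d by simp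
  finally show "mirror u x \<bullet> mirror u y = x \<bullet> y" .
qed

text \<open>Flipping the coordinate along \<open>b\<close> changes the sign of the mixed moment;
  swapping the coordinates along \<open>b\<close> and \<open>c\<close> identifies the two diagonal
  ones.\<close>

lemma radial_second_moments:
  fixes f :: "'a::euclidean_space \<Rightarrow> real"
  assumes [measurable]: "f \<in> borel_measurable borel" and rad: "\<And>x y. norm x = norm y \<Longrightarrow> f x = f y"
    and b: "b \<in> Basis" and c: "c \<in> Basis" and bc: "b \<noteq> c"
  shows "(LBINT x. (x \<bullet> b) * (x \<bullet> c) * f x) = 0"
    and "(LBINT x. (x \<bullet> b) * (x \<bullet> b) * f x) = (LBINT x. (x \<bullet> c) * (x \<bullet> c) * f x)"
proof -
  have ip: "b \<bullet> b = 1" "c \<bullet> c = 1" "b \<bullet> c = 0" "c \<bullet> b = 0" using b c bc by (auto simp: inner_Basis)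
  have b0: "b \<noteq> 0" and bc0: "b - c \<noteq> 0" using b bc by auto
  have fm: "f (mirror u x) = f x" if "u \<noteq> 0" for u x
    using orthogonal_transformation_norm[OF mirror_orthogonal[OF that]] by (intro rad)
  have "(LBINT x. (x \<bullet> b) * (x \<bullet> c) * f x) = (LBINT x. ((0 + mirror b x) \<bullet> b) * ((0 + mirror b x) \<bullet> c) * f (0 + mirror b x))"
    by (rule integral_rigid(1)[OF mirror_orthogonal[OF b0], symmetric]) measurable
  also have "\<dots> = (LBINT x. - ((x \<bullet> b) * (x \<bullet> c) * f x))"
    by (intro Bochner_Integration.integral_cong refl)
      (simp add: fm[OF b0], simp add: mirror_def inner_diff_left ip)
  finally show "(LBINT x. (x \<bullet> b) * (x \<bullet> c) * f x) = 0" by simp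
  have "(LBINT x. (x \<bullet> b) * (x \<bullet> b) * f x) = (LBINT x. ((0 + mirror (b - c) x) \<bullet> b) * ((0 + mirror (b - c) x) \<bullet> b) * f (0 + mirror (b - c) x))"
    by (rule integral_rigid(1)[OF mirror_orthogonal[OF bc0], symmetric]) measurable
  also have "\<dots> = (LBINT x. (x \<bullet> c) * (x \<bullet> c) * f x)"
    by (intro Bochner_Integration.integral_cong refl)
      (simp add: fm[OF bc0], simp add: mirror_def inner_diff_left inner_diff_right ip diff_divide_distrib)
  finally show "(LBINT x. (x \<bullet> b) * (x \<bullet> b) * f x) = (LBINT x. (x \<bullet> c) * (x \<bullet> c) * f x)" .
qed

lemma integral_quadratic_radial:
  fixes f :: "'a::euclidean_space \<Rightarrow> real" and B :: "'a \<Rightarrow> 'a \<Rightarrow> real"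
  assumes [measurable]: "f \<in> borel_measurable borel" and rad: "\<And>x y. norm x = norm y \<Longrightarrow> f x = f y"
    and int: "integrable lborel (\<lambda>x. (norm x)\<^sup>2 * f x)" and B: "bilinear B"
  shows "(LBINT x. B x x * f x) = (\<Sum>b\<in>Basis. B b b) / real DIM('a) * (LBINT x. (norm x)\<^sup>2 * f x)"
proof -
  define I where "I b c = (LBINT x. (x \<bullet> b) * (x \<bullet> c) * f x)" for b c
  have int_bc: "integrable lborel (\<lambda>x. (x \<bullet> b) * (x \<bullet> c) * f x)" if "b \<in> Basis" "c \<in> Basis" for b c
  proof (rule Bochner_Integration.integrable_bound[OF int])
    show "AE x in lborel. norm ((x \<bullet> b) * (x \<bullet> c) * f x) \<le> norm ((norm x)\<^sup>2 * f x)"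
    proof (rule AE_I2)
      fix x
      have "\<bar>x \<bullet> b\<bar> * \<bar>x \<bullet> c\<bar> \<le> norm x * norm x"
        using that by (intro mult_mono Basis_le_norm) auto
      then show "norm ((x \<bullet> b) * (x \<bullet> c) * f x) \<le> norm ((norm x)\<^sup>2 * f x)"
        by (simp add: abs_mult power2_eq_square mult_right_mono)
    qed
  qed measurable
  obtain b0 :: 'a where b0: "b0 \<in> Basis" using nonempty_Basis by blast
  have diag: "I b b = I b0 b0" if "b \<in> Basis" for b
  proof (cases "b = b0")
    case False
    show ?thesis unfolding I_def
      by (rule radial_second_moments(2)[OF assms(1) _ that b0 False]) (rule rad)
  qed simp
  have off: "I b c = (if c = b then I b0 b0 else 0)" if "b \<in> Basis" "c \<in> Basis" for b c
  proof (cases "b = c")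
    case False
    have "I b c = 0" unfolding I_def
      by (rule radial_second_moments(1)[OF assms(1) _ that False]) (rule rad)
    then show ?thesis using False by simp
  qed (use that diag in simp)
  note exp = bilinear_Basis_expansion[OF B]
  have "(LBINT x. B x x * f x) = (LBINT x. (\<Sum>b\<in>Basis. \<Sum>c\<in>Basis. B b c * ((x \<bullet> b) * (x \<bullet> c) * f x)))"
  proof (intro Bochner_Integration.integral_cong refl)
    fix x :: 'a
    show "B x x * f x = (\<Sum>b\<in>Basis. \<Sum>c\<in>Basis. B b c * ((x \<bullet> b) * (x \<bullet> c) * f x))"
      unfolding exp[of x] sum_distrib_right by (intro sum.cong refl) (simp only: mult_ac)
  qed
  also have "\<dots> = (\<Sum>b\<in>Basis. \<Sum>c\<in>Basis. B b c * I b c)"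
    using int_bc by (simp add: Bochner_Integration.integral_sum I_def)
  also have "\<dots> = (\<Sum>b\<in>Basis. \<Sum>c\<in>Basis. if c = b then B b b * I b0 b0 else 0)"
    by (intro sum.cong refl) (simp add: off)
  also have "\<dots> = (\<Sum>b\<in>Basis. B b b) * I b0 b0"
    by (simp add: sum_distrib_right)
  finally have 1: "(LBINT x. B x x * f x) = (\<Sum>b\<in>Basis. B b b) * I b0 b0" .
  have "(LBINT x. (norm x)\<^sup>2 * f x) = (LBINT x. (\<Sum>b\<in>Basis. (x \<bullet> b) * (x \<bullet> b) * f x))"
  proof (intro Bochner_Integration.integral_cong refl)
    fix x :: 'a
    have "(norm x)\<^sup>2 = (\<Sum>b\<in>Basis. (x \<bullet> b) * (x \<bullet> b))"
      unfolding power2_norm_eq_inner by (rule euclidean_inner)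
    then show "(norm x)\<^sup>2 * f x = (\<Sum>b\<in>Basis. (x \<bullet> b) * (x \<bullet> b) * f x)" by (simp add: sum_distrib_right)
  qed
  also have "\<dots> = (\<Sum>b\<in>Basis. I b b)"
    using int_bc by (simp add: Bochner_Integration.integral_sum I_def)
  also have "\<dots> = (\<Sum>b\<in>(Basis::'a set). I b0 b0)"
    by (rule sum.cong[OF refl diag])
  also have "\<dots> = real DIM('a) * I b0 b0" by (rule sum_constant)
  finally have 2: "(LBINT x. (norm x)\<^sup>2 * f x) = real DIM('a) * I b0 b0" .
  have cancel: "u * i = u / d * (d * i)" if "d \<noteq> 0" for u d i :: real using that by simp
  show ?thesis unfolding 1 2 by (rule cancel) simp
qed

lemma dominated_by_thin:
  fixes f :: "'m::euclidean_space \<times> real \<Rightarrow> real"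
  assumes [measurable]: "f \<in> borel_measurable borel" "q \<in> borel_measurable borel" and c: "0 \<le> c" and B: "0 \<le> B"
    and le: "(\<integral>\<^sup>+z. ennreal (norm z powr - p) * indicator (thin q M \<alpha> r) z \<partial>lborel) \<le> ennreal B"
    and bound: "\<And>z. z \<noteq> 0 \<Longrightarrow> \<bar>f z\<bar> \<le> c * norm z powr - p * indicator (thin q M \<alpha> r) z"
  shows "integrable lborel f" and "(LBINT z. \<bar>f z\<bar>) \<le> c * B"
proof -
  have "(\<integral>\<^sup>+z. ennreal \<bar>f z\<bar> \<partial>lborel) \<le> (\<integral>\<^sup>+z. ennreal c * (ennreal (norm z powr - p) * indicator (thin q M \<alpha> r) z) \<partial>lborel)"
  proof (rule nn_integral_mono_AE, rule AE_mp[OF AE_lborel_neq[of 0]], rule AE_I2, intro impI)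
    fix z :: "'m \<times> real" assume "z \<noteq> 0"
    from bound[OF this] show "ennreal \<bar>f z\<bar> \<le> ennreal c * (ennreal (norm z powr - p) * indicator (thin q M \<alpha> r) z)"
      using c by (auto simp: indicator_def simp flip: ennreal_mult intro!: ennreal_leI split: if_splits)
  qed
  also have "\<dots> = ennreal c * (\<integral>\<^sup>+z. ennreal (norm z powr - p) * indicator (thin q M \<alpha> r) z \<partial>lborel)"
    by (rule nn_integral_cmult) measurable
  also have "\<dots> \<le> ennreal c * ennreal B" using le by (rule mult_left_mono) simp
  also have "\<dots> = ennreal (c * B)" using c B by (simp add: ennreal_mult)
  finally have le': "(\<integral>\<^sup>+z. ennreal \<bar>f z\<bar> \<partial>lborel) \<le> ennreal (c * B)" .
  then show int: "integrable lborel f"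
    by (intro integrableI_bounded) (auto simp: le_less_trans)
  have "ennreal (LBINT z. \<bar>f z\<bar>) = (\<integral>\<^sup>+z. ennreal \<bar>f z\<bar> \<partial>lborel)"
    using int by (intro nn_integral_eq_integral[symmetric]) auto
  with le' have "ennreal (LBINT z. \<bar>f z\<bar>) \<le> ennreal (c * B)" by (simp only:)
  moreover have "0 \<le> c * B" using c B by simp
  ultimately show "(LBINT z. \<bar>f z\<bar>) \<le> c * B" by (simp only: ennreal_le_iff)
qed

text \<open>Halving the radius puts the cylinder inside the ball where the enclosure holds. Outside
  the cylinder \<open>thin\<close> contains everything and the trivial bound 2 is enough, so
  \<open>q'\<close> may be \<open>q\<close> cut off there.\<close>

lemma tau_sgn_thin:
  fixes q q' :: "'m::euclidean_space \<Rightarrow> real"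
  assumes sq: "squeezed E y R q M \<alpha> r" and R: "orthogonal_transformation R"
    and q: "continuous_on UNIV q" and \<alpha>: "0 < \<alpha>" and M: "0 \<le> M"
    and q': "\<And>x. norm x < r / 2 \<Longrightarrow> q' x = q x"
  shows "\<bar>tau E (y + R z) + sgn (snd z - q' (fst z))\<bar> \<le> 2 * indicator (thin q M \<alpha> (r / 2)) z"
proof (cases "z \<in> thin q M \<alpha> (r / 2)")
  case True
  have "\<bar>tau E (y + R z)\<bar> \<le> 1" using closure_subset[of E] by (auto simp: tau_def indicator_def)
  moreover have "\<bar>sgn (snd z - q' (fst z))\<bar> \<le> 1" by (simp add: abs_sgn_eq)
  ultimately have "\<bar>tau E (y + R z) + sgn (snd z - q' (fst z))\<bar> \<le> 2" by linarith
  then show ?thesis using True by simp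
next
  case False
  then have z: "norm (fst z) < r / 2" "\<bar>snd z\<bar> < r / 2" "M * norm (fst z) powr \<alpha> < \<bar>snd z - q (fst z)\<bar>"
    by (auto simp: thin_def)
  have nz: "norm z < r" using norm_Pair_le[of "fst z" "snd z"] z by simp
  have M': "0 \<le> M * norm (fst z) powr \<alpha>" using M by simp
  have qq: "q' (fst z) = q (fst z)" using q' z by simp
  consider "q (fst z) + M * norm (fst z) powr \<alpha> < snd z" | "snd z < q (fst z) - M * norm (fst z) powr \<alpha>"
    using z(3) by linarith
  then have "tau E (y + R z) + sgn (snd z - q (fst z)) = 0"
  proof cases
    case 1
    then have "0 < snd z - q (fst z)" using M' by linarith
    then show ?thesis using squeezed_tau(2)[OF sq R q \<alpha> nz 1] by simp
  next
    case 2
    then have "snd z - q (fst z) < 0" using M' by linarith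
    then show ?thesis using squeezed_tau(1)[OF sq R q \<alpha> nz 2] by simp
  qed
  then show ?thesis using False qq by simp
qed

lemma tau_rigid_measurable:
  fixes R :: "'a::euclidean_space \<Rightarrow> 'a"
  assumes "open E" and R: "orthogonal_transformation R"
  shows "(\<lambda>z. tau E (y + R z)) \<in> borel_measurable borel"
proof -
  note [measurable] = orthogonal_transformation_measurable[OF R]
  have [measurable]: "E \<in> sets borel" "closure E \<in> sets borel" using assms by auto
  show ?thesis unfolding tau_def by measurable
qed

text \<open>The added sign is odd in the last coordinate and contributes nothing to any truncated
  integral, but with it the integrand is absolutely integrable. The principal value then becomes an
  ordinary integral by dominated convergence.\<close>

lemma frac_curv_eq:
  fixes E :: "('m::euclidean_space \<times> real) set" and R :: "'m \<times> real \<Rightarrow> 'm \<times> real"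
  assumes E: "open E" and R: "orthogonal_transformation R" and p: "p = real DIM('m \<times> real) + 2 * s" and s: "0 < s"
    and int: "integrable lborel (\<lambda>z. norm z powr - p * (tau E (y + R z) + sgn (snd z)))"
  shows "frac_curv s E y = (LBINT z. norm z powr - p * (tau E (y + R z) + sgn (snd z)))"
proof -
  note [measurable] = tau_rigid_measurable[OF E R, of y] tau_rigid_measurable[OF E orthogonal_transformation_id[unfolded id_def], of 0, simplified]
  let ?g = "\<lambda>z. norm z powr - p * (tau E (y + R z) + sgn (snd z))"
  let ?F = "\<lambda>\<epsilon>. \<integral>w. indicator (- ball y \<epsilon>) w * tau E w / norm (y - w) powr (real DIM('m \<times> real) + 2 * s) \<partial>lborel"
  have F: "?F \<epsilon> = (LBINT z. indicator (- ball 0 \<epsilon>) z * ?g z)" if \<epsilon>: "0 < \<epsilon>" for \<epsilon>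
  proof -
    have "?F \<epsilon> = (LBINT z. indicator (- ball y \<epsilon>) (y + R z) * tau E (y + R z) / norm (y - (y + R z)) powr (real DIM('m \<times> real) + 2 * s))"
      by (rule integral_rigid(1)[OF R, symmetric]) measurable
    also have "\<dots> = (LBINT z. indicator (- ball 0 \<epsilon>) z * ?g z - indicator (- ball 0 \<epsilon>) z * norm z powr - p * sgn (snd z))"
    proof (intro Bochner_Integration.integral_cong refl)
      fix z
      have "norm (R z) = norm z" using R by (rule orthogonal_transformation_norm)
      then show "indicator (- ball y \<epsilon>) (y + R z) * tau E (y + R z) / norm (y - (y + R z)) powr (real DIM('m \<times> real) + 2 * s)
        = indicator (- ball 0 \<epsilon>) z * ?g z - indicator (- ball 0 \<epsilon>) z * norm z powr - p * sgn (snd z)"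
        unfolding p[symmetric] by (simp add: indicator_def dist_norm powr_minus divide_inverse algebra_simps)
    qed
    also have "\<dots> = (LBINT z. indicator (- ball 0 \<epsilon>) z * ?g z) - (LBINT z. indicator (- ball 0 \<epsilon>) z * norm z powr - p * sgn (snd (z::'m \<times> real)))"
    proof (rule Bochner_Integration.integral_diff)
      show "integrable lborel (\<lambda>z. indicator (- ball 0 \<epsilon>) z * ?g z)"
        by (rule Bochner_Integration.integrable_bound[OF int]) (auto simp: indicator_def)
      have *: "integrable lborel (\<lambda>z::'m \<times> real. norm z powr - p * indicator (- ball 0 \<epsilon>) z)"
      proof (rule integrableI_bounded)
        have "(\<integral>\<^sup>+z. ennreal (norm (norm (z::'m \<times> real) powr - p * indicator (- ball 0 \<epsilon>) z)) \<partial>lborel)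
          = (\<integral>\<^sup>+z. ennreal (norm (z::'m \<times> real) powr - p) * indicator (- ball 0 \<epsilon>) z \<partial>lborel)"
          by (intro nn_integral_cong) (auto simp: indicator_def)
        then show "(\<integral>\<^sup>+z. ennreal (norm (norm (z::'m \<times> real) powr - p * indicator (- ball 0 \<epsilon>) z)) \<partial>lborel) < \<infinity>"
          using nn_integral_norm_powr_outside_ball[where 'a="'m \<times> real" and e="- p", OF _ \<epsilon>] s p by simp
      qed (intro borel_measurable_times borel_measurable_indicator; simp)
      show "integrable lborel (\<lambda>z::'m \<times> real. indicator (- ball 0 \<epsilon>) z * norm z powr - p * sgn (snd z))"
        by (rule Bochner_Integration.integrable_bound[OF *]) (auto simp: indicator_def abs_mult abs_sgn_eq)
    qed
    also have "(LBINT z. indicator (- ball 0 \<epsilon>) z * norm z powr - p * sgn (snd (z::'m \<times> real))) = 0"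
      by (rule integral_vertically_odd) (measurable, simp add: indicator_def sgn_minus)
    finally show ?thesis by simp
  qed
  have "(?F \<longlongrightarrow> (LBINT z. ?g z)) (at_right 0)"
  proof (rule tendsto_at_right_sequentially[of 0 1])
    fix S :: "nat \<Rightarrow> real" assume S: "\<And>n. 0 < S n" "S \<longlonglongrightarrow> 0"
    have "(\<lambda>n. LBINT z. indicator (- ball 0 (S n)) z * ?g z) \<longlonglongrightarrow> (LBINT z. ?g z)"
    proof (rule integral_dominated_convergence[where w = "\<lambda>z. norm (?g z)"])
      show "integrable lborel (\<lambda>z. norm (?g z))" using int by (rule integrable_norm)
      show "AE z in lborel. (\<lambda>n. indicator (- ball 0 (S n)) z * ?g z) \<longlonglongrightarrow> ?g z"
        using AE_lborel_neq[of 0]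
      proof eventually_elim
        case (elim z)
        then have "\<forall>\<^sub>F n in sequentially. S n < norm z" using order_tendstoD(2)[OF S(2), of "norm z"] by simp
        then have "\<forall>\<^sub>F n in sequentially. ?g z = indicator (- ball 0 (S n)) z * ?g z"
          by eventually_elim (simp add: indicator_def)
        then show ?case by (rule Lim_transform_eventually[OF tendsto_const])
      qed
      show "AE z in lborel. norm (indicator (- ball 0 (S n)) z * ?g z) \<le> norm (?g z)" for n
        by (simp add: indicator_def)
    qed measurable
    then show "(\<lambda>n. ?F (S n)) \<longlonglongrightarrow> (LBINT z. ?g z)" using F[OF S(1)] by simp
  qed simp
  then show ?thesis unfolding frac_curv_def by (intro tendsto_Lim) simp
qed

context fractional_kernel
begin

lemma half_space_deviation:
  assumes E: "open E" and R: "orthogonal_transformation R" and \<rho>: "0 < \<rho>" and a: "\<bar>a\<bar> \<le> 1"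
    and zero: "uu P s E (y + (a * \<rho>) *\<^sub>R R (0, 1)) (\<rho> powr (2 * s)) = 0"
  shows "(LBINT w. P w * psi a (snd w)) = (LBINT z. k \<rho> (z - (0, a * \<rho>)) * (tau E (y + R z) + sgn (snd z)))"
proof -
  note [measurable] = tau_rigid_measurable[OF E R, of y]
  have w: "norm ((0, a * \<rho>) :: 'm \<times> real) \<le> \<rho>" using a \<rho> by (simp add: norm_Pair abs_mult mult_left_le_one_le)
  note int = k_shift_integrable[OF \<rho> w]
  have i1: "integrable lborel (\<lambda>z. k \<rho> (z - (0, a * \<rho>)) * tau E (y + R z))"
    by (rule Bochner_Integration.integrable_bound[OF int])
      (auto simp: abs_mult intro!: mult_left_le abs_tau_le)
  have i2: "integrable lborel (\<lambda>z. k \<rho> (z - (0, a * \<rho>)) * - sgn (snd z))"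
    by (rule Bochner_Integration.integrable_bound[OF int]) (auto simp: abs_mult abs_sgn_eq)
  have "(LBINT z. k \<rho> (z - (0, a * \<rho>)) * (tau E (y + R z) + sgn (snd z)))
    = (LBINT z. k \<rho> (z - (0, a * \<rho>)) * tau E (y + R z) - k \<rho> (z - (0, a * \<rho>)) * - sgn (snd z))"
    by (simp add: distrib_left)
  also have "\<dots> = (LBINT z. k \<rho> (z - (0, a * \<rho>)) * tau E (y + R z)) - (LBINT z. k \<rho> (z - (0, a * \<rho>)) * - sgn (snd z))"
    by (rule Bochner_Integration.integral_diff[OF i1 i2])
  also have "(LBINT z. k \<rho> (z - (0, a * \<rho>)) * tau E (y + R z)) = 0"
    using zero uu_chart[OF E R \<rho>] by simp
  finally show ?thesis unfolding half_space_identity[OF \<rho>] by simp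
qed

text \<open>If \<open>g0\<close> were zero, the half space term would be at most quadratic in
  \<open>a\<close>, contradicting its linear lower bound; the witness \<open>a\<close> makes
  \<open>quad_const * a\<close> smaller than \<open>lower_const\<close>.\<close>

lemma g0_pos: "0 < g0"
proof (rule ccontr)
  assume "\<not> 0 < g0"
  moreover have "0 \<le> g0" unfolding g0_def by (rule integral_nonneg_AE) (use P_pos less_imp_le in blast)
  ultimately have g: "g0 = 0" by simp
  note K = quad_const_nonneg lower_const_pos
  define a where "a = min 1 (lower_const / (2 * (quad_const + 1)))"
  have a: "0 < a" "a \<le> 1" using K by (auto simp: a_def)
  have "lower_const * a \<le> quad_const * a\<^sup>2" using half_space_quadratic[of a] half_space_lower[of a] a g by auto
  then have "lower_const \<le> quad_const * a" using a by (simp add: power2_eq_square)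
  also have "\<dots> \<le> quad_const * (lower_const / (2 * (quad_const + 1)))" using K by (intro mult_left_mono) (auto simp: a_def)
  also have "\<dots> < lower_const" using K by (simp add: field_simps add_pos_nonneg)
  finally show False by simp
qed


lemma shift_le: "\<bar>a\<bar> \<le> 1 \<Longrightarrow> 0 < \<rho> \<Longrightarrow> norm ((0, a * \<rho>) :: 'm \<times> real) \<le> \<rho>"
  by (simp add: norm_Pair abs_mult mult_left_le_one_le)

lemma k_shift_le_p:
  assumes "0 < \<rho>" "\<bar>a\<bar> \<le> 1" "z \<noteq> 0"
  shows "k \<rho> (z - (0, a * \<rho>)) \<le> Kb * \<rho> powr (2 * s) * norm z powr - p"
  using k_shift_le[OF assms(1) shift_le[OF assms(2,1)], of p z] assms(3) p_gt N_gt by (simp add: p_eq)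

lemma thin_bound:
  assumes "0 \<le> M" "0 < r" "1 + 2 * s < \<alpha>"
  obtains B where "0 \<le> B" and "\<And>q :: 'm \<Rightarrow> real. q \<in> borel_measurable borel \<Longrightarrow>
    (\<integral>\<^sup>+z. ennreal (norm z powr - p) * indicator (thin q M \<alpha> r) z \<partial>lborel) \<le> ennreal B"
proof -
  have "p - real DIM('m) < \<alpha>" using assms(3) by (simp add: real_DIM p_eq)
  moreover have "real DIM('m) + 1 < p" using p_gt by (simp add: real_DIM)
  ultimately show thesis using thin_integral_bound[where 'm='m, of M r p \<alpha>] assms that by blast
qed

section \<open>The kernel at small scales\<close>

text \<open>The evaluation point moves with \<open>n\<close>, so pointwise convergence would not
  suffice. The closed ball of radius \<open>norm z / 2\<close> around \<open>z\<close> avoids the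
  origin and finally contains the moving points, which brings the uniform limit into play.\<close>

lemma kernel_limit:
  assumes K_lim: "\<And>Kc. compact Kc \<Longrightarrow> 0 \<notin> Kc \<Longrightarrow> \<forall>\<epsilon>>0. \<exists>\<delta>>0. \<forall>t. 0 < t \<and> t < \<delta> \<longrightarrow>
      (\<forall>y\<in>Kc. \<bar>kernel P s y t / t - C / norm y powr (real DIM('m \<times> real) + 2 * s)\<bar> \<le> \<epsilon>)"
    and z: "z \<noteq> 0" and \<rho>: "\<And>n. 0 < \<rho> n" "\<rho> \<longlonglongrightarrow> 0" and a: "\<And>n. \<bar>a n\<bar> \<le> 1"
  shows "(\<lambda>n. k (\<rho> n) (z - (0, a n * \<rho> n)) * \<rho> n powr - (2 * s)) \<longlonglongrightarrow> C * norm z powr - p"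
proof -
  define Y where "Y n = z - (0, a n * \<rho> n)" for n
  have "(\<lambda>n. (0, a n * \<rho> n) :: 'm \<times> real) \<longlonglongrightarrow> (0, 0)"
  proof (intro tendsto_Pair tendsto_const)
    show "(\<lambda>n. a n * \<rho> n) \<longlonglongrightarrow> 0"
    proof (rule tendsto_rabs_zero_cancel[OF tendsto_sandwich[OF _ _ tendsto_const \<rho>(2)]])
      show "\<forall>\<^sub>F n in sequentially. \<bar>a n * \<rho> n\<bar> \<le> \<rho> n"
        using a \<rho>(1) by (intro always_eventually allI) (simp add: abs_mult mult_left_le_one_le less_imp_le)
    qed simp
  qed
  then have "Y \<longlonglongrightarrow> z - (0, 0)" unfolding Y_def by (intro tendsto_diff tendsto_const)
  then have Y: "Y \<longlonglongrightarrow> z" by (simp add: zero_prod_def[symmetric])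
  have t: "(\<lambda>n. \<rho> n powr (2 * s)) \<longlonglongrightarrow> 0"
    using tendsto_powr'[OF \<rho>(2) tendsto_const, of "2 * s"] s \<rho>(1) by (simp add: less_imp_le)
  let ?B = "cball z (norm z / 2)"
  have "0 \<notin> ?B" using z by (simp add: dist_norm)
  from K_lim[OF compact_cball this]
  have unif: "\<exists>\<delta>>0. \<forall>t. 0 < t \<and> t < \<delta> \<longrightarrow> (\<forall>y\<in>?B. \<bar>kernel P s y t / t - C / norm y powr p\<bar> \<le> \<epsilon>)" if "0 < \<epsilon>" for \<epsilon>
    using that by (simp add: real_DIM p_eq)
  have inB: "\<forall>\<^sub>F n in sequentially. Y n \<in> ?B"
  proof -
    have "\<forall>\<^sub>F n in sequentially. dist (Y n) z < norm z / 2" using Y z by (intro tendstoD) auto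
    then show ?thesis by eventually_elim (simp add: dist_commute)
  qed
  have "(\<lambda>n. kernel P s (Y n) (\<rho> n powr (2 * s)) / \<rho> n powr (2 * s) - C / norm (Y n) powr p) \<longlonglongrightarrow> 0"
  proof (rule tendstoI)
    fix \<epsilon> :: real assume \<epsilon>: "0 < \<epsilon>"
    then obtain \<delta> where \<delta>: "0 < \<delta>" "\<And>t y. 0 < t \<Longrightarrow> t < \<delta> \<Longrightarrow> y \<in> ?B \<Longrightarrow> \<bar>kernel P s y t / t - C / norm y powr p\<bar> \<le> \<epsilon> / 2"
      using unif[of "\<epsilon> / 2"] by auto
    have "\<forall>\<^sub>F n in sequentially. \<rho> n powr (2 * s) < \<delta>" using order_tendstoD(2)[OF t \<delta>(1)] .
    with inB show "\<forall>\<^sub>F n in sequentially. dist (kernel P s (Y n) (\<rho> n powr (2 * s)) / \<rho> n powr (2 * s) - C / norm (Y n) powr p) 0 < \<epsilon>"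
    proof eventually_elim
      case (elim n)
      have "0 < \<rho> n powr (2 * s)" using \<rho>(1)[of n] by simp
      from \<delta>(2)[OF this elim(2,1)] show ?case using \<epsilon> by (simp add: dist_norm)
    qed
  qed
  moreover have "(\<lambda>n. C / norm (Y n) powr p) \<longlonglongrightarrow> C / norm z powr p"
    using z by (intro tendsto_divide tendsto_const tendsto_powr tendsto_norm Y) auto
  ultimately have "(\<lambda>n. (kernel P s (Y n) (\<rho> n powr (2 * s)) / \<rho> n powr (2 * s) - C / norm (Y n) powr p) + C / norm (Y n) powr p)
      \<longlonglongrightarrow> 0 + C / norm z powr p"
    by (rule tendsto_add)
  moreover have "kernel P s (Y n) (\<rho> n powr (2 * s)) / \<rho> n powr (2 * s) = k (\<rho> n) (z - (0, a n * \<rho> n)) * \<rho> n powr - (2 * s)" for n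
    by (simp add: kernel_eq[OF \<rho>(1)] Y_def powr_minus divide_inverse)
  moreover have "C * norm z powr - p = C / norm z powr p" by (simp add: powr_minus divide_inverse)
  ultimately show ?thesis by (simp only: diff_add_cancel add_0_left)
qed

lemma rescaled_kernel_le:
  assumes \<rho>: "0 < \<rho>" and a: "\<bar>a\<bar> \<le> 1" and z: "z \<noteq> 0"
  shows "\<bar>k \<rho> (z - (0, a * \<rho>)) * \<rho> powr - (2 * s) - C * norm z powr - p\<bar> \<le> (Kb + \<bar>C\<bar>) * norm z powr - p"
proof -
  have "k \<rho> (z - (0, a * \<rho>)) * \<rho> powr - (2 * s) \<le> Kb * \<rho> powr (2 * s) * norm z powr - p * \<rho> powr - (2 * s)"
    by (intro mult_right_mono k_shift_le_p \<rho> a z) simp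
  also have "\<dots> = Kb * norm z powr - p * (\<rho> powr (2 * s) * \<rho> powr - (2 * s))" by (simp only: mult_ac)
  also have "\<rho> powr (2 * s) * \<rho> powr - (2 * s) = 1" using \<rho> by (simp flip: powr_add)
  finally have "k \<rho> (z - (0, a * \<rho>)) * \<rho> powr - (2 * s) \<le> Kb * norm z powr - p" by simp
  moreover have "0 \<le> k \<rho> (z - (0, a * \<rho>)) * \<rho> powr - (2 * s)" using k_pos[OF \<rho>] by (simp add: less_imp_le)
  moreover have "\<bar>C * norm z powr - p\<bar> = \<bar>C\<bar> * norm z powr - p" by (simp add: abs_mult)
  ultimately show ?thesis unfolding distrib_right by linarith
qed

text \<open>The dominating function does not involve the boundary point, hence dominated convergence along sequences of scales
  and shifts already yields uniformity in \<open>y\<close>.\<close>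

lemma kernel_limit_thin:
  assumes K_lim: "\<And>Kc. compact Kc \<Longrightarrow> 0 \<notin> Kc \<Longrightarrow> \<forall>\<epsilon>>0. \<exists>\<delta>>0. \<forall>t. 0 < t \<and> t < \<delta> \<longrightarrow>
      (\<forall>y\<in>Kc. \<bar>kernel P s y t / t - C / norm y powr (real DIM('m \<times> real) + 2 * s)\<bar> \<le> \<epsilon>)"
    and M: "0 \<le> M" and r: "0 < r" and \<alpha>: "1 + 2 * s < \<alpha>" and \<epsilon>: "0 < \<epsilon>"
  shows "\<exists>\<rho>0>0. \<forall>\<rho> a. 0 < \<rho> \<and> \<rho> < \<rho>0 \<and> \<bar>a\<bar> \<le> 1 \<longrightarrow>
    (LBINT z. \<bar>k \<rho> (z - (0, a * \<rho>)) * \<rho> powr - (2 * s) - C * norm z powr - p\<bar> * (2 * indicator (thin (\<lambda>_. 0) M \<alpha> r) z)) \<le> \<epsilon>"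
proof (rule ccontr)
  let ?f = "\<lambda>\<rho> a z. \<bar>k \<rho> (z - (0, a * \<rho>)) * \<rho> powr - (2 * s) - C * norm z powr - p\<bar> * (2 * indicator (thin (\<lambda>_. 0) M \<alpha> r) z)"
  assume "\<not> ?thesis"
  then have neg: "\<exists>\<rho> a. 0 < \<rho> \<and> \<rho> < \<rho>0 \<and> \<bar>a\<bar> \<le> 1 \<and> \<epsilon> < (LBINT z. ?f \<rho> a z)" if "0 < \<rho>0" for \<rho>0
    using that by (auto simp: not_le)
  define Q where "Q n \<rho> a \<longleftrightarrow> 0 < \<rho> \<and> \<rho> < 1 / real (Suc n) \<and> \<bar>a\<bar> \<le> 1 \<and> \<epsilon> < (LBINT z. ?f \<rho> a z)" for n \<rho> a
  have "\<exists>\<rho> a. Q n \<rho> a" for n unfolding Q_def by (rule neg) simp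
  then obtain \<rho> a where Q: "\<And>n. Q n (\<rho> n) (a n)" by metis
  have \<rho>: "\<And>n. 0 < \<rho> n" "\<And>n. \<rho> n < 1 / real (Suc n)" and a: "\<And>n::nat. \<bar>a n\<bar> \<le> 1"
    and gt: "\<And>n. \<epsilon> < (LBINT z. ?f (\<rho> n) (a n) z)"
    using Q unfolding Q_def by blast+
  have lim: "\<rho> \<longlonglongrightarrow> 0"
  proof (rule tendsto_sandwich[OF _ _ tendsto_const LIMSEQ_inverse_real_of_nat])
    show "\<forall>\<^sub>F n in sequentially. 0 \<le> \<rho> n" using \<rho>(1) by (intro always_eventually allI less_imp_le)
    show "\<forall>\<^sub>F n in sequentially. \<rho> n \<le> inverse (real (Suc n))"
      unfolding inverse_eq_divide using \<rho>(2) by (intro always_eventually allI less_imp_le)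
  qed
  obtain B where B: "0 \<le> B" "\<And>q :: 'm \<Rightarrow> real. q \<in> borel_measurable borel \<Longrightarrow>
    (\<integral>\<^sup>+z. ennreal (norm z powr - p) * indicator (thin q M \<alpha> r) z \<partial>lborel) \<le> ennreal B"
    by (rule thin_bound[OF M r \<alpha>]) blast
  let ?g = "\<lambda>z. (Kb + \<bar>C\<bar>) * norm z powr - p * (2 * indicator (thin (\<lambda>_::'m. 0) M \<alpha> r) z)"
  have [measurable]: "thin (\<lambda>_::'m. 0) M \<alpha> r \<in> sets borel" by (rule sets_thin) simp
  have g_int: "integrable lborel ?g"
  proof (rule dominated_by_thin(1)[where q = "\<lambda>_. 0" and c = "2 * (Kb + \<bar>C\<bar>)" and B = B])
    show "(\<integral>\<^sup>+z. ennreal (norm z powr - p) * indicator (thin (\<lambda>_::'m. 0) M \<alpha> r) z \<partial>lborel) \<le> ennreal B" by (rule B(2)) simp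
  qed (use Kb_pos B(1) in \<open>auto simp: abs_mult indicator_def\<close>)
  have "(\<lambda>n. LBINT z. ?f (\<rho> n) (a n) z) \<longlonglongrightarrow> (LBINT z::'m \<times> real. 0)"
  proof (rule integral_dominated_convergence[OF _ _ g_int])
    show "AE z in lborel. (\<lambda>n. ?f (\<rho> n) (a n) z) \<longlonglongrightarrow> 0"
      using AE_lborel_neq[of 0]
    proof eventually_elim
      case (elim z)
      from tendsto_diff[OF kernel_limit[OF K_lim elim \<rho>(1) lim a] tendsto_const[of "C * norm z powr - p"]]
      have "(\<lambda>n. \<bar>k (\<rho> n) (z - (0, a n * \<rho> n)) * \<rho> n powr - (2 * s) - C * norm z powr - p\<bar>) \<longlonglongrightarrow> 0"
        by (intro tendsto_rabs_zero) simp
      then show ?case by (rule tendsto_mult_left_zero)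
    qed
    show "AE z in lborel. norm (?f (\<rho> n) (a n) z) \<le> ?g z" for n
      using AE_lborel_neq[of 0]
    proof eventually_elim
      case (elim z)
      from rescaled_kernel_le[OF \<rho>(1) a elim, of n n C] show ?case by (simp add: abs_mult indicator_def)
    qed
  qed measurable
  then have "(\<lambda>n. LBINT z. ?f (\<rho> n) (a n) z) \<longlonglongrightarrow> 0" by simp
  from order_tendstoD(2)[OF this \<epsilon>] obtain n where "(LBINT z. ?f (\<rho> n) (a n) z) < \<epsilon>"
    by (auto simp: eventually_sequentially)
  with gt[of n] show False by simp
qed

subsection \<open>Motion of the boundary\<close>

text \<open>The radius of the ball is exactly the scale \<open>\<rho>\<close>, so membership in it
  is the normalisation of the rescaled displacement.\<close>

lemma motion_rescaled:
  assumes E: "open E" and \<rho>: "0 < \<rho>" and sig: "sigma s t = \<rho> powr (2 * s)"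
    and pt: "y + (v * t) *\<^sub>R ext_normal E y \<in> frontier (Et P s E t) \<inter> ball y (sigma s t powr (1 / (2 * s)))"
    and ch: "chart E y R \<gamma> r"
  shows "\<bar>v * t / \<rho>\<bar> \<le> 1" and "uu P s E (y + (v * t / \<rho> * \<rho>) *\<^sub>R R (0, 1)) (\<rho> powr (2 * s)) = 0"
proof -
  note nu = ext_normal_eq[OF ch]
  have rad: "sigma s t powr (1 / (2 * s)) = \<rho>" using s \<rho> by (simp add: sig powr_powr)
  have "\<bar>v * t\<bar> < \<rho>" using pt norm_chart_normal[OF ch] by (simp add: nu rad dist_norm)
  then show "\<bar>v * t / \<rho>\<bar> \<le> 1" using \<rho> by simp
  show "uu P s E (y + (v * t / \<rho> * \<rho>) *\<^sub>R R (0, 1)) (\<rho> powr (2 * s)) = 0"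
    using frontier_Et_zero[OF E sig \<rho>, of "y + (v * t) *\<^sub>R ext_normal E y"] pt \<rho> by (simp add: nu)
qed

text \<open>The deviation is O(rho^(2s)), so the lower bound of the half space term gives the same
  order for \<open>a\<close>. After division by \<open>\<rho> powr (2 * s)\<close> the quadratic
  term still vanishes and the kernel may be replaced by its limit, uniformly in
  \<open>y\<close>.\<close>

lemma fractional_motion:
  assumes K_lim: "\<And>Kc. compact Kc \<Longrightarrow> 0 \<notin> Kc \<Longrightarrow> \<forall>\<epsilon>>0. \<exists>\<delta>>0. \<forall>t. 0 < t \<and> t < \<delta> \<longrightarrow>
      (\<forall>y\<in>Kc. \<bar>kernel P s y t / t - C / norm y powr (real DIM('m \<times> real) + 2 * s)\<bar> \<le> \<epsilon>)"
    and s2: "s < 1 / 2" and E: "open E" and \<beta>: "2 * s < \<beta>" and bd: "boundary_C1beta \<beta> E"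
    and K: "compact K" "K \<subseteq> frontier E" and \<epsilon>: "0 < \<epsilon>"
  shows "\<exists>\<delta>>0. \<forall>t y v. 0 < t \<and> t < \<delta> \<and> y \<in> K \<and>
    y + (v * t) *\<^sub>R ext_normal E y \<in> frontier (Et P s E t) \<inter> ball y (sigma s t powr (1 / (2 * s)))
    \<longrightarrow> \<bar>v - C / (2 * g0) * frac_curv s E y\<bar> \<le> \<epsilon>"
proof -
  have "0 < \<beta>" using \<beta> s by simp
  from squeezed_C1_holder[OF E bd this K] obtain r M where r: "0 < r" and M: "0 \<le> M"
    and sq: "\<And>y R \<gamma> r'. y \<in> K \<Longrightarrow> chart E y R \<gamma> r' \<Longrightarrow> squeezed E y R (\<lambda>x. 0) M (1 + \<beta>) r" by blast
  define \<alpha> where "\<alpha> = 1 + \<beta>"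
  have \<alpha>: "1 + 2 * s < \<alpha>" using \<beta> by (simp add: \<alpha>_def)
  note sq = sq[folded \<alpha>_def]
  have r2: "0 < r / 2" using r by simp
  obtain B where B: "0 \<le> B" "\<And>q :: 'm \<Rightarrow> real. q \<in> borel_measurable borel \<Longrightarrow>
    (\<integral>\<^sup>+z. ennreal (norm z powr - p) * indicator (thin q M \<alpha> (r / 2)) z \<partial>lborel) \<le> ennreal B"
    by (rule thin_bound[OF M r2 \<alpha>]) blast
  have B0: "(\<integral>\<^sup>+z. ennreal (norm z powr - p) * indicator (thin (\<lambda>_::'m. 0) M \<alpha> (r / 2)) z \<partial>lborel) \<le> ennreal B"
    by (rule B(2)) simp
  define K1 where "K1 = 2 * Kb * B / lower_const"
  have K1: "0 \<le> K1" using Kb_pos B(1) lower_const_pos by (simp add: K1_def)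
  \<comment> \<open>Two errors of this size, from the kernel limit and from the quadratic term, add
    up to \<open>2 * g0 * \<epsilon>\<close>, and the final division is by
    \<open>2 * g0\<close>.\<close>
  have g\<epsilon>: "0 < g0 * \<epsilon>" using g0_pos \<epsilon> by simp
  from kernel_limit_thin[OF K_lim M r2 \<alpha> g\<epsilon>] obtain \<rho>1 where \<rho>1: "0 < \<rho>1"
    and lim: "\<And>\<rho> a. 0 < \<rho> \<Longrightarrow> \<rho> < \<rho>1 \<Longrightarrow> \<bar>a\<bar> \<le> 1 \<Longrightarrow>
      (LBINT z. \<bar>k \<rho> (z - (0, a * \<rho>)) * \<rho> powr - (2 * s) - C * norm z powr - p\<bar> * (2 * indicator (thin (\<lambda>_. 0) M \<alpha> (r / 2)) z)) \<le> g0 * \<epsilon>"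
    by blast
  \<comment> \<open>Below this scale \<open>quad_const * K1\<^sup>2 * \<rho> powr (2 * s)\<close>,
    the rescaled quadratic error, is at most \<open>g0 * \<epsilon>\<close>; the \<open>+ 1\<close>
    keeps the denominator positive.\<close>
  define \<rho>2 where "\<rho>2 = (g0 * \<epsilon> / (quad_const * K1\<^sup>2 + 1)) powr (1 / (2 * s))"
  have KK: "0 < quad_const * K1\<^sup>2 + 1" using quad_const_nonneg by (intro add_nonneg_pos mult_nonneg_nonneg) auto
  have \<rho>2: "0 < \<rho>2" using KK g0_pos \<epsilon> by (simp add: \<rho>2_def)
  have main: "\<bar>a * \<rho> powr - (2 * s) - C / (2 * g0) * frac_curv s E y\<bar> \<le> \<epsilon>"
    if \<rho>: "0 < \<rho>" "\<rho> < min \<rho>1 \<rho>2" and a: "\<bar>a\<bar> \<le> 1" and y: "y \<in> K" and ch: "chart E y R \<gamma> r'"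
      and zero: "uu P s E (y + (a * \<rho>) *\<^sub>R R (0, 1)) (\<rho> powr (2 * s)) = 0" for \<rho> a y R \<gamma> r'
  proof -
    have R: "orthogonal_transformation R" using ch by (simp add: chart_def)
    note [measurable] = tau_rigid_measurable[OF E R, of y]
    have [measurable]: "thin (\<lambda>_::'m. 0) M \<alpha> (r / 2) \<in> sets borel" by (rule sets_thin) simp
    define d where "d z = tau E (y + R z) + sgn (snd z)" for z
    have dm[measurable]: "d \<in> borel_measurable borel" unfolding d_def[abs_def] by measurable
    have d_le: "\<bar>d z\<bar> \<le> 2 * indicator (thin (\<lambda>_. 0) M \<alpha> (r / 2)) z" for z
      using tau_sgn_thin[OF sq[OF y ch] R continuous_on_const _ M, of "\<lambda>_. 0" z] \<alpha> s by (simp add: d_def)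
    define A where "A = (LBINT z. k \<rho> (z - (0, a * \<rho>)) * d z)"
    have GA: "(LBINT w. P w * psi a (snd w)) = A"
      unfolding A_def d_def by (rule half_space_deviation[OF E R \<rho>(1) a zero])
    define H where "H = (LBINT z. norm z powr - p * d z)"
    have kd: "\<bar>k \<rho> (z - (0, a * \<rho>)) * d z\<bar> \<le> 2 * Kb * \<rho> powr (2 * s) * norm z powr - p * indicator (thin (\<lambda>_. 0) M \<alpha> (r / 2)) z"
      if "z \<noteq> 0" for z
    proof -
      have "\<bar>k \<rho> (z - (0, a * \<rho>)) * d z\<bar> = k \<rho> (z - (0, a * \<rho>)) * \<bar>d z\<bar>"
        using k_pos[OF \<rho>(1), of "z - (0, a * \<rho>)"] by (simp add: abs_mult)
      also have "\<dots> \<le> (Kb * \<rho> powr (2 * s) * norm z powr - p) * (2 * indicator (thin (\<lambda>_. 0) M \<alpha> (r / 2)) z)"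
        using Kb_pos by (intro mult_mono k_shift_le_p[OF \<rho>(1) a that] d_le) auto
      finally show ?thesis by (simp add: mult_ac)
    qed
    have c0: "0 \<le> 2 * Kb * \<rho> powr (2 * s)" using Kb_pos by simp
    have kd_m: "(\<lambda>z. k \<rho> (z - (0, a * \<rho>)) * d z) \<in> borel_measurable borel" by measurable
    have zm: "(\<lambda>_::'m. 0::real) \<in> borel_measurable borel" by simp
    note kd_int = dominated_by_thin[OF kd_m zm c0 B(1) B0 kd]
    have nd: "\<bar>norm z powr - p * d z\<bar> \<le> 2 * norm z powr - p * indicator (thin (\<lambda>_. 0) M \<alpha> (r / 2)) z" for z
      using mult_left_mono[OF d_le[of z], of "norm z powr - p"] by (simp add: abs_mult mult_ac)
    have nd_m: "(\<lambda>z. norm z powr - p * d z) \<in> borel_measurable borel" by measurable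
    note nd_int = dominated_by_thin(1)[OF nd_m zm _ B(1) B0 nd, simplified]
    have H: "frac_curv s E y = H" unfolding H_def d_def
      by (rule frac_curv_eq[OF E R _ s(1)]) (use nd_int in \<open>simp_all add: p_eq real_DIM d_def\<close>)
    have "\<bar>A\<bar> \<le> (LBINT z. \<bar>k \<rho> (z - (0, a * \<rho>)) * d z\<bar>)" unfolding A_def by (rule integral_abs_bound)
    also have "\<dots> \<le> 2 * Kb * \<rho> powr (2 * s) * B" by (rule kd_int(2))
    finally have "lower_const * \<bar>a\<bar> \<le> 2 * Kb * \<rho> powr (2 * s) * B" using half_space_lower[OF a] by (simp add: GA)
    then have a_le: "\<bar>a\<bar> \<le> K1 * \<rho> powr (2 * s)" using lower_const_pos by (simp add: K1_def field_simps)
    have pw: "\<rho> powr (2 * s) * \<rho> powr - (2 * s) = 1" using \<rho> by (simp flip: powr_add)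
    have diff_m: "(\<lambda>z. \<bar>k \<rho> (z - (0, a * \<rho>)) * \<rho> powr - (2 * s) - C * norm z powr - p\<bar> * (2 * indicator (thin (\<lambda>_. 0) M \<alpha> (r / 2)) z)) \<in> borel_measurable borel"
      by measurable
    have i1: "integrable lborel (\<lambda>z. k \<rho> (z - (0, a * \<rho>)) * d z * \<rho> powr - (2 * s))"
      by (rule integrable_mult_left, rule kd_int(1))
    have i2: "integrable lborel (\<lambda>z. C * (norm z powr - p * d z))"
      by (rule integrable_mult_right, rule nd_int)
    have e0: "A * \<rho> powr - (2 * s) - C * H = (LBINT z. k \<rho> (z - (0, a * \<rho>)) * d z * \<rho> powr - (2 * s) - C * (norm z powr - p * d z))"
      unfolding A_def H_def by (simp only: Bochner_Integration.integral_diff[OF i1 i2] integral_mult_left_zero integral_mult_right_zero)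
    have e1: "\<bar>LBINT z. k \<rho> (z - (0, a * \<rho>)) * d z * \<rho> powr - (2 * s) - C * (norm z powr - p * d z)\<bar> \<le> (LBINT z. \<bar>k \<rho> (z - (0, a * \<rho>)) * d z * \<rho> powr - (2 * s) - C * (norm z powr - p * d z)\<bar>)"
      by (rule integral_abs_bound)
    have e2: "(LBINT z. \<bar>k \<rho> (z - (0, a * \<rho>)) * d z * \<rho> powr - (2 * s) - C * (norm z powr - p * d z)\<bar>)
      \<le> (LBINT z. \<bar>k \<rho> (z - (0, a * \<rho>)) * \<rho> powr - (2 * s) - C * norm z powr - p\<bar> * (2 * indicator (thin (\<lambda>_. 0) M \<alpha> (r / 2)) z))"
    proof (rule integral_mono)
      show "integrable lborel (\<lambda>z. \<bar>k \<rho> (z - (0, a * \<rho>)) * d z * \<rho> powr - (2 * s) - C * (norm z powr - p * d z)\<bar>)"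
        by (rule integrable_abs, rule Bochner_Integration.integrable_diff[OF i1 i2])
      show "integrable lborel (\<lambda>z. \<bar>k \<rho> (z - (0, a * \<rho>)) * \<rho> powr - (2 * s) - C * norm z powr - p\<bar> * (2 * indicator (thin (\<lambda>_. 0) M \<alpha> (r / 2)) z))"
      proof (rule dominated_by_thin(1)[OF diff_m zm _ B(1) B0])
        show "0 \<le> 2 * (Kb + \<bar>C\<bar>)" using Kb_pos by simp
        fix z :: "'m \<times> real" assume z: "z \<noteq> 0"
        from rescaled_kernel_le[OF \<rho>(1) a z, of C]
        show "\<bar>\<bar>k \<rho> (z - (0, a * \<rho>)) * \<rho> powr - (2 * s) - C * norm z powr - p\<bar> * (2 * indicator (thin (\<lambda>_. 0) M \<alpha> (r / 2)) z)\<bar>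
          \<le> 2 * (Kb + \<bar>C\<bar>) * norm z powr - p * indicator (thin (\<lambda>_. 0) M \<alpha> (r / 2)) z"
          by (simp add: abs_mult indicator_def algebra_simps)
      qed
      fix z :: "'m \<times> real"
      have "k \<rho> (z - (0, a * \<rho>)) * d z * \<rho> powr - (2 * s) - C * (norm z powr - p * d z)
          = (k \<rho> (z - (0, a * \<rho>)) * \<rho> powr - (2 * s) - C * norm z powr - p) * d z" by (simp add: algebra_simps)
      then show "\<bar>k \<rho> (z - (0, a * \<rho>)) * d z * \<rho> powr - (2 * s) - C * (norm z powr - p * d z)\<bar>
          \<le> \<bar>k \<rho> (z - (0, a * \<rho>)) * \<rho> powr - (2 * s) - C * norm z powr - p\<bar> * (2 * indicator (thin (\<lambda>_. 0) M \<alpha> (r / 2)) z)"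
        by (simp only: abs_mult) (rule mult_left_mono[OF d_le abs_ge_zero])
    qed
    have "(LBINT z. \<bar>k \<rho> (z - (0, a * \<rho>)) * \<rho> powr - (2 * s) - C * norm z powr - p\<bar> * (2 * indicator (thin (\<lambda>_. 0) M \<alpha> (r / 2)) z)) \<le> g0 * \<epsilon>"
      using \<rho> by (intro lim a) auto
    then have 1: "\<bar>A * \<rho> powr - (2 * s) - C * H\<bar> \<le> g0 * \<epsilon>"
      unfolding e0 by (rule order_trans[OF order_trans[OF e1 e2]])
    have 2: "\<bar>A * \<rho> powr - (2 * s) - 2 * g0 * (a * \<rho> powr - (2 * s))\<bar> \<le> g0 * \<epsilon>"
    proof -
      have "A * \<rho> powr - (2 * s) - 2 * g0 * (a * \<rho> powr - (2 * s)) = (A - 2 * g0 * a) * \<rho> powr - (2 * s)"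
        by (simp add: algebra_simps)
      also have "\<bar>\<dots>\<bar> \<le> quad_const * a\<^sup>2 * \<rho> powr - (2 * s)"
        using half_space_quadratic[of a] by (simp add: GA abs_mult mult_right_mono)
      also have "a\<^sup>2 \<le> (K1 * \<rho> powr (2 * s))\<^sup>2" using power_mono[OF a_le, of 2] by simp
      also have "quad_const * (K1 * \<rho> powr (2 * s))\<^sup>2 * \<rho> powr - (2 * s) = quad_const * K1\<^sup>2 * \<rho> powr (2 * s) * (\<rho> powr (2 * s) * \<rho> powr - (2 * s))"
        by (simp only: power2_eq_square mult_ac)
      also have "\<dots> = quad_const * K1\<^sup>2 * \<rho> powr (2 * s)" by (simp only: pw mult_1_right)
      also have "\<dots> \<le> quad_const * K1\<^sup>2 * (g0 * \<epsilon> / (quad_const * K1\<^sup>2 + 1))"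
      proof (rule mult_left_mono)
        have "\<rho> powr (2 * s) \<le> \<rho>2 powr (2 * s)" using \<rho> s by (intro powr_mono2) auto
        also have "\<dots> = g0 * \<epsilon> / (quad_const * K1\<^sup>2 + 1)"
          using s by (simp add: \<rho>2_def powr_powr abs_of_pos[OF g\<epsilon>] abs_of_pos[OF KK])
        finally show "\<rho> powr (2 * s) \<le> g0 * \<epsilon> / (quad_const * K1\<^sup>2 + 1)" .
      qed (use quad_const_nonneg in simp)
      also have "\<dots> \<le> g0 * \<epsilon>"
        using KK g\<epsilon> by (simp add: divide_le_eq algebra_simps)
      finally show ?thesis using quad_const_nonneg by (simp add: mult_left_mono mult_right_mono)
    qed
    have "2 * g0 * (a * \<rho> powr - (2 * s) - C / (2 * g0) * H) = 2 * g0 * (a * \<rho> powr - (2 * s)) - C * H"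
      using g0_pos by (simp add: right_diff_distrib)
    then have "\<bar>2 * g0 * (a * \<rho> powr - (2 * s) - C / (2 * g0) * H)\<bar> \<le> 2 * g0 * \<epsilon>" using 1 2 by linarith
    then have "2 * g0 * \<bar>a * \<rho> powr - (2 * s) - C / (2 * g0) * H\<bar> \<le> 2 * g0 * \<epsilon>"
      using g0_pos by (simp add: abs_mult)
    then show ?thesis using g0_pos by (simp add: H)
  qed
  show ?thesis
  proof (intro exI conjI allI impI)
    show "0 < min \<rho>1 \<rho>2 powr (1 + 2 * s)" using \<rho>1 \<rho>2 by simp
    fix t y v
    assume H: "0 < t \<and> t < min \<rho>1 \<rho>2 powr (1 + 2 * s) \<and> y \<in> K \<and>
      y + (v * t) *\<^sub>R ext_normal E y \<in> frontier (Et P s E t) \<inter> ball y (sigma s t powr (1 / (2 * s)))"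
    then have t: "0 < t" "t < min \<rho>1 \<rho>2 powr (1 + 2 * s)" and y: "y \<in> K" by blast+
    obtain R \<gamma> r' where ch: "chart E y R \<gamma> r'" using bd K(2) y unfolding boundary_C1beta_def by blast
    define \<rho> where "\<rho> = t powr (1 / (1 + 2 * s))"
    have \<rho>: "0 < \<rho>" using t by (simp add: \<rho>_def)
    have sig: "sigma s t = \<rho> powr (2 * s)" using s2 t by (simp add: sigma_def \<rho>_def powr_powr)
    \<comment> \<open>Thus \<open>v\<close> is the rescaled displacement divided by
      \<open>\<rho> powr (2 * s)\<close>.\<close>
    have t_eq: "t = \<rho> * \<rho> powr (2 * s)"
    proof -
      have "\<rho> * \<rho> powr (2 * s) = \<rho> powr (1 + 2 * s)" using \<rho> by (simp add: powr_add)
      also have "\<dots> = t" using s t by (simp add: \<rho>_def powr_powr)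
      finally show ?thesis by simp
    qed
    have "\<rho> < (min \<rho>1 \<rho>2 powr (1 + 2 * s)) powr (1 / (1 + 2 * s))"
      unfolding \<rho>_def using t s by (intro powr_less_mono2) auto
    also have "\<dots> = min \<rho>1 \<rho>2" using s \<rho>1 \<rho>2 by (simp add: powr_powr)
    finally have small: "\<rho> < min \<rho>1 \<rho>2" .
    have "y + (v * t) *\<^sub>R ext_normal E y \<in> frontier (Et P s E t) \<inter> ball y (sigma s t powr (1 / (2 * s)))" using H by blast
    note scaled = motion_rescaled[OF E \<rho> sig this ch]
    have "\<bar>v * t / \<rho> * \<rho> powr - (2 * s) - C / (2 * g0) * frac_curv s E y\<bar> \<le> \<epsilon>"
      by (rule main[OF \<rho> small scaled(1) y ch scaled(2)])
    moreover have "v * t / \<rho> * \<rho> powr - (2 * s) = v"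
    proof -
      have "\<rho> powr (2 * s) * \<rho> powr - (2 * s) = 1" using \<rho> by (simp flip: powr_add)
      then show ?thesis using \<rho> by (simp add: t_eq)
    qed
    ultimately show "\<bar>v - C / (2 * g0) * frac_curv s E y\<bar> \<le> \<epsilon>" by (simp only:)
  qed
qed


section \<open>Second order expansion of the deviation\<close>

lemma k_horizontal_measurable: "(\<lambda>x. k \<rho> (x, 0)) \<in> borel_measurable borel"
  using measurable_compose[OF borel_measurable_continuous_onI k_measurable, of "\<lambda>x. (x, 0)"]
  by (simp add: continuous_intros)

lemma k_horizontal_le: "k \<rho> (x, 0) \<le> \<rho> powr - N * Cc"
proof -
  have "0 < 1 + norm ((x, 0) /\<^sub>R \<rho>) powr p" by (simp add: add_pos_nonneg)
  then have "Cc / (1 + norm ((x, 0) /\<^sub>R \<rho>) powr p) \<le> Cc"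
    using Cc_pos by (simp add: divide_le_eq)
  then show ?thesis unfolding k_def using P_upper[of "(x, 0) /\<^sub>R \<rho>"] by (intro mult_left_mono) auto
qed

lemma second_moment_integrable:
  assumes \<rho>: "0 < \<rho>"
  shows "integrable lborel (\<lambda>x. (norm x)\<^sup>2 * (k \<rho> (x, 0) * indicator (ball 0 r) x))"
proof (rule Bochner_Integration.integrable_bound)
  note [measurable] = k_horizontal_measurable
  have [measurable]: "ball (0::'m) r \<in> sets borel" by simp
  show "(\<lambda>x. (norm x)\<^sup>2 * (k \<rho> (x, 0) * indicator (ball 0 r) x)) \<in> borel_measurable lborel" by measurable
  show "integrable lborel (\<lambda>x::'m. r\<^sup>2 * (\<rho> powr - N * Cc) * indicator (ball 0 r) x)"
    using emeasure_lborel_ball_finite[of "0::'m" r] by (intro integrable_mult_right integrable_real_indicator) auto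
  show "AE x in lborel. norm ((norm x)\<^sup>2 * (k \<rho> (x, 0) * indicator (ball 0 r) x))
    \<le> norm (r\<^sup>2 * (\<rho> powr - N * Cc) * indicator (ball (0::'m) r) x)"
  proof (rule AE_I2)
    fix x :: 'm
    show "norm ((norm x)\<^sup>2 * (k \<rho> (x, 0) * indicator (ball 0 r) x)) \<le> norm (r\<^sup>2 * (\<rho> powr - N * Cc) * indicator (ball (0::'m) r) x)"
    proof (cases "norm x < r")
      case True
      then have "(norm x)\<^sup>2 * k \<rho> (x, 0) \<le> r\<^sup>2 * (\<rho> powr - N * Cc)"
        using k_horizontal_le[of \<rho> x] k_pos[OF \<rho>, of "(x, 0)"] by (intro mult_mono power_mono) auto
      then show ?thesis using True k_pos[OF \<rho>, of "(x, 0)"] Cc_pos by (simp add: abs_mult)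
    qed simp
  qed
qed

text \<open>The bound \<open>k \<le> Kb \<rho>\<^bsup>\<kappa> - N\<^esup> \<bar>z\<bar>\<^bsup>-\<kappa>\<^esup>\<close> with \<open>\<kappa> = N + s\<close> first gives \<open>a = O(\<rho>\<^sup>s)\<close>; then the quadratic error \<open>a\<^sup>2\<close> is of the
  admissible size \<open>\<rho>\<^bsup>2s\<^esup>\<close>, without logarithms even for \<open>s = 1/2\<close>.\<close>

lemma deviation_expansion:
  fixes q :: "'m \<Rightarrow> real"
  assumes s2: "1 / 2 \<le> s" and M: "0 \<le> M" and r1: "0 < r1"
    and B: "0 \<le> B" and B_le: "(\<integral>\<^sup>+z. ennreal (norm z powr - p) * indicator (thin q M 3 r1) z \<partial>lborel) \<le> ennreal B"
    and J1: "J1 = enn2real (\<integral>\<^sup>+(x::'m). ennreal (norm x powr (1 - p + 2)) * indicator (ball 0 r1) x \<partial>lborel)"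
    and J2: "J2 = enn2real (\<integral>\<^sup>+(x::'m). ennreal (norm x powr (- N - s + 2)) * indicator (ball 0 r1) x \<partial>lborel)"
    and E: "open E" and R: "orthogonal_transformation R" and sq: "squeezed E y R q M 3 (2 * r1)"
    and q: "continuous_on UNIV q" and q_le: "\<And>x. \<bar>q x\<bar> \<le> M * (norm x)\<^sup>2"
    and \<rho>: "0 < \<rho>" "\<rho> \<le> 1" and a: "\<bar>a\<bar> \<le> 1"
    and zero: "uu P s E (y + (a * \<rho>) *\<^sub>R R (0, 1)) (\<rho> powr (2 * s)) = 0"
    and K2: "K2 = (2 * Kb * B + 4 * Kb * M * J2) / lower_const"
  shows "\<bar>2 * g0 * a - 2 * (LBINT x. q x * (k \<rho> (x, 0) * indicator (ball 0 r1) x))\<bar>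
    \<le> (quad_const * K2\<^sup>2 + 2 * Kb * B + 4 * Cc * M\<^sup>2 * J1 + 4 * Cc * K2 * M * J2) * \<rho> powr (2 * s)"
proof -
  have q_m[measurable]: "q \<in> borel_measurable borel" using q by (rule borel_measurable_continuous_onI)
  note [measurable] = tau_rigid_measurable[OF E R, of y] k_horizontal_measurable
  have J: "0 \<le> J1" "0 \<le> J2" by (simp_all add: J1 J2)
  have K2_0: "0 \<le> K2" using Kb_pos B M J lower_const_pos by (simp add: K2)
  define q' where "q' x = q x * indicator (ball 0 r1) x" for x
  have ball_m[measurable]: "ball (0::'m) r1 \<in> sets borel" by simp
  have q'_m[measurable]: "q' \<in> borel_measurable borel" unfolding q'_def[abs_def] by measurable
  define h where "h = a * \<rho>"
  have h: "\<bar>h\<bar> = \<bar>a\<bar> * \<rho>" using \<rho> by (simp add: h_def abs_mult)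
  have w: "norm ((0, h) :: 'm \<times> real) \<le> \<rho>" using a \<rho> by (simp add: norm_Pair h mult_left_le_one_le)
  \<comment> \<open>The layer between the tangent plane and the truncated paraboloid. With
    \<open>d\<close> below, \<open>tau E (y + R z) + sgn (snd z)\<close> equals
    \<open>d z - D z\<close>: \<open>d\<close> is supported in a cubically thin set, and
    \<open>D\<close> carries the curvature.\<close>
  define D where "D z = psi (- q' (fst z)) (snd z)" for z :: "'m \<times> real"
  have D_m[measurable]: "D \<in> borel_measurable borel" unfolding D_def[abs_def] by measurable
  let ?S = "{z :: 'm \<times> real. norm (fst z) < r1 \<and> \<bar>snd z\<bar> \<le> M * norm (fst z) powr 2}"
  have D_le: "\<bar>D z\<bar> \<le> 2 * indicator ?S z" for z
  proof (cases "z \<in> ?S")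
    case True
    then show ?thesis using abs_psi_le by (simp add: D_def)
  next
    case False
    have "D z = 0"
    proof (cases "norm (fst z) < r1")
      case True
      then have "M * (norm (fst z))\<^sup>2 < \<bar>snd z\<bar>" using False by (simp add: powr_numeral)
      then have "\<bar>- q' (fst z)\<bar> < \<bar>snd z\<bar>" using q_le[of "fst z"] True by (simp add: q'_def)
      then show ?thesis unfolding D_def by (rule psi_support)
    next
      case False
      then show ?thesis by (simp add: D_def q'_def psi_def)
    qed
    then show ?thesis using False by simp
  qed
  define d where "d z = tau E (y + R z) + sgn (snd z - q' (fst z))" for z
  have d_m[measurable]: "d \<in> borel_measurable borel" unfolding d_def[abs_def] by measurable
  have d_le: "\<bar>d z\<bar> \<le> 2 * indicator (thin q M 3 r1) z" for z
    using tau_sgn_thin[OF sq R q _ M, of q' z] by (simp add: d_def q'_def)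
  define f1 where "f1 z = k \<rho> (z - (0, h)) * d z" for z
  define f2 where "f2 z = k \<rho> (z - (0, h)) * D z" for z
  define f3 where "f3 z = k \<rho> (fst z, 0) * D z" for z
  \<comment> \<open>The kernel is frozen in two stages, first from height \<open>snd z - h\<close>
    to \<open>- h\<close>, then from \<open>- h\<close> to \<open>0\<close>. The displacements,
    \<open>snd z\<close> of order |x'|^2 and \<open>h\<close> of order rho^(1+s), call for different
    decay exponents in \<open>k_vertical_diff\<close>.\<close>
  define h1 where "h1 z = (k \<rho> (z - (0, h)) - k \<rho> (fst z, - h)) * D z" for z
  define h2 where "h2 z = (k \<rho> (fst z, - h) - k \<rho> (fst z, 0)) * D z" for z
  have kfst_m[measurable]: "(\<lambda>z::'m \<times> real. k \<rho> (fst z, \<zeta>)) \<in> borel_measurable borel" for \<zeta>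
    using measurable_compose[OF borel_measurable_continuous_onI k_measurable, of "\<lambda>z. (fst z, \<zeta>)" \<rho>]
    by (simp add: continuous_intros)
  have ms: "f1 \<in> borel_measurable borel" "f2 \<in> borel_measurable borel" "h1 \<in> borel_measurable borel" "h2 \<in> borel_measurable borel"
    unfolding f1_def[abs_def] f2_def[abs_def] h1_def[abs_def] h2_def[abs_def] by measurable
  have f1_le: "\<bar>f1 z\<bar> \<le> 2 * Kb * \<rho> powr (2 * s) * norm z powr - p * indicator (thin q M 3 r1) z" if "z \<noteq> 0" for z
  proof -
    have "k \<rho> (z - (0, h)) \<le> Kb * \<rho> powr (p - N) * norm z powr - p"
      using p_gt N_gt that by (intro k_shift_le[OF \<rho>(1) w]) auto
    then have kl: "k \<rho> (z - (0, h)) \<le> Kb * \<rho> powr (2 * s) * norm z powr - p" by (simp add: p_eq)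
    have "\<bar>f1 z\<bar> = k \<rho> (z - (0, h)) * \<bar>d z\<bar>"
      using k_pos[OF \<rho>(1), of "z - (0, h)"] by (simp add: f1_def abs_mult)
    also have "\<dots> \<le> (Kb * \<rho> powr (2 * s) * norm z powr - p) * (2 * indicator (thin q M 3 r1) z)"
      using Kb_pos by (intro mult_mono kl d_le) auto
    finally show ?thesis by (simp add: mult_ac)
  qed
  have c1: "0 \<le> 2 * Kb * \<rho> powr (2 * s)" using Kb_pos by simp
  note f1_int = dominated_by_thin[OF ms(1) q_m c1 B B_le f1_le]
  \<comment> \<open>Both exponents already include the width of the layer, of order |x'|^2; both
    conditions amount to \<open>s < 1\<close>.\<close>
  have e1: "- real DIM('m) < - N - s + 2" "- real DIM('m) < 1 - p + 2" using s by (simp_all add: real_DIM p_eq)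
  have f2_le: "\<bar>f2 z\<bar> \<le> (2 * Kb * \<rho> powr s) * norm (fst z) powr (- N - s) * indicator ?S z" if "fst z \<noteq> 0" for z
  proof -
    have "z \<noteq> 0" using that by auto
    then have "k \<rho> (z - (0, h)) \<le> Kb * \<rho> powr ((N + s) - N) * norm z powr - (N + s)"
      using p_gt N_gt s by (intro k_shift_le[OF \<rho>(1) w]) (auto simp: p_eq)
    also have "\<dots> \<le> Kb * \<rho> powr s * norm (fst z) powr - (N + s)"
      using Kb_pos that norm_fst_le'[of z] N_gt s by (simp add: mult_left_mono powr_mono2')
    finally have kl: "k \<rho> (z - (0, h)) \<le> Kb * \<rho> powr s * norm (fst z) powr (- N - s)" by simp
    have "\<bar>f2 z\<bar> = k \<rho> (z - (0, h)) * \<bar>D z\<bar>"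
      using k_pos[OF \<rho>(1), of "z - (0, h)"] by (simp add: f2_def abs_mult)
    also have "\<dots> \<le> (Kb * \<rho> powr s * norm (fst z) powr (- N - s)) * (2 * indicator ?S z)"
      using Kb_pos by (intro mult_mono kl D_le) auto
    finally show ?thesis by (simp add: mult_ac)
  qed
  have c2: "0 \<le> 2 * Kb * \<rho> powr s" using Kb_pos by simp
  note f2_int = thin_region_integral[OF ms(2) c2 M e1(1) f2_le]
  define A where "A = (LBINT w. P w * psi a (snd w))"
  have "A = (LBINT z. k \<rho> (z - (0, h)) * (tau E (y + R z) + sgn (snd z)))"
    unfolding A_def h_def by (rule half_space_deviation[OF E R \<rho>(1) a zero])
  also have "\<dots> = (LBINT z. f1 z - f2 z)"
    by (intro Bochner_Integration.integral_cong refl)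
      (simp add: f1_def f2_def d_def D_def psi_def algebra_simps)
  also have "\<dots> = (LBINT z. f1 z) - (LBINT z. f2 z)"
    by (rule Bochner_Integration.integral_diff[OF f1_int(1) f2_int(1)])
  finally have A_eq: "A = (LBINT z. f1 z) - (LBINT z. f2 z)" .
  have I1: "\<bar>LBINT z. f1 z\<bar> \<le> 2 * Kb * \<rho> powr (2 * s) * B"
    by (rule order_trans[OF integral_abs_bound f1_int(2)])
  have I2: "\<bar>LBINT z. f2 z\<bar> \<le> 2 * (2 * Kb * \<rho> powr s) * M * J2"
    unfolding J2 by (rule order_trans[OF integral_abs_bound f2_int(2)])
  have rs: "\<rho> powr (2 * s) \<le> \<rho> powr s"
    using \<rho> s by (intro powr_mono') auto
  have "\<bar>A\<bar> \<le> (2 * Kb * B + 4 * Kb * M * J2) * \<rho> powr s"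
  proof -
    have "2 * Kb * \<rho> powr (2 * s) * B \<le> 2 * Kb * \<rho> powr s * B"
      using rs Kb_pos B by (intro mult_right_mono mult_left_mono) auto
    then have "\<bar>A\<bar> \<le> 2 * Kb * \<rho> powr s * B + 2 * (2 * Kb * \<rho> powr s) * M * J2" unfolding A_eq using I1 I2 by linarith
    then show ?thesis by (simp add: algebra_simps)
  qed
  moreover have "lower_const * \<bar>a\<bar> \<le> \<bar>A\<bar>" using half_space_lower[OF a] by (simp add: A_def)
  ultimately have "lower_const * \<bar>a\<bar> \<le> lower_const * (K2 * \<rho> powr s)" using lower_const_pos by (simp add: K2)
  then have a_le: "\<bar>a\<bar> \<le> K2 * \<rho> powr s" using lower_const_pos by simp
  have ss: "\<rho> powr s * \<rho> powr s = \<rho> powr (2 * s)" by (simp flip: powr_add)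
  have A_a: "\<bar>A - 2 * g0 * a\<bar> \<le> quad_const * K2\<^sup>2 * \<rho> powr (2 * s)"
  proof -
    have "\<bar>A - 2 * g0 * a\<bar> \<le> quad_const * a\<^sup>2" using half_space_quadratic[of a] by (simp add: A_def)
    also have "a\<^sup>2 \<le> (K2 * \<rho> powr s)\<^sup>2" using power_mono[OF a_le, of 2] by simp
    also have "quad_const * (K2 * \<rho> powr s)\<^sup>2 = quad_const * K2\<^sup>2 * (\<rho> powr s * \<rho> powr s)" by (simp only: power2_eq_square mult_ac)
    finally show ?thesis using quad_const_nonneg by (simp add: ss mult_left_mono)
  qed
  have h1_le: "\<bar>h1 z\<bar> \<le> (2 * Cc * M * \<rho> powr (2 * s)) * norm (fst z) powr (1 - p) * indicator ?S z" if z: "fst z \<noteq> 0" for z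
  proof (cases "z \<in> ?S")
    case False
    then show ?thesis using D_le[of z] by (simp add: h1_def)
  next
    case True
    let ?x = "norm (fst z)"
    \<comment> \<open>The maximal exponent \<open>p + 1\<close> is affordable here, since the
      displacement supplies two more powers of the horizontal norm; it gives the factor
      \<open>\<rho> powr (2 * s)\<close> at once.\<close>
    have "\<bar>k \<rho> (fst z, snd z - h) - k \<rho> (fst z, - h)\<bar> \<le> Cc * \<rho> powr ((p + 1) - N - 1) * ?x powr - (p + 1) * \<bar>snd z - h - - h\<bar>"
      using p_gt N_gt z by (intro k_vertical_diff[OF \<rho>(1)]) auto
    also have "z - (0, h) = (fst z, snd z - h)" by (cases z) simp
    then have "k \<rho> (fst z, snd z - h) = k \<rho> (z - (0, h))" by simp
    also have "Cc * \<rho> powr ((p + 1) - N - 1) * ?x powr - (p + 1) * \<bar>snd z - h - - h\<bar> \<le> Cc * \<rho> powr ((p + 1) - N - 1) * ?x powr - (p + 1) * (M * ?x powr 2)"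
      using True Cc_pos by (intro mult_left_mono) auto
    also have "\<dots> = Cc * M * \<rho> powr (2 * s) * (?x powr - (p + 1) * ?x powr 2)" by (simp add: p_eq mult_ac)
    also have "?x powr - (p + 1) * ?x powr 2 = ?x powr (1 - p)" by (simp only: powr_add[symmetric]) simp
    finally have kl: "\<bar>k \<rho> (z - (0, h)) - k \<rho> (fst z, - h)\<bar> \<le> Cc * M * \<rho> powr (2 * s) * ?x powr (1 - p)" .
    have "\<bar>h1 z\<bar> = \<bar>k \<rho> (z - (0, h)) - k \<rho> (fst z, - h)\<bar> * \<bar>D z\<bar>" by (simp add: h1_def abs_mult)
    also have "\<dots> \<le> (Cc * M * \<rho> powr (2 * s) * ?x powr (1 - p)) * (2 * indicator ?S z)"
      using Cc_pos M by (intro mult_mono kl D_le) auto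
    finally show ?thesis by (simp add: mult_ac)
  qed
  have c3: "0 \<le> 2 * Cc * M * \<rho> powr (2 * s)" using Cc_pos M by simp
  note h1_int = thin_region_integral[OF ms(3) c3 M e1(2) h1_le]
  have h2_le: "\<bar>h2 z\<bar> \<le> (2 * Cc * K2 * \<rho> powr (2 * s)) * norm (fst z) powr (- N - s) * indicator ?S z" if z: "fst z \<noteq> 0" for z
  proof -
    let ?x = "norm (fst z)"
    \<comment> \<open>With exponent \<open>N + s\<close> the kernel contributes
      \<open>\<rho> powr (s - 1)\<close>; the missing power of the scale comes from the smallness of
      \<open>h\<close> just obtained.\<close>
    have "\<bar>k \<rho> (fst z, - h) - k \<rho> (fst z, 0)\<bar> \<le> Cc * \<rho> powr ((N + s) - N - 1) * ?x powr - (N + s) * \<bar>- h - 0\<bar>"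
      using p_gt N_gt s z by (intro k_vertical_diff[OF \<rho>(1)]) (auto simp: p_eq)
    also have "\<dots> \<le> Cc * \<rho> powr ((N + s) - N - 1) * ?x powr - (N + s) * (K2 * \<rho> powr s * \<rho>)"
      using a_le Cc_pos \<rho> by (intro mult_left_mono) (auto simp: h mult_right_mono)
    also have "\<dots> = Cc * K2 * (\<rho> powr (s - 1) * \<rho> powr s * \<rho> powr 1) * ?x powr (- N - s)"
      using \<rho> by (simp add: mult_ac)
    also have "\<rho> powr (s - 1) * \<rho> powr s * \<rho> powr 1 = \<rho> powr (2 * s)" by (simp only: powr_add[symmetric]) simp
    finally have kl: "\<bar>k \<rho> (fst z, - h) - k \<rho> (fst z, 0)\<bar> \<le> Cc * K2 * \<rho> powr (2 * s) * ?x powr (- N - s)" .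
    have "\<bar>h2 z\<bar> = \<bar>k \<rho> (fst z, - h) - k \<rho> (fst z, 0)\<bar> * \<bar>D z\<bar>" by (simp add: h2_def abs_mult)
    also have "\<dots> \<le> (Cc * K2 * \<rho> powr (2 * s) * ?x powr (- N - s)) * (2 * indicator ?S z)"
      using Cc_pos K2_0 by (intro mult_mono kl D_le) auto
    finally show ?thesis by (simp add: mult_ac)
  qed
  have c4: "0 \<le> 2 * Cc * K2 * \<rho> powr (2 * s)" using Cc_pos K2_0 by simp
  note h2_int = thin_region_integral[OF ms(4) c4 M e1(1) h2_le]
  have I3: "\<bar>LBINT z. h1 z\<bar> \<le> 2 * (2 * Cc * M * \<rho> powr (2 * s)) * M * J1"
    unfolding J1 by (rule order_trans[OF integral_abs_bound h1_int(2)])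
  have I4: "\<bar>LBINT z. h2 z\<bar> \<le> 2 * (2 * Cc * K2 * \<rho> powr (2 * s)) * M * J2"
    unfolding J2 by (rule order_trans[OF integral_abs_bound h2_int(2)])
  define Q where "Q = (LBINT x. q x * (k \<rho> (x, 0) * indicator (ball 0 r1) x))"
  have q_int: "integrable lborel (\<lambda>x. k \<rho> (x, 0) * - q' x)"
  proof (rule Bochner_Integration.integrable_bound[OF integrable_mult_right[OF second_moment_integrable[OF \<rho>(1), of r1], of M]])
    show "AE x in lborel. norm (k \<rho> (x, 0) * - q' x) \<le> norm (M * ((norm x)\<^sup>2 * (k \<rho> (x, 0) * indicator (ball 0 r1) x)))"
    proof (rule AE_I2)
      fix x :: 'm
      show "norm (k \<rho> (x, 0) * - q' x) \<le> norm (M * ((norm x)\<^sup>2 * (k \<rho> (x, 0) * indicator (ball 0 r1) x)))"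
        using mult_left_mono[OF q_le[of x], of "k \<rho> (x, 0)"] k_pos[OF \<rho>(1), of "(x, 0)"] M
        by (simp add: q'_def abs_mult indicator_def mult_ac)
    qed
  qed measurable
  have f3_int: "integrable lborel f3" and f3_eq: "(LBINT z. f3 z) = - 2 * Q"
  proof -
    have nq_m: "(\<lambda>x. - q' x) \<in> borel_measurable borel" by measurable
    note I = integral_psi_prod[OF k_horizontal_measurable nq_m q_int]
    show "integrable lborel f3" using I(1) by (simp add: f3_def[abs_def] D_def)
    have "(LBINT x. k \<rho> (x, 0) * - q' x) = (LBINT x. - (q x * (k \<rho> (x, 0) * indicator (ball 0 r1) x)))"
      by (intro Bochner_Integration.integral_cong refl) (simp add: q'_def mult_ac)
    also have "\<dots> = - Q" by (simp add: Q_def)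
    finally show "(LBINT z. f3 z) = - 2 * Q" using I(2) by (simp add: f3_def[abs_def] D_def)
  qed
  have "(LBINT z. f2 z) = (LBINT z. h1 z + h2 z + f3 z)"
    by (intro Bochner_Integration.integral_cong refl) (simp add: f2_def h1_def h2_def f3_def algebra_simps)
  also have "\<dots> = (LBINT z. h1 z) + (LBINT z. h2 z) + (LBINT z. f3 z)"
    using h1_int(1) h2_int(1) f3_int
    by (simp add: Bochner_Integration.integral_add Bochner_Integration.integrable_add)
  finally have "A - 2 * Q = (LBINT z. f1 z) - (LBINT z. h1 z) - (LBINT z. h2 z)"
    unfolding A_eq f3_eq by simp
  then have "\<bar>2 * g0 * a - 2 * Q\<bar> \<le> quad_const * K2\<^sup>2 * \<rho> powr (2 * s) + 2 * Kb * \<rho> powr (2 * s) * B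
      + 2 * (2 * Cc * M * \<rho> powr (2 * s)) * M * J1 + 2 * (2 * Cc * K2 * \<rho> powr (2 * s)) * M * J2"
    using A_a I1 I3 I4 by linarith
  also have "\<dots> = (quad_const * K2\<^sup>2 + 2 * Kb * B + 4 * Cc * M\<^sup>2 * J1 + 4 * Cc * K2 * M * J2) * \<rho> powr (2 * s)"
    by (simp add: algebra_simps power2_eq_square)
  finally show ?thesis unfolding Q_def .
qed

end

section \<open>The critical time scale\<close>

text \<open>On the branch the right side is -x^2 ln x, which increases strictly up to its maximum
  \<open>exp (- 1) / 2\<close> at \<open>exp (- 1 / 2)\<close>. So every smaller positive
  \<open>t\<close> is attained exactly once.\<close>

lemma sigma_half:
  assumes t: "0 < t" "t < exp (- 1) / 2"
  shows "0 < sigma (1 / 2) t \<and> sigma (1 / 2) t < exp (- 1 / 2) \<and> t = (sigma (1 / 2) t)\<^sup>2 * \<bar>ln (sigma (1 / 2) t)\<bar>"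
proof -
  define f where "f x = - (x\<^sup>2 * ln x)" for x :: real
  have f_eq: "x\<^sup>2 * \<bar>ln x\<bar> = f x" if "0 < x" "x \<le> exp (- 1 / 2)" for x
  proof -
    have "x < 1" using that(2) by (rule le_less_trans) simp
    then have "ln x \<le> 0" using that by simp
    then show ?thesis by (simp add: f_def)
  qed
  have der: "(f has_real_derivative - x * (2 * ln x + 1)) (at x)" if "0 < x" for x
    unfolding f_def[abs_def] using that
    by (auto intro!: derivative_eq_intros simp: power2_eq_square field_simps)
  have cont: "isCont f x" if "0 < x" for x using der[OF that] by (rule DERIV_isCont)
  have mono: "f x < f y" if "0 < x" "x < y" "y \<le> exp (- 1 / 2)" for x y
  proof (rule DERIV_pos_imp_increasing_open[OF that(2)])
    fix w assume w: "x < w" "w < y"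
    then have "ln w < ln (exp (- 1 / 2))" using that by (subst ln_less_cancel_iff) auto
    then have "0 < - w * (2 * ln w + 1)" using w that by (intro mult_neg_neg) auto
    then show "\<exists>d. (f has_real_derivative d) (at w) \<and> 0 < d" using der[of w] w that by auto
  next
    show "continuous_on {x..y} f"
      using that by (intro continuous_at_imp_continuous_on ballI cont) auto
  qed
  \<comment> \<open>Left end for the intermediate value theorem: \<open>- ln a \<le> 1 / a\<close>
    gives \<open>f a \<le> a\<close>, which is at most \<open>t\<close>.\<close>
  define a where "a = min t (exp (- 1 / 2))"
  have a: "0 < a" "a \<le> exp (- 1 / 2)" "a \<le> t" using t by (auto simp: a_def)
  have fe: "f (exp (- 1 / 2)) = exp (- 1) / 2"
    by (simp add: f_def power2_eq_square flip: exp_add)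
  have fa: "f a \<le> t"
  proof -
    have "ln (1 / a) \<le> 1 / a - 1" using a by (intro ln_le_minus_one) simp
    then have "- ln a \<le> 1 / a" using a by (simp add: ln_div)
    then have "a\<^sup>2 * - ln a \<le> a\<^sup>2 * (1 / a)" by (rule mult_left_mono) simp
    also have "\<dots> = a" using a by (simp add: power2_eq_square)
    finally show ?thesis using a by (simp add: f_def)
  qed
  obtain \<sigma> where \<sigma>: "a \<le> \<sigma>" "\<sigma> \<le> exp (- 1 / 2)" "f \<sigma> = t"
  proof -
    have "\<exists>x\<ge>a. x \<le> exp (- 1 / 2) \<and> f x = t"
      by (rule IVT) (use fa fe t a cont in auto)
    then show thesis using that by blast
  qed
  have ne: "\<sigma> \<noteq> exp (- 1 / 2)" using \<sigma>(3) fe t by auto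
  let ?Q = "\<lambda>\<sigma>. 0 < \<sigma> \<and> \<sigma> < exp (- 1 / 2) \<and> t = \<sigma>\<^sup>2 * \<bar>ln \<sigma>\<bar>"
  have Q: "?Q \<sigma>" using \<sigma> ne a f_eq[of \<sigma>] by auto
  moreover have "x = \<sigma>" if "?Q x" for x
  proof (rule ccontr)
    assume "x \<noteq> \<sigma>"
    then consider "x < \<sigma>" | "\<sigma> < x" by linarith
    then show False
    proof cases
      case 1
      then have "f x < f \<sigma>" using that Q by (intro mono) auto
      then show False using that \<sigma> f_eq[of x] by simp
    next
      case 2
      then have "f \<sigma> < f x" using that Q by (intro mono) auto
      then show False using that \<sigma> f_eq[of x] by simp
    qed
  qed
  ultimately have "?Q (THE \<sigma>. ?Q \<sigma>)" by (rule theI)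
  then show ?thesis by (simp add: sigma_def)
qed

context fractional_kernel
begin

section \<open>Motion by mean curvature for s at least 1/2\<close>

text \<open>The moment is still cut off at the local radius \<open>r\<close>, a geometric quantity.
  The bound on the mean curvature is carried along because exchanging this moment for the one in the
  theorem multiplies the difference by the curvature.\<close>

lemma classical_motion:
  assumes s2: "1 / 2 \<le> s" and E: "open E" and bd: "boundary_C3 E" and K: "compact K" "K \<subseteq> frontier E"
  obtains r M K1 where "0 < r" "r \<le> 1" "0 \<le> M" "0 \<le> K1"
    and "\<And>\<rho> t y v. 0 < \<rho> \<Longrightarrow> \<rho> \<le> 1 \<Longrightarrow> y \<in> K \<Longrightarrow> sigma s t = \<rho> powr (2 * s) \<Longrightarrow>
      y + (v * t) *\<^sub>R ext_normal E y \<in> frontier (Et P s E t) \<inter> ball y (sigma s t powr (1 / (2 * s))) \<Longrightarrow>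
      \<bar>2 * g0 * (v * t / \<rho>) - mean_curv E y * (LBINT x. (norm x)\<^sup>2 * (k \<rho> (x, 0) * indicator (ball 0 r) x))\<bar> \<le> K1 * \<rho> powr (2 * s)
      \<and> \<bar>mean_curv E y\<bar> \<le> 2 * M"
proof -
  obtain r0 M where r0: "0 < r0" and M: "0 \<le> M" and cv0: "\<And>y. y \<in> K \<Longrightarrow> curved E y r0 M"
    using curved_C3[OF E bd K] by blast
  \<comment> \<open>The cap makes the final radius \<open>r / 2\<close> at most 1, so that in the
    critical case its ball lies in the unit ball.\<close>
  define r where "r = min r0 2"
  have r: "0 < r" using r0 by (simp add: r_def)
  have cv: "curved E y r M" if "y \<in> K" for y using curved_mono[OF cv0[OF that]] by (simp add: r_def)
  have r2: "0 < r / 2" using r by simp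
  have "1 + 2 * s < 3" using s by simp
  from thin_bound[OF M r2 this] obtain B where B: "0 \<le> B" "\<And>q :: 'm \<Rightarrow> real. q \<in> borel_measurable borel \<Longrightarrow>
    (\<integral>\<^sup>+z. ennreal (norm z powr - p) * indicator (thin q M 3 (r / 2)) z \<partial>lborel) \<le> ennreal B" by blast
  define J1 where "J1 = enn2real (\<integral>\<^sup>+(x::'m). ennreal (norm x powr (1 - p + 2)) * indicator (ball 0 (r / 2)) x \<partial>lborel)"
  define J2 where "J2 = enn2real (\<integral>\<^sup>+(x::'m). ennreal (norm x powr (- N - s + 2)) * indicator (ball 0 (r / 2)) x \<partial>lborel)"
  define K2 where "K2 = (2 * Kb * B + 4 * Kb * M * J2) / lower_const"
  define K1 where "K1 = quad_const * K2\<^sup>2 + 2 * Kb * B + 4 * Cc * M\<^sup>2 * J1 + 4 * Cc * K2 * M * J2"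
  have J: "0 \<le> J1" "0 \<le> J2" by (simp_all add: J1_def J2_def)
  have K2: "0 \<le> K2" using Kb_pos B(1) M J lower_const_pos by (simp add: K2_def)
  have K1: "0 \<le> K1" using Kb_pos B(1) M J quad_const_nonneg K2 Cc_pos by (simp add: K1_def)
  have main: "\<bar>2 * g0 * a - mean_curv E y * (LBINT x. (norm x)\<^sup>2 * (k \<rho> (x, 0) * indicator (ball 0 (r / 2)) x))\<bar> \<le> K1 * \<rho> powr (2 * s)
      \<and> \<bar>mean_curv E y\<bar> \<le> 2 * M"
    if \<rho>: "0 < \<rho>" "\<rho> \<le> 1" and a: "\<bar>a\<bar> \<le> 1" and y: "y \<in> K" and ch: "chart E y R \<gamma> r'" and C2: "C2_on \<gamma> (ball 0 r')"
      and zero: "uu P s E (y + (a * \<rho>) *\<^sub>R R (0, 1)) (\<rho> powr (2 * s)) = 0" for \<rho> a y R \<gamma> r'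
  proof -
    have R: "orthogonal_transformation R" using ch by (simp add: chart_def)
    then have lin: "linear R" by (rule orthogonal_transformation_linear)
    obtain F :: "'m \<times> real \<Rightarrow> 'm \<times> real \<Rightarrow> real" where F: "bilinear F" and F_le: "\<And>w. \<bar>F w w\<bar> \<le> M * (norm w)\<^sup>2"
      and sq: "\<And>R \<gamma> r'. chart E y R \<gamma> r' \<Longrightarrow> squeezed E y R (\<lambda>x. F (R (x, 0)) (R (x, 0))) M 3 r"
      using cv[OF y] unfolding curved_def by blast
    define G where "G x x' = F (R (x, 0)) (R (x', 0))" for x x'
    have R_add: "R (x + x', 0) = R (x, 0) + R (x', 0)" for x x'
      using linear_add[OF lin, of "(x, 0)" "(x', 0)"] by simp
    have R_scale: "R (c *\<^sub>R x, 0) = c *\<^sub>R R (x, 0)" for c x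
      using linear_scale[OF lin, of c "(x, 0)"] by simp
    have G: "bilinear G" unfolding bilinear_def G_def
      by (intro conjI allI linearI)
        (simp_all add: R_add R_scale bilinear_ladd[OF F] bilinear_radd[OF F] bilinear_lmul[OF F] bilinear_rmul[OF F])
    have Gc: "continuous_on UNIV (\<lambda>x. G x x)"
      using G bounded_bilinear.continuous_on[of G UNIV "\<lambda>x. x" "\<lambda>x. x"]
      by (simp add: bilinear_conv_bounded_bilinear continuous_on_id)
    have G_le: "\<bar>G x x\<bar> \<le> M * (norm x)\<^sup>2" for x
      using F_le[of "R (x, 0)"] R by (simp add: G_def orthogonal_transformation_norm norm_Pair)
    have sqG: "squeezed E y R (\<lambda>x. G x x) M 3 (2 * (r / 2))" using sq[OF ch] by (simp add: G_def)
    have Gm: "(\<lambda>x. G x x) \<in> borel_measurable borel" using Gc by (rule borel_measurable_continuous_onI)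
    let ?f = "\<lambda>x. k \<rho> (x, 0) * indicator (ball 0 (r / 2)) x"
    have pt: "\<bar>2 * g0 * a - 2 * (LBINT x. G x x * ?f x)\<bar> \<le> K1 * \<rho> powr (2 * s)"
      unfolding K1_def
      by (rule deviation_expansion[OF s2 M r2 B(1) B(2)[OF Gm] J1_def J2_def E R sqG Gc G_le \<rho> a zero K2_def])
    have mc: "mean_curv E y = 2 * (\<Sum>b\<in>Basis. G b b) / real DIM('m)"
      unfolding G_def by (rule mean_curv_eq[OF F sq r M ch C2])
    have "(LBINT x. G x x * ?f x) = (\<Sum>b\<in>Basis. G b b) / real DIM('m) * (LBINT x. (norm x)\<^sup>2 * ?f x)"
    proof (rule integral_quadratic_radial[OF _ _ _ G])
      note [measurable] = k_horizontal_measurable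
      have [measurable]: "ball (0::'m) (r / 2) \<in> sets borel" by simp
      show fm: "?f \<in> borel_measurable borel" by measurable
      show "?f x = ?f x'" if "norm x = norm x'" for x x'
      proof -
        have "k \<rho> (x, 0) = k \<rho> (x', 0)" using that by (intro k_radial) (simp add: norm_Pair)
        then show ?thesis using that by (simp add: indicator_def)
      qed
      show "integrable lborel (\<lambda>x. (norm x)\<^sup>2 * ?f x)" by (rule second_moment_integrable[OF \<rho>(1)])
    qed
    then have "2 * (LBINT x. G x x * ?f x) = mean_curv E y * (LBINT x. (norm x)\<^sup>2 * ?f x)"
      by (simp add: mc)
    moreover have "\<bar>mean_curv E y\<bar> \<le> 2 * M"
    proof -
      have "\<bar>\<Sum>b\<in>Basis. G b b\<bar> \<le> (\<Sum>b\<in>(Basis :: 'm set). M)"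
      proof (rule order_trans[OF sum_abs sum_mono])
        fix b :: 'm assume "b \<in> Basis"
        then show "\<bar>G b b\<bar> \<le> M" using G_le[of b] by simp
      qed
      then have "\<bar>\<Sum>b\<in>Basis. G b b\<bar> \<le> real DIM('m) * M" by simp
      then have "\<bar>\<Sum>b\<in>Basis. G b b\<bar> / real DIM('m) \<le> M" by (simp add: divide_le_eq mult.commute)
      then show ?thesis by (simp add: mc abs_mult)
    qed
    ultimately show ?thesis using pt by simp
  qed
  show thesis
  proof (rule that)
    show "0 < r / 2" "r / 2 \<le> 1" "0 \<le> M" "0 \<le> K1" using r M K1 by (auto simp: r_def)
    fix \<rho> t y v
    assume \<rho>: "0 < \<rho>" "\<rho> \<le> 1" and y: "y \<in> K" and sig: "sigma s t = \<rho> powr (2 * s)"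
      and pt: "y + (v * t) *\<^sub>R ext_normal E y \<in> frontier (Et P s E t) \<inter> ball y (sigma s t powr (1 / (2 * s)))"
    obtain R \<gamma> r' where ch: "chart E y R \<gamma> r'" and C3: "C3_on \<gamma> (ball 0 r')"
      using bd K(2) y unfolding boundary_C3_def by blast
    note scaled = motion_rescaled[OF E \<rho>(1) sig pt ch]
    show "\<bar>2 * g0 * (v * t / \<rho>) - mean_curv E y * (LBINT x. (norm x)\<^sup>2 * (k \<rho> (x, 0) * indicator (ball 0 (r / 2)) x))\<bar> \<le> K1 * \<rho> powr (2 * s)
      \<and> \<bar>mean_curv E y\<bar> \<le> 2 * M"
      by (rule main[OF \<rho> scaled(1) y ch C3_on_imp_C2_on[OF C3] scaled(2)])
  qed
qed

lemma second_moment_scale: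
  assumes \<rho>: "0 < \<rho>" and S: "S \<in> sets borel"
  shows "(LBINT x. (norm x)\<^sup>2 * (k \<rho> (x, 0) * indicator S x))
    = \<rho> * (LBINT x. (norm x)\<^sup>2 * (P (x, 0) * indicator S (\<rho> *\<^sub>R x)))"
proof -
  note [measurable] = S
  let ?F = "\<lambda>x. (norm x)\<^sup>2 * (P (x, 0) * indicator S (\<rho> *\<^sub>R x))"
  have "(LBINT x. (norm x)\<^sup>2 * (k \<rho> (x, 0) * indicator S x)) = (LBINT x. \<rho> powr (2 - N) * ?F (x /\<^sub>R \<rho>))"
  proof (intro Bochner_Integration.integral_cong refl)
    fix x :: 'm
    have "\<rho> powr (2 - N) = \<rho>\<^sup>2 * \<rho> powr - N"
      using powr_add[of \<rho> 2 "- N"] \<rho> by (simp add: powr_numeral)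
    moreover have "norm (x /\<^sub>R \<rho>) = norm x / \<rho>" using \<rho> by (simp add: divide_inverse mult.commute)
    ultimately show "(norm x)\<^sup>2 * (k \<rho> (x, 0) * indicator S x) = \<rho> powr (2 - N) * ?F (x /\<^sub>R \<rho>)"
      using \<rho> by (simp add: k_def power_divide)
  qed
  also have "\<dots> = \<rho> powr (2 - N) * (LBINT x. ?F (x /\<^sub>R \<rho>))" by (rule integral_mult_right_zero)
  also have "(LBINT x. ?F (x /\<^sub>R \<rho>)) = \<rho> ^ DIM('m) * (LBINT x. ?F x)"
    by (rule integral_scale(1)[OF \<rho>]) measurable
  also have "\<rho> ^ DIM('m) = \<rho> powr (N - 1)" using powr_realpow[OF \<rho>, of "DIM('m)"] by (simp add: real_DIM)
  also have "\<rho> powr (2 - N) * (\<rho> powr (N - 1) * (LBINT x. ?F x)) = (\<rho> powr (2 - N) * \<rho> powr (N - 1)) * (LBINT x. ?F x)"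
    by simp
  also have "\<rho> powr (2 - N) * \<rho> powr (N - 1) = \<rho>" using \<rho> by (simp flip: powr_add)
  finally show ?thesis .
qed

text \<open>Away from the origin the kernel is O(rho^(2s)) times \<open>norm x powr - p\<close>, so
  changing the region of integration there stays within the admissible error.\<close>

lemma second_moment_tail:
  fixes S :: "'m set"
  assumes r: "0 < r" and S: "S \<in> sets borel" "ball 0 r \<subseteq> S"
    and W: "(\<integral>\<^sup>+x. ennreal (norm x powr (2 - p)) * indicator (S - ball 0 r) x \<partial>lborel) \<le> ennreal W" "0 \<le> W"
    and \<rho>: "0 < \<rho>"
  shows "\<bar>(LBINT x. (norm x)\<^sup>2 * (k \<rho> (x, 0) * indicator S x))
    - (LBINT x. (norm x)\<^sup>2 * (k \<rho> (x, 0) * indicator (ball 0 r) x))\<bar> \<le> Kb * W * \<rho> powr (2 * s)"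
proof -
  note [measurable] = S(1) k_horizontal_measurable
  have [measurable]: "ball (0::'m) r \<in> sets borel" by simp
  let ?u = "\<lambda>x. (norm x)\<^sup>2 * (k \<rho> (x, 0) * indicator (ball 0 r) x)"
  let ?v = "\<lambda>x. (norm x)\<^sup>2 * (k \<rho> (x, 0) * indicator (S - ball 0 r) x)"
  have u: "integrable lborel ?u" by (rule second_moment_integrable[OF \<rho>])
  have v_le: "\<bar>?v x\<bar> \<le> Kb * \<rho> powr (2 * s) * (norm x powr (2 - p) * indicator (S - ball 0 r) x)" for x
  proof (cases "x \<in> S - ball 0 r")
    case True
    then have x: "0 < norm x" using r by auto
    have "k \<rho> ((x, 0) - 0) \<le> Kb * \<rho> powr (p - N) * norm (x, 0::real) powr - p"
      using x \<rho> p_gt N_gt by (intro k_shift_le) (auto simp: zero_prod_def)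
    then have "k \<rho> (x, 0) \<le> Kb * \<rho> powr (2 * s) * norm x powr - p" by (simp add: p_eq norm_Pair)
    then have "(norm x)\<^sup>2 * k \<rho> (x, 0) \<le> (norm x)\<^sup>2 * (Kb * \<rho> powr (2 * s) * norm x powr - p)"
      by (rule mult_left_mono) simp
    also have "\<dots> = Kb * \<rho> powr (2 * s) * ((norm x)\<^sup>2 * norm x powr - p)" by (simp only: mult_ac)
    also have "(norm x)\<^sup>2 * norm x powr - p = norm x powr (2 - p)"
      using powr_add[of "norm x" 2 "- p"] x by (simp add: powr_numeral)
    finally show ?thesis using True k_pos[OF \<rho>, of "(x, 0)"] by (simp add: abs_mult)
  qed simp
  have nn: "(\<integral>\<^sup>+x. ennreal \<bar>?v x\<bar> \<partial>lborel) \<le> ennreal (Kb * W * \<rho> powr (2 * s))"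
  proof -
    have "(\<integral>\<^sup>+x. ennreal \<bar>?v x\<bar> \<partial>lborel)
      \<le> (\<integral>\<^sup>+x. ennreal (Kb * \<rho> powr (2 * s)) * (ennreal (norm x powr (2 - p)) * indicator (S - ball 0 r) x) \<partial>lborel)"
    proof (rule nn_integral_mono)
      fix x
      have "ennreal \<bar>?v x\<bar> \<le> ennreal (Kb * \<rho> powr (2 * s) * (norm x powr (2 - p) * indicator (S - ball 0 r) x))"
        using v_le by (rule ennreal_leI)
      also have "\<dots> = ennreal (Kb * \<rho> powr (2 * s)) * (ennreal (norm x powr (2 - p)) * indicator (S - ball 0 r) x)"
        using Kb_pos by (auto simp: indicator_def ennreal_mult)
      finally show "ennreal \<bar>?v x\<bar> \<le> \<dots>" .
    qed
    also have "\<dots> = ennreal (Kb * \<rho> powr (2 * s)) * (\<integral>\<^sup>+x. ennreal (norm x powr (2 - p)) * indicator (S - ball 0 r) x \<partial>lborel)"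
      by (rule nn_integral_cmult) measurable
    also have "\<dots> \<le> ennreal (Kb * \<rho> powr (2 * s)) * ennreal W" using W(1) by (rule mult_left_mono) simp
    also have "\<dots> = ennreal (Kb * W * \<rho> powr (2 * s))"
      using Kb_pos W(2) by (simp add: mult_ac flip: ennreal_mult)
    finally show ?thesis .
  qed
  have v: "integrable lborel ?v"
  proof (rule integrableI_bounded)
    show "(\<integral>\<^sup>+x. ennreal (norm (?v x)) \<partial>lborel) < \<infinity>"
      unfolding real_norm_def by (rule le_less_trans[OF nn]) simp
  qed measurable
  have "ennreal (LBINT x. \<bar>?v x\<bar>) = (\<integral>\<^sup>+x. ennreal \<bar>?v x\<bar> \<partial>lborel)"
    by (rule nn_integral_eq_integral[symmetric]) (rule integrable_abs[OF v], simp)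
  with nn have "ennreal (LBINT x. \<bar>?v x\<bar>) \<le> ennreal (Kb * W * \<rho> powr (2 * s))" by (simp only:)
  moreover have "0 \<le> Kb * W * \<rho> powr (2 * s)" using Kb_pos W(2) by simp
  ultimately have v_int: "(LBINT x. \<bar>?v x\<bar>) \<le> Kb * W * \<rho> powr (2 * s)" by (simp only: ennreal_le_iff)
  have "(LBINT x. (norm x)\<^sup>2 * (k \<rho> (x, 0) * indicator S x)) = (LBINT x. ?u x + ?v x)"
    using S(2) by (intro Bochner_Integration.integral_cong refl) (auto simp: indicator_def)
  also have "\<dots> = (LBINT x. ?u x) + (LBINT x. ?v x)" by (rule Bochner_Integration.integral_add[OF u v])
  finally have eq: "(LBINT x. (norm x)\<^sup>2 * (k \<rho> (x, 0) * indicator S x)) - (LBINT x. ?u x) = (LBINT x. ?v x)" by simp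
  show ?thesis unfolding eq by (rule order_trans[OF integral_abs_bound v_int])
qed


lemma replace_second_moment:
  assumes "\<bar>x - h * I\<bar> \<le> K1 * e" "\<bar>J - I\<bar> \<le> W * e" "\<bar>h\<bar> \<le> 2 * M" "0 \<le> W" "0 \<le> e"
  shows "\<bar>x - h * J\<bar> \<le> (K1 + 2 * M * W) * (e :: real)"
proof -
  have "\<bar>h * (J - I)\<bar> \<le> 2 * M * (W * e)"
    unfolding abs_mult using assms by (intro mult_mono) auto
  moreover have "x - h * J = (x - h * I) - h * (J - I)" by (simp add: algebra_simps)
  ultimately have "\<bar>x - h * J\<bar> \<le> K1 * e + 2 * M * (W * e)" using assms(1) by linarith
  then show ?thesis by (simp add: algebra_simps)
qed

text \<open>For \<open>s > 1/2\<close> the exponent \<open>2 - p\<close> is itself integrable at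
  infinity and \<open>S\<close> is the whole space. For \<open>s = 1/2\<close> it is the borderline
  one, so \<open>S\<close> is the unit ball, where the exponent may be lowered to
  \<open>- N\<close>.\<close>

lemma outer_moment_bound:
  assumes "0 < r" and exponent: "\<And>x. x \<in> S \<Longrightarrow> r \<le> norm x \<Longrightarrow> norm x powr (2 - p) \<le> norm (x :: 'm) powr e"
    and "e < - real DIM('m)"
  obtains W where "0 \<le> W" "(\<integral>\<^sup>+x. ennreal (norm x powr (2 - p)) * indicator (S - ball 0 r) x \<partial>lborel) \<le> ennreal W"
proof -
  let ?I = "\<integral>\<^sup>+(x::'m). ennreal (norm x powr e) * indicator (- ball 0 r) x \<partial>lborel"
  have fin: "?I < \<infinity>" using assms by (intro nn_integral_norm_powr_outside_ball)
  have "(\<integral>\<^sup>+x. ennreal (norm x powr (2 - p)) * indicator (S - ball 0 r) x \<partial>lborel) \<le> ?I"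
  proof (rule nn_integral_mono)
    fix x :: 'm
    show "ennreal (norm x powr (2 - p)) * indicator (S - ball 0 r) x \<le> ennreal (norm x powr e) * indicator (- ball 0 r) x"
      using exponent[of x] by (auto simp: indicator_def intro!: ennreal_leI)
  qed
  also have "?I = ennreal (enn2real ?I)" using fin by simp
  finally show thesis by (rule that[rotated]) simp
qed

lemma divide_error:
  assumes "\<bar>2 * g * (v * b) - h * (b' * J)\<bar> \<le> e" "0 < g" "0 < b"
  shows "\<bar>v - b' * J / (2 * b * g) * h\<bar> \<le> e / (2 * g * (b :: real))"
proof -
  have "v - b' * J / (2 * b * g) * h = (2 * g * (v * b) - h * (b' * J)) / (2 * g * b)"
    using assms by (simp add: field_simps)
  moreover have "\<bar>(2 * g * (v * b) - h * (b' * J)) / (2 * g * b)\<bar> \<le> e / (2 * g * b)"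
    using assms by (simp add: divide_right_mono)
  ultimately show ?thesis by simp
qed

lemma critical_motion:
  assumes s2: "s = 1 / 2" and E: "open E" and bd: "boundary_C3 E" and K: "compact K" "K \<subseteq> frontier E"
  shows "\<exists>M \<delta>. 0 < \<delta> \<and> (\<forall>t y v. 0 < t \<and> t < \<delta> \<and> y \<in> K \<and>
    y + (v * t) *\<^sub>R ext_normal E y \<in> frontier (Et P s E t) \<inter> ball y (sigma s t powr (1 / (2 * s)))
    \<longrightarrow> \<bar>v - (LINT z:ball 0 (1 / sigma s t)|lborel. (norm z)\<^sup>2 * P (z, 0))
              / (2 * \<bar>ln (sigma s t)\<bar> * g0) * mean_curv E y\<bar> \<le> M * \<bar>1 / ln (sigma s t)\<bar>)"
proof -
  have "1 / 2 \<le> s" using s2 by simp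
  from classical_motion[OF this E bd K] obtain r M K1 where r: "0 < r" "r \<le> 1" and M: "0 \<le> M" and K1: "0 \<le> K1"
    and main: "\<And>\<rho> t y v. 0 < \<rho> \<Longrightarrow> \<rho> \<le> 1 \<Longrightarrow> y \<in> K \<Longrightarrow> sigma s t = \<rho> powr (2 * s) \<Longrightarrow>
      y + (v * t) *\<^sub>R ext_normal E y \<in> frontier (Et P s E t) \<inter> ball y (sigma s t powr (1 / (2 * s))) \<Longrightarrow>
      \<bar>2 * g0 * (v * t / \<rho>) - mean_curv E y * (LBINT x. (norm x)\<^sup>2 * (k \<rho> (x, 0) * indicator (ball 0 r) x))\<bar> \<le> K1 * \<rho> powr (2 * s)
      \<and> \<bar>mean_curv E y\<bar> \<le> 2 * M" by blast
  \<comment> \<open>The unit ball appears because the ball of radius \<open>1 / sigma s t\<close> in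
    the theorem becomes it after scaling by \<open>\<rho> = sigma s t\<close>.\<close>
  obtain W where W: "0 \<le> W" "(\<integral>\<^sup>+x. ennreal (norm x powr (2 - p)) * indicator (ball (0::'m) 1 - ball 0 r) x \<partial>lborel) \<le> ennreal W"
  proof (rule outer_moment_bound[OF r(1), of "ball 0 1" "- N"])
    fix x :: 'm assume "x \<in> ball 0 1" "r \<le> norm x"
    then show "norm x powr (2 - p) \<le> norm x powr - N"
      using r s2 by (intro powr_mono') (auto simp: p_eq)
  qed (auto simp: real_DIM)
  define M' where "M' = (K1 + 2 * M * (Kb * W)) / (2 * g0)"
  have KW: "0 \<le> Kb * W" using Kb_pos W by simp
  show ?thesis
  proof (rule exI[of _ M'], rule exI[of _ "exp (- 1) / 2"], intro conjI allI impI)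
    fix t y v
    assume H: "0 < t \<and> t < exp (- 1) / 2 \<and> y \<in> K \<and>
      y + (v * t) *\<^sub>R ext_normal E y \<in> frontier (Et P s E t) \<inter> ball y (sigma s t powr (1 / (2 * s)))"
    define \<rho> where "\<rho> = sigma s t"
    have \<rho>: "0 < \<rho>" "\<rho> < exp (- 1 / 2)" "t = \<rho>\<^sup>2 * \<bar>ln \<rho>\<bar>"
      using sigma_half[of t] H by (auto simp: \<rho>_def s2)
    have \<rho>1: "\<rho> < 1" using \<rho>(2) by (rule less_trans) simp
    have L: "0 < \<bar>ln \<rho>\<bar>" using \<rho> \<rho>1 by simp
    have pw: "\<rho> powr (2 * s) = \<rho>" unfolding s2 using \<rho> by simp
    have sig: "sigma s t = \<rho> powr (2 * s)" unfolding pw by (simp add: \<rho>_def)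
    let ?I = "\<lambda>S. \<integral>x. (norm x)\<^sup>2 * (k \<rho> (x, 0) * indicator S x) \<partial>lborel"
    let ?J = "LINT z:ball 0 (1 / \<rho>)|lborel. (norm z)\<^sup>2 * P (z, 0)"
    from main[OF \<rho>(1) less_imp_le[OF \<rho>1] _ sig, of y v] H
    have 1: "\<bar>2 * g0 * (v * t / \<rho>) - mean_curv E y * ?I (ball 0 r)\<bar> \<le> K1 * \<rho>" "\<bar>mean_curv E y\<bar> \<le> 2 * M"
      unfolding pw by blast+
    have 2: "\<bar>?I (ball 0 1) - ?I (ball 0 r)\<bar> \<le> Kb * W * \<rho>"
      using second_moment_tail[OF r(1) _ _ W(2,1) \<rho>(1)] r unfolding pw by (simp add: subset_ball)
    have "?I (ball 0 1) = \<rho> * (LBINT x. (norm x)\<^sup>2 * (P (x, 0) * indicator (ball 0 1) (\<rho> *\<^sub>R x)))"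
      by (rule second_moment_scale[OF \<rho>(1)]) simp
    also have "(LBINT x. (norm x)\<^sup>2 * (P (x, 0) * indicator (ball 0 1) (\<rho> *\<^sub>R x))) = ?J"
      unfolding set_lebesgue_integral_def
      by (intro Bochner_Integration.integral_cong refl) (use \<rho> in \<open>auto simp: indicator_def field_simps\<close>)
    finally have I1: "?I (ball 0 1) = \<rho> * ?J" .
    have "\<bar>2 * g0 * (v * t / \<rho>) - mean_curv E y * (\<rho> * ?J)\<bar> \<le> (K1 + 2 * M * (Kb * W)) * \<rho>"
      using replace_second_moment[OF 1(1) 2 1(2) KW] \<rho> unfolding I1 by simp
    \<comment> \<open>The displacement thus carries the factor
      \<open>\<rho> * \<bar>ln \<rho>\<bar>\<close>; dividing the error of order
      \<open>\<rho>\<close> by it leaves \<open>1 / \<bar>ln \<rho>\<bar>\<close>.\<close>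
    moreover have "v * t / \<rho> = v * (\<rho> * \<bar>ln \<rho>\<bar>)" using \<rho>(1) by (simp add: \<rho>(3) power2_eq_square)
    moreover have "0 < \<rho> * \<bar>ln \<rho>\<bar>" using \<rho> L by simp
    ultimately have "\<bar>v - \<rho> * ?J / (2 * (\<rho> * \<bar>ln \<rho>\<bar>) * g0) * mean_curv E y\<bar> \<le> (K1 + 2 * M * (Kb * W)) * \<rho> / (2 * g0 * (\<rho> * \<bar>ln \<rho>\<bar>))"
      using g0_pos by (intro divide_error) simp_all
    moreover have "\<rho> * ?J / (2 * (\<rho> * \<bar>ln \<rho>\<bar>) * g0) = ?J / (2 * \<bar>ln \<rho>\<bar> * g0)" using \<rho>(1) by simp
    moreover have "(K1 + 2 * M * (Kb * W)) * \<rho> / (2 * g0 * (\<rho> * \<bar>ln \<rho>\<bar>)) = M' * \<bar>1 / ln \<rho>\<bar>"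
      using \<rho>(1) by (simp add: M'_def)
    ultimately show "\<bar>v - (LINT z:ball 0 (1 / sigma s t)|lborel. (norm z)\<^sup>2 * P (z, 0))
      / (2 * \<bar>ln (sigma s t)\<bar> * g0) * mean_curv E y\<bar> \<le> M' * \<bar>1 / ln (sigma s t)\<bar>"
      by (simp only: \<rho>_def)
  qed simp
qed

lemma supercritical_motion:
  assumes s2: "1 / 2 < s" and E: "open E" and bd: "boundary_C3 E" and K: "compact K" "K \<subseteq> frontier E"
  shows "\<exists>M \<delta>. 0 < \<delta> \<and> (\<forall>t y v. 0 < t \<and> t < \<delta> \<and> y \<in> K \<and>
    y + (v * t) *\<^sub>R ext_normal E y \<in> frontier (Et P s E t) \<inter> ball y (sigma s t powr (1 / (2 * s)))
    \<longrightarrow> \<bar>v - (LBINT z. (norm z)\<^sup>2 * P (z, 0)) / (2 * g0) * mean_curv E y\<bar> \<le> M * t powr ((2 * s - 1) / 2))"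
proof -
  have "1 / 2 \<le> s" using s2 by simp
  from classical_motion[OF this E bd K] obtain r M K1 where r: "0 < r" "r \<le> 1" and M: "0 \<le> M" and K1: "0 \<le> K1"
    and main: "\<And>\<rho> t y v. 0 < \<rho> \<Longrightarrow> \<rho> \<le> 1 \<Longrightarrow> y \<in> K \<Longrightarrow> sigma s t = \<rho> powr (2 * s) \<Longrightarrow>
      y + (v * t) *\<^sub>R ext_normal E y \<in> frontier (Et P s E t) \<inter> ball y (sigma s t powr (1 / (2 * s))) \<Longrightarrow>
      \<bar>2 * g0 * (v * t / \<rho>) - mean_curv E y * (LBINT x. (norm x)\<^sup>2 * (k \<rho> (x, 0) * indicator (ball 0 r) x))\<bar> \<le> K1 * \<rho> powr (2 * s)
      \<and> \<bar>mean_curv E y\<bar> \<le> 2 * M" by blast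
  obtain W where W: "0 \<le> W" "(\<integral>\<^sup>+x. ennreal (norm x powr (2 - p)) * indicator (UNIV - ball (0::'m) r) x \<partial>lborel) \<le> ennreal W"
    by (rule outer_moment_bound[OF r(1), of UNIV "2 - p"]) (use s2 in \<open>auto simp: real_DIM p_eq\<close>)
  define M' where "M' = (K1 + 2 * M * (Kb * W)) / (2 * g0)"
  have KW: "0 \<le> Kb * W" using Kb_pos W by simp
  show ?thesis
  proof (rule exI[of _ M'], rule exI[of _ "1::real"], intro conjI allI impI)
    fix t y v
    assume H: "0 < t \<and> t < 1 \<and> y \<in> K \<and>
      y + (v * t) *\<^sub>R ext_normal E y \<in> frontier (Et P s E t) \<inter> ball y (sigma s t powr (1 / (2 * s)))"
    then have t: "0 < t" "t < 1" by auto
    \<comment> \<open>With this scale the displacement is \<open>v * \<rho>\<close>, so an error of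
      order \<open>\<rho> powr (2 * s)\<close> becomes \<open>\<rho> powr (2 * s - 1)\<close>, the
      claimed power of \<open>t\<close>.\<close>
    define \<rho> where "\<rho> = t powr (1 / 2)"
    have \<rho>: "0 < \<rho>" using t by (simp add: \<rho>_def)
    have \<rho>1: "\<rho> \<le> 1" unfolding \<rho>_def using t by (intro powr_le1) auto
    have t_eq: "t = \<rho> * \<rho>" using t by (simp add: \<rho>_def flip: powr_add)
    have sig: "sigma s t = \<rho> powr (2 * s)" using s2 by (simp add: sigma_def \<rho>_def powr_powr)
    let ?I = "\<lambda>S. \<integral>x. (norm x)\<^sup>2 * (k \<rho> (x, 0) * indicator S x) \<partial>lborel"
    let ?J = "\<integral>z. (norm z)\<^sup>2 * P (z, 0) \<partial>lborel"
    from main[OF \<rho> \<rho>1 _ sig, of y v] H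
    have 1: "\<bar>2 * g0 * (v * t / \<rho>) - mean_curv E y * ?I (ball 0 r)\<bar> \<le> K1 * \<rho> powr (2 * s)" "\<bar>mean_curv E y\<bar> \<le> 2 * M"
      by blast+
    have 2: "\<bar>?I UNIV - ?I (ball 0 r)\<bar> \<le> Kb * W * \<rho> powr (2 * s)"
      by (rule second_moment_tail[OF r(1) _ _ W(2,1) \<rho>]) auto
    have I1: "?I UNIV = \<rho> * ?J"
      using second_moment_scale[OF \<rho>, of UNIV] by simp
    have "\<bar>2 * g0 * (v * t / \<rho>) - mean_curv E y * (\<rho> * ?J)\<bar> \<le> (K1 + 2 * M * (Kb * W)) * \<rho> powr (2 * s)"
      using replace_second_moment[OF 1(1) 2 1(2) KW] unfolding I1 by simp
    moreover have "v * t / \<rho> = v * \<rho>" using \<rho> by (simp add: t_eq)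
    ultimately have "\<bar>v - \<rho> * ?J / (2 * \<rho> * g0) * mean_curv E y\<bar> \<le> (K1 + 2 * M * (Kb * W)) * \<rho> powr (2 * s) / (2 * g0 * \<rho>)"
      using g0_pos \<rho> by (intro divide_error) simp_all
    moreover have "\<rho> * ?J / (2 * \<rho> * g0) = ?J / (2 * g0)" using \<rho> by simp
    moreover have "(K1 + 2 * M * (Kb * W)) * \<rho> powr (2 * s) / (2 * g0 * \<rho>) = M' * t powr ((2 * s - 1) / 2)"
    proof -
      have "t powr ((2 * s - 1) / 2) = \<rho> powr (2 * s - 1)" by (simp add: \<rho>_def powr_powr)
      also have "\<dots> = \<rho> powr (2 * s) / \<rho>" using \<rho> by (simp add: powr_diff)
      finally show ?thesis by (simp add: M'_def)
    qed
    ultimately show "\<bar>v - ?J / (2 * g0) * mean_curv E y\<bar> \<le> M' * t powr ((2 * s - 1) / 2)" by (simp only:)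
  qed simp
qed

end

section \<open>The three ranges of s together\<close>

theorem theorem1p1:
  fixes P :: "'m::euclidean_space \<times> real \<Rightarrow> real"
    and s C Cc :: real
    and E :: "('m \<times> real) set"
  assumes s: "0 < s" "s < 1"
    and P_C1: "\<exists>DP :: ('m \<times> real) \<Rightarrow> ((('m \<times> real)) \<Rightarrow>\<^sub>L real).
                 (\<forall>y. (P has_derivative blinfun_apply (DP y)) (at y)) \<and> continuous_on UNIV DP \<and>
                 (\<forall>y. norm (DP y) \<le> Cc / (1 + norm y powr (real DIM('m \<times> real) + 2 * s + 1)))"
    and P_radial: "\<And>x y. norm x = norm y \<Longrightarrow> P x = P y"
    and Cc_pos: "Cc > 0"
    and P_lower: "\<And>y. 1 / Cc / (1 + norm y powr (real DIM('m \<times> real) + 2 * s)) \<le> P y"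
    and P_upper: "\<And>y. P y \<le> Cc / (1 + norm y powr (real DIM('m \<times> real) + 2 * s))"
    and C_pos: "C > 0"
    and K_lim: "\<And>Kc. compact Kc \<Longrightarrow> 0 \<notin> Kc \<Longrightarrow> \<forall>\<epsilon>>0. \<exists>\<delta>>0. \<forall>t. 0 < t \<and> t < \<delta> \<longrightarrow>
                  (\<forall>y\<in>Kc. \<bar>kernel P s y t / t - C / norm y powr (real DIM('m \<times> real) + 2 * s)\<bar> \<le> \<epsilon>)"
    and E_open: "open E"
    and E_reg_small: "s < 1/2 \<Longrightarrow> \<exists>\<beta>. 2 * s < \<beta> \<and> \<beta> \<le> 1 \<and> boundary_C1beta \<beta> E"
    and E_reg_large: "1/2 \<le> s \<Longrightarrow> boundary_C3 E"
  shows
    "(s < 1/2 \<longrightarrow>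
       (\<forall>Kc. compact Kc \<and> Kc \<subseteq> frontier E \<longrightarrow>
         (\<forall>\<epsilon>>0. \<exists>\<delta>>0. \<forall>t y v. 0 < t \<and> t < \<delta> \<and> y \<in> Kc \<and>
            y + (v * t) *\<^sub>R ext_normal E y \<in> frontier (Et P s E t) \<inter> ball y (sigma s t powr (1 / (2 * s)))
            \<longrightarrow> \<bar>v - C / (2 * (\<integral>z. P (z, 0) \<partial>lborel)) * frac_curv s E y\<bar> \<le> \<epsilon>)))
     \<and>
     (s = 1/2 \<longrightarrow>
       (\<forall>Kc. compact Kc \<and> Kc \<subseteq> frontier E \<longrightarrow>
         (\<exists>M \<delta>. \<delta> > 0 \<and> (\<forall>t y v. 0 < t \<and> t < \<delta> \<and> y \<in> Kc \<and>
            y + (v * t) *\<^sub>R ext_normal E y \<in> frontier (Et P s E t) \<inter> ball y (sigma s t powr (1 / (2 * s)))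
            \<longrightarrow> \<bar>v - (LINT z:ball 0 (1 / sigma s t)|lborel. (norm z)\<^sup>2 * P (z, 0))
                      / (2 * \<bar>ln (sigma s t)\<bar> * (\<integral>z. P (z, 0) \<partial>lborel)) * mean_curv E y\<bar>
                \<le> M * \<bar>1 / ln (sigma s t)\<bar>))))
     \<and>
     (1/2 < s \<longrightarrow>
       (\<forall>Kc. compact Kc \<and> Kc \<subseteq> frontier E \<longrightarrow>
         (\<exists>M \<delta>. \<delta> > 0 \<and> (\<forall>t y v. 0 < t \<and> t < \<delta> \<and> y \<in> Kc \<and>
            y + (v * t) *\<^sub>R ext_normal E y \<in> frontier (Et P s E t) \<inter> ball y (sigma s t powr (1 / (2 * s)))
            \<longrightarrow> \<bar>v - (\<integral>z. (norm z)\<^sup>2 * P (z, 0) \<partial>lborel) / (2 * (\<integral>z. P (z, 0) \<partial>lborel)) * mean_curv E y\<bar>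
                \<le> M * t powr ((2 * s - 1) / 2)))))"
proof -
  obtain DP :: "'m \<times> real \<Rightarrow> ('m \<times> real) \<Rightarrow>\<^sub>L real" where DP: "\<And>y. (P has_derivative blinfun_apply (DP y)) (at y)"
    "\<And>y. norm (DP y) \<le> Cc / (1 + norm y powr (real DIM('m \<times> real) + 2 * s + 1))"
    using P_C1 by blast
  interpret K: fractional_kernel P s Cc "real DIM('m) + 1" "real DIM('m) + 1 + 2 * s" DP
    by unfold_locales (use s DP P_radial Cc_pos P_lower P_upper in blast)+
  show ?thesis
  proof (intro conjI impI allI)
    fix Kc \<epsilon> assume "s < 1 / 2" "compact Kc \<and> Kc \<subseteq> frontier E" "(0::real) < \<epsilon>"
    moreover from E_reg_small[OF this(1)] obtain \<beta> where "2 * s < \<beta>" "boundary_C1beta \<beta> E" by blast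
    ultimately show "\<exists>\<delta>>0. \<forall>t y v. 0 < t \<and> t < \<delta> \<and> y \<in> Kc \<and>
        y + (v * t) *\<^sub>R ext_normal E y \<in> frontier (Et P s E t) \<inter> ball y (sigma s t powr (1 / (2 * s)))
        \<longrightarrow> \<bar>v - C / (2 * (\<integral>z. P (z, 0) \<partial>lborel)) * frac_curv s E y\<bar> \<le> \<epsilon>"
      using K.fractional_motion[OF K_lim _ E_open, of \<beta> Kc \<epsilon>] unfolding K.g0_def by blast
  next
    fix Kc assume half: "s = 1 / 2" and "compact Kc \<and> Kc \<subseteq> frontier E"
    moreover have "boundary_C3 E" using half E_reg_large by simp
    ultimately show "\<exists>M \<delta>. \<delta> > 0 \<and> (\<forall>t y v. 0 < t \<and> t < \<delta> \<and> y \<in> Kc \<and>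
            y + (v * t) *\<^sub>R ext_normal E y \<in> frontier (Et P s E t) \<inter> ball y (sigma s t powr (1 / (2 * s)))
            \<longrightarrow> \<bar>v - (LINT z:ball 0 (1 / sigma s t)|lborel. (norm z)\<^sup>2 * P (z, 0))
                      / (2 * \<bar>ln (sigma s t)\<bar> * (\<integral>z. P (z, 0) \<partial>lborel)) * mean_curv E y\<bar>
                \<le> M * \<bar>1 / ln (sigma s t)\<bar>)"
      using K.critical_motion[OF _ E_open, of Kc] unfolding K.g0_def by blast
  next
    fix Kc assume half: "1 / 2 < s" and "compact Kc \<and> Kc \<subseteq> frontier E"
    moreover have "boundary_C3 E" using half E_reg_large by simp
    ultimately show "\<exists>M \<delta>. \<delta> > 0 \<and> (\<forall>t y v. 0 < t \<and> t < \<delta> \<and> y \<in> Kc \<and>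
            y + (v * t) *\<^sub>R ext_normal E y \<in> frontier (Et P s E t) \<inter> ball y (sigma s t powr (1 / (2 * s)))
            \<longrightarrow> \<bar>v - (\<integral>z. (norm z)\<^sup>2 * P (z, 0) \<partial>lborel) / (2 * (\<integral>z. P (z, 0) \<partial>lborel)) * mean_curv E y\<bar>
                \<le> M * t powr ((2 * s - 1) / 2))"
      using K.supercritical_motion[OF _ E_open, of Kc] unfolding K.g0_def by blast
  qed
qed

end
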